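(* Let $\beta\in\mathbb{Z}_+$. Given $m\in\mathbb{N}$ and $(n_1,\ldots,n_{4m})\in\mathbb{Z}_+^{4m}$, there is a constant $C>0$, independent of $k$ and $\mathbf{d}$, such that for all $k\ge k_0$ and all $\mathbf{d}=(d_1,\ldots,d_{4m})\in\mathbb{N}^{4m}$ with $d_j\ge n_j-1$ for every $j$, $$\|\eta-\hat\eta_\beta\|_{L^2(\partial K)}\le C\,\frac{C_k}{c_k}\,k^{-\frac{\beta}{3}}\sum_{j=1}^{4m}\frac{1+E(k,j)}{(d_j)^{n_j}}$$ for the $\beta$-asymptotic frequency-adapted Galerkin approximation $\hat\eta_\beta\in\sigma_\beta+\mathcal{G}_{\mathbf d}$ to $\eta$. Here, on the transition regions (with $j'\equiv j \bmod m$, $j'\in\{1,\ldots,m-1\}$), $$E(k,j)=k^{-\frac{1-3\epsilon_{j'+1}}{6}}\big(k^{\frac{\epsilon_{j'}-\epsilon_{j'+1}}{2}}\big)^{n_j},\qquad j\in\{1,\ldots,4m\}\setminus\{m,2m,3m,4m\};$$ on the illuminated and shadow regions, $$E(k,j)=\delta_{n_j,1}\sqrt{\log k}+H[n_j-2]\,k^{-\frac{1-3\epsilon_1}{6}}\big(k^{\frac{1-3\epsilon_1}{6}}\big)^{n_j},\qquad j=m,2m;$$ and on the shadow boundaries, $$E(k,j)=k^{-\frac16}(k^{\epsilon_m})^{n_j},\qquad j=3m,4m.$$ Here $\delta$ is the Kronecker delta and $H$ is the Heaviside function, $H[x]=1$ for $x\ge0$ and $H[x]=0$ for $x<0$.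
   Context: Notation: $\mathbb{Z}_+=\{0,1,2,\ldots\}$, $\mathbb{N}=\{1,2,\ldots\}$, $-\mathbb{N}=\{-1,-2,\ldots\}$, $t_-=\min\{t,0\}$; an empty sum is zero. Scattering problem. $K\subset\mathbb{R}^2$ is a compact, strictly convex obstacle with smooth boundary of length $2P$ and exterior unit normal $\nu$; $u^{\rm inc}(x)=e^{ik\alpha\cdot x}$ with $|\alpha|=1$, $k>0$; $u$ is the solution of $(\Delta+k^2)u=0$ in $\mathbb{R}^2\setminus K$, $\partial_\nu u=-\partial_\nu u^{\rm inc}$ on $\partial K$, $\lim_{r=|x|\to\infty}\sqrt r(\partial_r u-iku)=0$. The total field on $\partial K$ is $\eta=u+u^{\rm inc}$. $\gamma$ is the $2P$-periodic counterclockwise arc length parametrization of $\partial K$ for which $\alpha\cdot\nu(\gamma(s))$ vanishes on $[0,2P]$ exactly at $s=t_1,t_2$, with $0<t_1<t_2<2P$, $t_1+t_2=2P$, is negative on $(t_1,t_2)$ (illuminated region) and positive on $[0,t_1)\cup(t_2,2P]$ (shadow region). Functions on $\partial K$ are identified via $\gamma$ with $2P$-periodic functions of $s$; $\eta^{\rm slow}(s,k)=e^{-ik\alpha\cdot\gamma(s)}\eta(s,k)$. Hörmander class: a $C^\infty$ function $a(s,k)$ on $[0,2P]\times(0,\infty)$ belongs to $S^{\mu}_{\varrho,\delta}$ if for all $n,m\in\mathbb{Z}_+$ and every $\kappa>0$ there is $C$ with $|D_s^nD_k^m a(s,k)|\le C k^{\mu+\delta n-\varrho m}$ for $s\in[0,2P]$,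 $k\ge\kappa$. Asymptotic expansion (a known fact). $\eta^{\rm slow}\in S^0_{\frac23,\frac13}$ and $\eta^{\rm slow}\sim\sum_{p,q,r\in\mathbb{Z}_+,\,\ell\in-\mathbb{N}}a_{p,q,r,\ell}$ with $$a_{p,q,r,\ell}(s,k)=k^{-\frac{1+2p+3q+r+\ell}{3}+(\ell+1)_-}\,b_{p,q,r,\ell}(s)\,(\Psi^{r,\ell})^{(p)}(k^{\frac13}Z(s)),$$ where $b_{p,q,r,\ell}$ are $2P$-periodic complex-valued $C^\infty$ functions; $Z$ is a $2P$-periodic real-valued $C^\infty$ function, positive on the illuminated region, negative on the shadow region, vanishing precisely to first order at $t_1,t_2$; $\Psi^{r,\ell}$ are complex-valued $C^\infty$ functions on $\mathbb{R}$ with $\Psi^{r,\ell}(\tau)\sim\sum_{j\in\mathbb{Z}_+}a_{r,\ell,j}\tau^{1+\ell-2r-3j}$ as $\tau\to+\infty$ (in the sense of symbols) and rapidly decreasing with all derivatives as $\tau\to-\infty$. The relation $\sim$ means: for every $M>0$ there is a finite index set $F_M$ such that $\eta^{\rm slow}-\sum_{F}a_{p,q,r,\ell}\in S^{-M}_{\frac23,\frac13}$ for every finite $F\supseteq F_M$. Definition of $\sigma_\beta$. $$\vartheta(p,q,r,\ell)=-\frac{1+2p+3q+r+\ell}{3}+(\ell+1)_-+\begin{cases}0, & 1+\ell-2r-p<0,\\ \frac{1+\ell-2r-p}{3}, & 1+\ell-2r-p\ge 0,\end{cases}$$ $\mathcal{F}_\beta=\{(p,q,r,\ell)\in\mathbb{Z}_+^3\times(-\mathbb{N}):\vartheta(p,q,r,\ell)>-\beta/3\}$,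 $\sigma_\beta^{\rm slow}=\sum_{\mathcal{F}_\beta}a_{p,q,r,\ell}$, $\sigma_\beta=e^{ik\alpha\cdot\gamma}\sigma_\beta^{\rm slow}$, $\rho_\beta=\eta-\sigma_\beta$. Integral equation. For some $k_0>1$ and all $k\ge k_0$, $\eta$ solves an integral equation $\mathcal{R}_k\eta=f$ on $L^2(\partial K)$ where the linear operator $\mathcal{R}_k$ is continuous and coercive with constants $C_k,c_k>0$: $|\langle\mu,\mathcal{R}_k\phi\rangle|\le C_k\|\mu\|\|\phi\|$ and $|\langle\mu,\mathcal{R}_k\mu\rangle|\ge c_k\|\mu\|^2$ for all $\mu,\phi\in L^2(\partial K)$. Put $f_\beta=f-\mathcal{R}_k\sigma_\beta$, so that $\mathcal{R}_k\rho_\beta=f_\beta$. Regions. Fix reals $0<\epsilon_m<\epsilon_{m-1}<\cdots<\epsilon_1<\frac13$ and positive reals $\xi_1,\xi_2,\zeta_1,\zeta_2$ with $t_1+\xi_1<t_2-\xi_2$ and $t_2+\zeta_2<2P+t_1-\zeta_1$. For $j=1,\ldots,m-1$ let (intervals in the parameter domain, modulo $2P$) $R_j=[t_1+\xi_1k^{-\frac13+\epsilon_{j+1}},\,t_1+\xi_1k^{-\frac13+\epsilon_j}]$, $R_{m+j}=[t_2-\xi_2k^{-\frac13+\epsilon_j},\,t_2-\xi_2k^{-\frac13+\epsilon_{j+1}}]$, $R_{2m+j}=[t_1-\zeta_1k^{-\frac13+\epsilon_j},\,t_1-\zeta_1k^{-\frac13+\epsilon_{j+1}}]$, $R_{3m+j}=[t_2+\zeta_2k^{-\frac13+\epsilon_{j+1}},\,t_2+\zeta_2k^{-\frac13+\epsilon_j}]$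 (transition regions; absent if $m=1$), and $R_m=[t_1+\xi_1k^{-\frac13+\epsilon_1},\,t_2-\xi_2k^{-\frac13+\epsilon_1}]$ (illuminated region), $R_{2m}=[t_2+\zeta_2k^{-\frac13+\epsilon_1},\,2P+t_1-\zeta_1k^{-\frac13+\epsilon_1}]$ (shadow region), $R_{3m}=[t_1-\zeta_1k^{-\frac13+\epsilon_m},\,t_1+\xi_1k^{-\frac13+\epsilon_m}]$ and $R_{4m}=[t_2-\xi_2k^{-\frac13+\epsilon_m},\,t_2+\zeta_2k^{-\frac13+\epsilon_m}]$ (shadow boundaries). Galerkin method. $\mathbb{P}_d$ is the space of polynomials of degree at most $d$, $\mathbf{1}_R$ the characteristic function of $R$, and $\mathcal{G}_{\mathbf d}=e^{ik\alpha\cdot\gamma}\bigoplus_{j=1}^{4m}\mathbf{1}_{R_j}\mathbb{P}_{d_j}\subset L^2(\partial K)$. The $\beta$-asymptotic frequency-adapted Galerkin approximation is $\hat\eta_\beta=\sigma_\beta+\hat\rho_\beta$, where $\hat\rho_\beta\in\mathcal{G}_{\mathbf d}$ is the unique solution of $\langle\hat\mu,\mathcal{R}_k\hat\rho_\beta\rangle=\langle\hat\mu,f_\beta\rangle$ for all $\hat\mu\in\mathcal{G}_{\mathbf d}$. *)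

theory Defs
  imports "HOL-Analysis.Analysis" "HOL-Library.Landau_Symbols"
    "HOL-Computational_Algebra.Polynomial"
begin

section \<open>Differentiability\<close>

text \<open>\<open>C_on n S f\<close>: \<open>f\<close> is \<open>n\<close> times continuously differentiable on the open set \<open>S\<close>.\<close>

primrec C_on :: "nat \<Rightarrow> 'a::real_normed_vector set \<Rightarrow> ('a \<Rightarrow> 'b::real_normed_vector) \<Rightarrow> bool" where
  "C_on 0 S f \<longleftrightarrow> continuous_on S f"
| "C_on (Suc n) S f \<longleftrightarrow>
     (\<forall>x\<in>S. f differentiable (at x)) \<and> (\<forall>v. C_on n S (\<lambda>x. frechet_derivative f (at x) v))"

definition smooth_on :: "'a::real_normed_vector set \<Rightarrow> ('a \<Rightarrow> 'b::real_normed_vector) \<Rightarrow> bool" where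
  "smooth_on S f \<longleftrightarrow> (\<forall>n. C_on n S f)"

definition nderiv :: "nat \<Rightarrow> (real \<Rightarrow> 'a::real_normed_vector) \<Rightarrow> real \<Rightarrow> 'a" where
  "nderiv n f = ((\<lambda>g x. vector_derivative g (at x)) ^^ n) f"

text \<open>\<open>D\<^sub>s\<^sup>n D\<^sub>k\<^sup>m a(s, k)\<close>\<close>

definition mixed_deriv :: "nat \<Rightarrow> nat \<Rightarrow> (real \<Rightarrow> real \<Rightarrow> complex) \<Rightarrow> real \<Rightarrow> real \<Rightarrow> complex" where
  "mixed_deriv n m a s k = nderiv n (\<lambda>s'. nderiv m (a s') k) s"

definition laplacian :: "('a::euclidean_space \<Rightarrow> 'b::real_normed_vector) \<Rightarrow> 'a \<Rightarrow> 'b" where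
  "laplacian f x =
     (\<Sum>b\<in>Basis. frechet_derivative (\<lambda>y. frechet_derivative f (at y) b) (at x) b)"

section \<open>Obstacle and scattering problem\<close>

definition strictly_convex :: "'a::euclidean_space set \<Rightarrow> bool" where
  "strictly_convex K \<longleftrightarrow> (\<forall>x\<in>K. \<forall>y\<in>K. x \<noteq> y \<longrightarrow> open_segment x y \<subseteq> interior K)"

text \<open>The unit tangent turned clockwise by a right angle. It is the exterior normal exactly when
  the boundary curve is counterclockwise; this is how orientation is expressed below.\<close>

definition normal :: "(real \<Rightarrow> real ^ 2) \<Rightarrow> real \<Rightarrow> real ^ 2" where
  "normal \<gamma> s = vector [vector_derivative \<gamma> (at s) $ 2, - (vector_derivative \<gamma> (at s) $ 1)]"

definition boundary_parametrization :: "(real ^ 2) set \<Rightarrow> real \<Rightarrow> (real \<Rightarrow> real ^ 2) \<Rightarrow> bool" where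
  "boundary_parametrization K P \<gamma> \<longleftrightarrow>
     P > 0 \<and> smooth_on UNIV \<gamma> \<and> (\<forall>s. \<gamma> (s + 2 * P) = \<gamma> s) \<and>
     inj_on \<gamma> {0..<2 * P} \<and> range \<gamma> = frontier K \<and>
     (\<forall>s. norm (vector_derivative \<gamma> (at s)) = 1) \<and>
     (\<forall>s. eventually (\<lambda>h. \<gamma> s + h *\<^sub>R normal \<gamma> s \<notin> K) (at_right 0))"

definition shadow_boundary_points ::
    "real \<Rightarrow> (real \<Rightarrow> real ^ 2) \<Rightarrow> real ^ 2 \<Rightarrow> real \<Rightarrow> real \<Rightarrow> bool" where
  "shadow_boundary_points P \<gamma> \<alpha> t1 t2 \<longleftrightarrow>
     0 < t1 \<and> t1 < t2 \<and> t2 < 2 * P \<and> t1 + t2 = 2 * P \<and>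
     (\<forall>s\<in>{0..2 * P}. \<alpha> \<bullet> normal \<gamma> s = 0 \<longleftrightarrow> s = t1 \<or> s = t2) \<and>
     (\<forall>s\<in>{t1<..<t2}. \<alpha> \<bullet> normal \<gamma> s < 0) \<and>
     (\<forall>s\<in>{0..<t1} \<union> {t2<..2 * P}. \<alpha> \<bullet> normal \<gamma> s > 0)"

definition u_inc :: "real ^ 2 \<Rightarrow> real \<Rightarrow> real ^ 2 \<Rightarrow> complex" where
  "u_inc \<alpha> k x = exp (\<i> * of_real (k * (\<alpha> \<bullet> x)))"

text \<open>The classical solution: twice continuously differentiable in the exterior, and
  continuously differentiable up to the boundary with derivative \<open>Du\<close>. The limit
  along \<open>at_infinity\<close> makes the radiation condition uniform in the direction.\<close>

definition scattered_field ::
    "(real ^ 2) set \<Rightarrow> (real \<Rightarrow> real ^ 2) \<Rightarrow> real ^ 2 \<Rightarrow> real \<Rightarrow> (real ^ 2 \<Rightarrow> complex) \<Rightarrow> bool" where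
  "scattered_field K \<gamma> \<alpha> k u \<longleftrightarrow>
     C_on 2 (- K) u \<and>
     (\<forall>x\<in>- K. laplacian u x + of_real (k\<^sup>2) * u x = 0) \<and>
     (\<exists>Du :: real ^ 2 \<Rightarrow> real ^ 2 \<Rightarrow> complex.
        (\<forall>x\<in>closure (- K). (u has_derivative Du x) (at x within closure (- K))) \<and>
        (\<forall>v. continuous_on (closure (- K)) (\<lambda>x. Du x v)) \<and>
        (\<forall>s. Du (\<gamma> s) (normal \<gamma> s) =
              - frechet_derivative (u_inc \<alpha> k) (at (\<gamma> s)) (normal \<gamma> s)) \<and>
        ((\<lambda>x. of_real (sqrt (norm x)) * (Du x (x /\<^sub>R norm x) - \<i> * of_real k * u x)) \<longlongrightarrow> 0)
          at_infinity)"

definition phase :: "real ^ 2 \<Rightarrow> (real \<Rightarrow> real ^ 2) \<Rightarrow> real \<Rightarrow> real \<Rightarrow> complex" where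
  "phase \<alpha> \<gamma> s k = exp (\<i> * of_real (k * (\<alpha> \<bullet> \<gamma> s)))"

text \<open>The total field on the boundary and its slowly oscillating envelope, as periodic functions
  of the arc length; \<open>u k\<close> is the scattered field at wavenumber \<open>k\<close>.\<close>

definition eta ::
    "real ^ 2 \<Rightarrow> (real \<Rightarrow> real ^ 2) \<Rightarrow> (real \<Rightarrow> real ^ 2 \<Rightarrow> complex) \<Rightarrow> real \<Rightarrow> real \<Rightarrow> complex" where
  "eta \<alpha> \<gamma> u s k = u k (\<gamma> s) + u_inc \<alpha> k (\<gamma> s)"

definition eta_slow ::
    "real ^ 2 \<Rightarrow> (real \<Rightarrow> real ^ 2) \<Rightarrow> (real \<Rightarrow> real ^ 2 \<Rightarrow> complex) \<Rightarrow> real \<Rightarrow> real \<Rightarrow> complex" where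
  "eta_slow \<alpha> \<gamma> u s k = exp (- \<i> * of_real (k * (\<alpha> \<bullet> \<gamma> s))) * eta \<alpha> \<gamma> u s k"

section \<open>Symbol classes and the asymptotic expansion\<close>

text \<open>Functions on the boundary are periodic functions of \<open>s \<in> \<real>\<close>, so smoothness is required for
  all \<open>s\<close>, in particular across the point \<open>s = 0 \<equiv> 2P\<close> of the circle.\<close>

definition hormander_class ::
    "real \<Rightarrow> real \<Rightarrow> real \<Rightarrow> real \<Rightarrow> (real \<Rightarrow> real \<Rightarrow> complex) set" where
  "hormander_class P \<mu> \<rho> \<delta> =
     {a. smooth_on (UNIV \<times> {0<..}) (\<lambda>(s, k). a s k) \<and>
         (\<forall>n m. \<forall>\<kappa>>0. \<exists>C. \<forall>s\<in>{0..2 * P}. \<forall>k\<ge>\<kappa>.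
            norm (mixed_deriv n m a s k) \<le> C * k powr (\<mu> + \<delta> * real n - \<rho> * real m))}"

text \<open>\<open>\<psi>(\<tau>) \<sim> \<Sum>\<^sub>j c\<^sub>j \<tau>\<^bsup>e - 3j\<^esup>\<close> as \<open>\<tau> \<rightarrow> \<infinity>\<close> in the sense of symbols\<close>

definition symbol_expansion :: "(real \<Rightarrow> complex) \<Rightarrow> int \<Rightarrow> (nat \<Rightarrow> complex) \<Rightarrow> bool" where
  "symbol_expansion \<psi> e c \<longleftrightarrow>
     (\<forall>N n. (\<lambda>\<tau>. norm (nderiv n (\<lambda>\<tau>. \<psi> \<tau> - (\<Sum>j<N. c j * of_real (\<tau> powi (e - 3 * int j)))) \<tau>))
              \<in> O[at_top](\<lambda>\<tau>. \<tau> powi (e - 3 * int N - int n)))"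

definition rapidly_decreasing_at_bot :: "(real \<Rightarrow> complex) \<Rightarrow> bool" where
  "rapidly_decreasing_at_bot \<psi> \<longleftrightarrow>
     (\<forall>N n. (\<lambda>\<tau>. norm (nderiv n \<psi> \<tau>)) \<in> O[at_bot](\<lambda>\<tau>. \<tau> powi (- int N)))"

text \<open>Index tuples \<open>(p, q, r, \<ell>)\<close> with \<open>\<ell> \<in> {-1, -2, \<dots>}\<close>\<close>

type_synonym index = "nat \<times> nat \<times> nat \<times> int"

definition indices :: "index set" where
  "indices = {(p, q, r, l). l < 0}"

definition expansion_term ::
    "(index \<Rightarrow> real \<Rightarrow> complex) \<Rightarrow> (nat \<Rightarrow> int \<Rightarrow> real \<Rightarrow> complex) \<Rightarrow> (real \<Rightarrow> real) \<Rightarrow>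
     index \<Rightarrow> real \<Rightarrow> real \<Rightarrow> complex" where
  "expansion_term b \<Psi> Z = (\<lambda>(p, q, r, l) s k.
     of_real (k powr (- (1 + 2 * real p + 3 * real q + real r + real_of_int l) / 3
                      + min (real_of_int l + 1) 0))
     * b (p, q, r, l) s * nderiv p (\<Psi> r l) (k powr (1 / 3) * Z s))"

definition expansion_data ::
    "real \<Rightarrow> real \<Rightarrow> real \<Rightarrow> (index \<Rightarrow> real \<Rightarrow> complex) \<Rightarrow> (nat \<Rightarrow> int \<Rightarrow> real \<Rightarrow> complex) \<Rightarrow>
     (real \<Rightarrow> real) \<Rightarrow> bool" where
  "expansion_data P t1 t2 b \<Psi> Z \<longleftrightarrow>
     (\<forall>i\<in>indices. smooth_on UNIV (b i) \<and> (\<forall>s. b i (s + 2 * P) = b i s)) \<and>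
     smooth_on UNIV Z \<and> (\<forall>s. Z (s + 2 * P) = Z s) \<and>
     (\<forall>s\<in>{t1<..<t2}. Z s > 0) \<and> (\<forall>s\<in>{0..<t1} \<union> {t2<..2 * P}. Z s < 0) \<and>
     Z t1 = 0 \<and> Z t2 = 0 \<and> deriv Z t1 \<noteq> 0 \<and> deriv Z t2 \<noteq> 0 \<and>
     (\<forall>r. \<forall>l<0. smooth_on UNIV (\<Psi> r l) \<and>
        (\<exists>c. symbol_expansion (\<Psi> r l) (1 + l - 2 * int r) c) \<and>
        rapidly_decreasing_at_bot (\<Psi> r l))"

definition asymptotic_expansion ::
    "real \<Rightarrow> (real \<Rightarrow> real \<Rightarrow> complex) \<Rightarrow> (index \<Rightarrow> real \<Rightarrow> real \<Rightarrow> complex) \<Rightarrow> bool" where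
  "asymptotic_expansion P a A \<longleftrightarrow>
     (\<forall>M>0. \<exists>F\<^sub>M. finite F\<^sub>M \<and> F\<^sub>M \<subseteq> indices \<and>
        (\<forall>F. finite F \<and> F\<^sub>M \<subseteq> F \<and> F \<subseteq> indices \<longrightarrow>
           (\<lambda>s k. a s k - (\<Sum>i\<in>F. A i s k)) \<in> hormander_class P (- M) (2 / 3) (1 / 3)))"

definition theta :: "index \<Rightarrow> real" where
  "theta = (\<lambda>(p, q, r, l).
     - (1 + 2 * real p + 3 * real q + real r + real_of_int l) / 3 + min (real_of_int l + 1) 0
     + (if 1 + l - 2 * int r - int p < 0 then 0
        else real_of_int (1 + l - 2 * int r - int p) / 3))"

definition F_idx :: "nat \<Rightarrow> index set" where
  "F_idx \<beta> = {i \<in> indices. theta i > - real \<beta> / 3}"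

lemma finite_F_idx: "finite (F_idx \<beta>)"
proof (rule finite_subset)
  show "F_idx \<beta> \<subseteq> {..\<beta>} \<times> {..\<beta>} \<times> {..\<beta>} \<times> {- int \<beta> - 1..<0}"
  proof
    fix i assume "i \<in> F_idx \<beta>"
    moreover obtain p q r l where i: "i = (p, q, r, l)" by (cases i)
    ultimately have l: "l < 0" and th: "theta (p, q, r, l) > - real \<beta> / 3"
      by (auto simp: F_idx_def indices_def)
    from l have l1: "real_of_int l + 1 \<le> 0" by linarith
    from l l1 th have "2 * real p + 3 * real q + real r < 2 * (real_of_int l + 1) + real \<beta>"
      by (auto simp: theta_def min_def field_simps split: if_splits)
    then have "real_of_int (2 * int p + 3 * int q + int r) < real_of_int (2 * (l + 1) + int \<beta>)"
      by simp
    then have "2 * int p + 3 * int q + int r < 2 * (l + 1) + int \<beta>"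
      by (simp only: of_int_less_iff)
    with l show "i \<in> {..\<beta>} \<times> {..\<beta>} \<times> {..\<beta>} \<times> {- int \<beta> - 1..<0}"
      by (auto simp: i)
  qed
qed auto

definition sigma_slow ::
    "(index \<Rightarrow> real \<Rightarrow> real \<Rightarrow> complex) \<Rightarrow> nat \<Rightarrow> real \<Rightarrow> real \<Rightarrow> complex" where
  "sigma_slow A \<beta> s k = (\<Sum>i\<in>F_idx \<beta>. A i s k)"

definition sigma ::
    "real ^ 2 \<Rightarrow> (real \<Rightarrow> real ^ 2) \<Rightarrow> (index \<Rightarrow> real \<Rightarrow> real \<Rightarrow> complex) \<Rightarrow> nat \<Rightarrow>
     real \<Rightarrow> real \<Rightarrow> complex" where
  "sigma \<alpha> \<gamma> A \<beta> s k = phase \<alpha> \<gamma> s k * sigma_slow A \<beta> s k"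

section \<open>The integral equation\<close>

text \<open>The space \<open>L\<^sup>2\<close> of the boundary in the arc length variable. Its elements are functions rather
  than classes modulo null sets, so identities between them hold almost everywhere.\<close>

definition L2 :: "real \<Rightarrow> (real \<Rightarrow> complex) set" where
  "L2 P = {g. g \<in> borel_measurable lborel \<and> (\<forall>s. g (s + 2 * P) = g s) \<and>
              set_integrable lborel {0..2 * P} (\<lambda>s. (norm (g s))\<^sup>2)}"

definition L2_inner :: "real \<Rightarrow> (real \<Rightarrow> complex) \<Rightarrow> (real \<Rightarrow> complex) \<Rightarrow> complex" where
  "L2_inner P g h = set_lebesgue_integral lborel {0..2 * P} (\<lambda>s. cnj (g s) * h s)"

definition L2_norm :: "real \<Rightarrow> (real \<Rightarrow> complex) \<Rightarrow> real" where
  "L2_norm P g = sqrt (set_lebesgue_integral lborel {0..2 * P} (\<lambda>s. (norm (g s))\<^sup>2))"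

definition L2_linear_operator :: "real \<Rightarrow> ((real \<Rightarrow> complex) \<Rightarrow> real \<Rightarrow> complex) \<Rightarrow> bool" where
  "L2_linear_operator P R \<longleftrightarrow>
     (\<forall>g\<in>L2 P. R g \<in> L2 P) \<and>
     (\<forall>g\<in>L2 P. \<forall>h\<in>L2 P. (AE s in lborel. g s = h s) \<longrightarrow> (AE s in lborel. R g s = R h s)) \<and>
     (\<forall>g\<in>L2 P. \<forall>h\<in>L2 P. AE s in lborel. R (\<lambda>s. g s + h s) s = R g s + R h s) \<and>
     (\<forall>g\<in>L2 P. \<forall>z. AE s in lborel. R (\<lambda>s. z * g s) s = z * R g s)"

definition continuous_coercive ::
    "real \<Rightarrow> ((real \<Rightarrow> complex) \<Rightarrow> real \<Rightarrow> complex) \<Rightarrow> real \<Rightarrow> real \<Rightarrow> bool" where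
  "continuous_coercive P R Cc cc \<longleftrightarrow>
     Cc > 0 \<and> cc > 0 \<and>
     (\<forall>\<mu>\<in>L2 P. \<forall>\<phi>\<in>L2 P. norm (L2_inner P \<mu> (R \<phi>)) \<le> Cc * L2_norm P \<mu> * L2_norm P \<phi>) \<and>
     (\<forall>\<mu>\<in>L2 P. norm (L2_inner P \<mu> (R \<mu>)) \<ge> cc * (L2_norm P \<mu>)\<^sup>2)"

section \<open>Regions and the Galerkin method\<close>

definition region_parameters ::
    "real \<Rightarrow> real \<Rightarrow> real \<Rightarrow> nat \<Rightarrow> (nat \<Rightarrow> real) \<Rightarrow> real \<Rightarrow> real \<Rightarrow> real \<Rightarrow> real \<Rightarrow> bool" where
  "region_parameters P t1 t2 m \<epsilon> \<xi>1 \<xi>2 \<zeta>1 \<zeta>2 \<longleftrightarrow>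
     0 < \<epsilon> m \<and> \<epsilon> 1 < 1 / 3 \<and> (\<forall>j. 1 \<le> j \<and> j < m \<longrightarrow> \<epsilon> (j + 1) < \<epsilon> j) \<and>
     0 < \<xi>1 \<and> 0 < \<xi>2 \<and> 0 < \<zeta>1 \<and> 0 < \<zeta>2 \<and>
     t1 + \<xi>1 < t2 - \<xi>2 \<and> t2 + \<zeta>2 < 2 * P + t1 - \<zeta>1"

definition region ::
    "real \<Rightarrow> real \<Rightarrow> real \<Rightarrow> nat \<Rightarrow> (nat \<Rightarrow> real) \<Rightarrow> real \<Rightarrow> real \<Rightarrow> real \<Rightarrow> real \<Rightarrow>
     real \<Rightarrow> nat \<Rightarrow> real set" where
  "region P t1 t2 m \<epsilon> \<xi>1 \<xi>2 \<zeta>1 \<zeta>2 k j =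
     (let w = (\<lambda>i. k powr (- (1 / 3) + \<epsilon> i)) in
      if j = m then {t1 + \<xi>1 * w 1 .. t2 - \<xi>2 * w 1}
      else if j = 2 * m then {t2 + \<zeta>2 * w 1 .. 2 * P + t1 - \<zeta>1 * w 1}
      else if j = 3 * m then {t1 - \<zeta>1 * w m .. t1 + \<xi>1 * w m}
      else if j = 4 * m then {t2 - \<xi>2 * w m .. t2 + \<zeta>2 * w m}
      else if j < m then {t1 + \<xi>1 * w (j + 1) .. t1 + \<xi>1 * w j}
      else if j < 2 * m then {t2 - \<xi>2 * w (j - m) .. t2 - \<xi>2 * w (j - m + 1)}
      else if j < 3 * m then {t1 - \<zeta>1 * w (j - 2 * m) .. t1 - \<zeta>1 * w (j - 2 * m + 1)}
      else {t2 + \<zeta>2 * w (j - 3 * m + 1) .. t2 + \<zeta>2 * w (j - 3 * m)})"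

text \<open>The \<open>2P\<close>-periodic extension of \<open>1\<^sub>I p\<close>. The regions are shorter than \<open>2P\<close>, so the sum
  has at most one term for them.\<close>

definition periodic_piece :: "real \<Rightarrow> real set \<Rightarrow> complex poly \<Rightarrow> real \<Rightarrow> complex" where
  "periodic_piece P I p s =
     (\<Sum>n | s + 2 * P * real_of_int n \<in> I. poly p (of_real (s + 2 * P * real_of_int n)))"

definition galerkin_space ::
    "real \<Rightarrow> real ^ 2 \<Rightarrow> (real \<Rightarrow> real ^ 2) \<Rightarrow> nat \<Rightarrow> (nat \<Rightarrow> real set) \<Rightarrow> (nat \<Rightarrow> nat) \<Rightarrow> real \<Rightarrow>
     (real \<Rightarrow> complex) set" where
  "galerkin_space P \<alpha> \<gamma> m I d k =
     {(\<lambda>s. phase \<alpha> \<gamma> s k * (\<Sum>j=1..4 * m. periodic_piece P (I j) (p j) s)) | p.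
        \<forall>j\<in>{1..4 * m}. degree (p j) \<le> d j}"

definition galerkin_solution ::
    "real \<Rightarrow> ((real \<Rightarrow> complex) \<Rightarrow> real \<Rightarrow> complex) \<Rightarrow> (real \<Rightarrow> complex) set \<Rightarrow> (real \<Rightarrow> complex) \<Rightarrow>
     real \<Rightarrow> complex" where
  "galerkin_solution P R G g =
     (THE \<rho>. \<rho> \<in> G \<and> (\<forall>\<mu>\<in>G. L2_inner P \<mu> (R \<rho>) = L2_inner P \<mu> g))"

definition galerkin_approximation ::
    "real \<Rightarrow> ((real \<Rightarrow> complex) \<Rightarrow> real \<Rightarrow> complex) \<Rightarrow> (real \<Rightarrow> complex) \<Rightarrow> (real \<Rightarrow> complex) set \<Rightarrow>
     (real \<Rightarrow> complex) \<Rightarrow> real \<Rightarrow> complex" where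
  "galerkin_approximation P R f G \<sigma> s =
     \<sigma> s + galerkin_solution P R G (\<lambda>s. f s - R \<sigma> s) s"

definition E_factor :: "nat \<Rightarrow> (nat \<Rightarrow> real) \<Rightarrow> (nat \<Rightarrow> nat) \<Rightarrow> real \<Rightarrow> nat \<Rightarrow> real" where
  "E_factor m \<epsilon> n k j =
     (if j = m \<or> j = 2 * m then
        (if n j = 1 then sqrt (ln k) else 0)
        + (if n j \<ge> 2 then k powr (- (1 - 3 * \<epsilon> 1) / 6) * (k powr ((1 - 3 * \<epsilon> 1) / 6)) ^ n j else 0)
      else if j = 3 * m \<or> j = 4 * m then
        k powr (- (1 / 6)) * (k powr \<epsilon> m) ^ n j
      else
        let j' = j mod m in
        k powr (- (1 - 3 * \<epsilon> (j' + 1)) / 6) * (k powr ((\<epsilon> j' - \<epsilon> (j' + 1)) / 2)) ^ n j)"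

end

theory Submission
  imports Defs
begin

text \<open>
Fix \<open>k\<close> and write \<open>r\<close> for the slowly varying remainder \<open>eta_slow - sigma_slow\<close>. Because the
operator is coercive and continuous, the Galerkin error is at most \<open>Cc / cc\<close> times the distance of
\<open>eta - sigma\<close> from the Galerkin space (\<open>galerkin_quasi_optimal\<close>). The phase has modulus one, so it
remains to approximate \<open>r\<close> in \<open>L\<^sup>2\<close> by one polynomial on each region \<open>[a, b]\<close>. Three estimates
are combined.

First, the \<open>L\<^sup>2\<close> distance of a function \<open>f\<close> from the polynomials of degree \<open>d\<close> is at most a constant
times \<open>d\<^bsup>-n\<^esup>\<close> times the square root of the integral of \<open>\<bar>f\<^bsup>(n)\<^esup>\<bar>\<^sup>2 ((s - a) (b - s))\<^bsup>n\<^esup>\<close>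
(\<open>complex_best_approximation\<close>). The weight, which vanishes at the ends, is essential: it is what
compensates the growth of the derivatives towards the shadow boundaries.

Second, \<open>\<bar>r\<^bsup>(n)\<^esup>\<bar> \<le> C k\<^bsup>-\<beta>/3\<^esup> (k\<^bsup>-1/3\<^esup> + \<bar>Z\<bar>)\<^bsup>-n\<^esup>\<close> (\<open>truncated_expansion_bound\<close>). When a
derivative hits \<open>\<Psi>\<^bsup>(p)\<^esup>(k\<^bsup>1/3\<^esup> Z)\<close> it costs \<open>k\<^bsup>1/3\<^esup>\<close>, but it lowers the order of the symbol
\<open>\<Psi>\<^bsup>(p)\<^esup>\<close> by one, and \<open>k\<^bsup>1/3\<^esup> / (1 + k\<^bsup>1/3\<^esup> \<bar>Z\<bar>) = (k\<^bsup>-1/3\<^esup> + \<bar>Z\<bar>)\<^bsup>-1\<^esup>\<close>. The number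
\<open>theta\<close> is the exponent of \<open>k\<close> in the resulting bound of a term, and \<open>F_idx \<beta>\<close> leaves precisely
the terms with \<open>theta \<le> - \<beta> / 3\<close> in the remainder.

Third, it follows that the squared error on \<open>[a, b]\<close> is governed by the integral of
\<open>((s - a) (b - s))\<^bsup>n\<^esup> (k\<^bsup>-1/3\<^esup> + \<bar>Z\<bar>)\<^bsup>-2n\<^esup>\<close>. Since \<open>Z\<close> has simple zeros at the two shadow
boundary points and no others in a period, \<open>\<bar>Z\<bar>\<close> can be replaced by the distance to them
(\<open>expansion_data_growth\<close>). Away from the zeros the weight cancels \<open>n\<close> of the \<open>2n\<close> powers of the
distance, and on the shadow boundary regions \<open>k\<^bsup>-1/3\<^esup>\<close> regularises the singularity; either way the
integral is at most a constant times \<open>(1 + E)\<^sup>2\<close> (\<open>region_weighted_integral_rate\<close>). For \<open>n = 1\<close> a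
logarithm of \<open>k\<close> appears: it is the term \<open>sqrt (ln k)\<close> on the illuminated and shadow regions,
whereas on the transition regions a negative power of \<open>k\<close> absorbs it into the summand \<open>1\<close>.

The Galerkin approximation is defined through a unique solution in a space of functions, not of
classes. Existence comes from definiteness of the form on a finite-dimensional space
(\<open>sesquilinear_solvable\<close>), and uniqueness from the fact that a piecewise polynomial vanishing almost
everywhere has vanishing pieces (\<open>weighted_pieces_eq_zero\<close>), as all regions are nondegenerate.
\<close>

section \<open>Iterated derivatives\<close>

text \<open>Differentiability and the value of the derivative are kept in one predicate, so that a
  bound for the \<open>n\<close>-th derivative can be proved by induction on \<open>n\<close> from bounds for its
  summands.\<close>

primrec has_nderiv ::
    "nat \<Rightarrow> (real \<Rightarrow> 'a::real_normed_vector) \<Rightarrow> (real \<Rightarrow> 'a) \<Rightarrow> bool" where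
  "has_nderiv 0 f g \<longleftrightarrow> continuous_on UNIV f \<and> g = f"
| "has_nderiv (Suc n) f g \<longleftrightarrow>
     (\<exists>D. (\<forall>x. (f has_vector_derivative D x) (at x)) \<and> has_nderiv n D g)"

lemma has_nderiv_SucI:
  "(\<And>x. (f has_vector_derivative D x) (at x)) \<Longrightarrow> has_nderiv n D g \<Longrightarrow> has_nderiv (Suc n) f g"
  by auto

lemma has_nderiv_continuous_deriv: "has_nderiv n f g \<Longrightarrow> continuous_on UNIV g"
  by (induction n arbitrary: f) auto

lemma has_vector_derivative_continuous_on_UNIV:
  "(\<And>x. (f has_vector_derivative D x) (at x)) \<Longrightarrow> continuous_on UNIV f"
  by (meson continuous_at_imp_continuous_on has_vector_derivative_continuous)

lemma has_nderiv_continuous: "has_nderiv n f g \<Longrightarrow> continuous_on UNIV f"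
  by (cases n) (auto intro: has_vector_derivative_continuous_on_UNIV)

lemma has_nderiv_add:
  "has_nderiv n f g \<Longrightarrow> has_nderiv n f' g' \<Longrightarrow> has_nderiv n (\<lambda>s. f s + f' s) (\<lambda>s. g s + g' s)"
proof (induction n arbitrary: f f')
  case 0
  then show ?case by (auto intro!: continuous_intros)
next
  case (Suc n)
  from Suc.prems obtain D D' where
    "\<And>x. (f has_vector_derivative D x) (at x)" "has_nderiv n D g"
    "\<And>x. (f' has_vector_derivative D' x) (at x)" "has_nderiv n D' g'"
    by auto
  with Suc.IH[of D D'] show ?case
    by (auto intro!: exI[of _ "\<lambda>s. D s + D' s"] has_vector_derivative_add)
qed

lemma has_nderiv_linear:
  assumes "bounded_linear L"
  shows "has_nderiv n f g \<Longrightarrow> has_nderiv n (\<lambda>s. L (f s)) (\<lambda>s. L (g s))"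
proof (induction n arbitrary: f)
  case 0
  then show ?case
    using bounded_linear.continuous_on[OF assms] by auto
next
  case (Suc n)
  from Suc.prems obtain D where "\<And>x. (f has_vector_derivative D x) (at x)" "has_nderiv n D g"
    by auto
  with Suc.IH[of D] show ?case
    by (auto intro!: exI[of _ "\<lambda>s. L (D s)"] bounded_linear.has_vector_derivative[OF assms])
qed

lemma nderiv_Suc_inner: "nderiv (Suc n) f = nderiv n (\<lambda>x. vector_derivative f (at x))"
  by (simp add: nderiv_def funpow_Suc_right del: funpow.simps(2))

lemma has_nderiv_imp_nderiv: "has_nderiv n f g \<Longrightarrow> g = nderiv n f"
proof (induction n arbitrary: f)
  case 0
  then show ?case by (simp add: nderiv_def)
next
  case (Suc n)
  then obtain D where D: "\<And>x. (f has_vector_derivative D x) (at x)" "has_nderiv n D g"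
    by auto
  from D(1) have "(\<lambda>x. vector_derivative f (at x)) = D"
    by (auto simp: fun_eq_iff intro: vector_derivative_at)
  with Suc.IH[OF D(2)] show ?case
    by (simp add: nderiv_Suc_inner)
qed

lemma has_nderiv_shift: "has_nderiv n f g \<Longrightarrow> has_nderiv n (\<lambda>s. f (s + p)) (\<lambda>s. g (s + p))"
proof (induction n arbitrary: f)
  case 0
  then show ?case by (auto intro!: continuous_on_compose2[of UNIV f] continuous_intros)
next
  case (Suc n)
  then obtain D where D: "\<And>x. (f has_vector_derivative D x) (at x)" "has_nderiv n D g"
    by auto
  have "((\<lambda>s. f (s + p)) has_vector_derivative D (x + p)) (at x)" for x
    using vector_diff_chain_at[of "\<lambda>s. s + p" 1 x f "D (x + p)"] D(1)[of "x + p"]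
    by (simp add: o_def has_vector_derivative_add_const)
  from has_nderiv_SucI[where D = "\<lambda>s. D (s + p)", OF this Suc.IH[OF D(2)]] show ?case .
qed

lemma has_nderiv_periodic:
  assumes "has_nderiv n f g" "\<And>s. f (s + p) = f s"
  shows "g (s + p) = g s"
proof -
  have "(\<lambda>s. g (s + p)) = nderiv n f" "g = nderiv n f"
    using has_nderiv_shift[OF assms(1), of p] assms by (auto intro: has_nderiv_imp_nderiv)
  then show ?thesis by metis
qed

text \<open>A line covers two cases at once: functions of one real variable, and the slices
  \<open>s \<mapsto> a(s, k)\<close> of a symbol that is smooth in \<open>(s, k)\<close>.\<close>

lemma C_on_line_has_nderiv:
  assumes "C_on n S F" "\<And>s. x + s *\<^sub>R v \<in> S"
  shows "\<exists>g. has_nderiv n (\<lambda>s. F (x + s *\<^sub>R v)) g"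
  using assms(1)
proof (induction n arbitrary: F)
  case 0
  then show ?case
    using assms(2) by (auto intro!: continuous_on_compose2[of S F] continuous_intros)
next
  case (Suc n)
  let ?D = "\<lambda>y. frechet_derivative F (at y) v"
  obtain g where g: "has_nderiv n (\<lambda>s. ?D (x + s *\<^sub>R v)) g"
    using Suc.IH[of ?D] Suc.prems by auto
  have "((\<lambda>s. F (x + s *\<^sub>R v)) has_vector_derivative ?D (x + s *\<^sub>R v)) (at s)" for s
  proof -
    have F: "(F has_derivative frechet_derivative F (at (x + s *\<^sub>R v))) (at (x + s *\<^sub>R v))"
      using Suc.prems assms(2) by (simp add: frechet_derivative_works)
    have "((\<lambda>s. x + s *\<^sub>R v) has_derivative (\<lambda>h. h *\<^sub>R v)) (at s)"
      by (auto intro!: derivative_eq_intros)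
    from has_derivative_compose[OF this F] show ?thesis
      by (simp add: has_vector_derivative_def linear_cmul[OF has_derivative_linear[OF F]])
  qed
  from has_nderiv_SucI[where D = "\<lambda>s. ?D (x + s *\<^sub>R v)", OF this g] show ?case
    by blast
qed

lemma smooth_on_line_has_nderiv:
  assumes "smooth_on S F" "\<And>s. x + s *\<^sub>R v \<in> S"
  shows "has_nderiv n (\<lambda>s. F (x + s *\<^sub>R v)) (nderiv n (\<lambda>s. F (x + s *\<^sub>R v)))"
proof -
  obtain g where g: "has_nderiv n (\<lambda>s. F (x + s *\<^sub>R v)) g"
    using C_on_line_has_nderiv assms unfolding smooth_on_def by blast
  from has_nderiv_imp_nderiv[OF this] g show ?thesis by simp
qed

lemma smooth_on_UNIV_has_nderiv:
  fixes f :: "real \<Rightarrow> 'a::real_normed_vector"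
  assumes "smooth_on UNIV f"
  shows "has_nderiv n f (nderiv n f)"
  using smooth_on_line_has_nderiv[OF assms, of 0 1 n] by simp

lemma has_nderiv_Suc_nderiv:
  assumes "has_nderiv (Suc n) f g"
  shows "(nderiv n f has_vector_derivative g x) (at x)"
  using assms
proof (induction n arbitrary: f)
  case 0
  then show ?case by (auto simp: nderiv_def)
next
  case (Suc n)
  then obtain D where D: "\<And>x. (f has_vector_derivative D x) (at x)" "has_nderiv (Suc n) D g"
    unfolding has_nderiv.simps(2)[of "Suc n"] by blast
  from D(1) have "(\<lambda>x. vector_derivative f (at x)) = D"
    by (auto simp: fun_eq_iff intro: vector_derivative_at)
  with Suc.IH[OF D(2)] show ?case
    by (simp add: nderiv_Suc_inner)
qed

lemma smooth_on_UNIV_nderiv_step: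
  fixes f :: "real \<Rightarrow> 'a::real_normed_vector"
  assumes "smooth_on UNIV f"
  shows "(nderiv n f has_vector_derivative nderiv (Suc n) f x) (at x)"
  by (rule has_nderiv_Suc_nderiv[OF smooth_on_UNIV_has_nderiv[OF assms]])

section \<open>Polynomial approximation in weighted seminorms\<close>

text \<open>A condition on coefficients rather than on the degree, so that \<open>N = 0\<close> gives the zero
  space. It occurs for \<open>n = d + 1\<close>, where \<open>n\<close> differentiations leave nothing of a polynomial of
  degree \<open>d\<close>.\<close>

definition polys_below :: "nat \<Rightarrow> real poly set" where
  "polys_below N = {p. \<forall>i\<ge>N. coeff p i = 0}"

lemma polys_below_0 [simp]: "polys_below 0 = {0}"
  by (auto simp: polys_below_def poly_eq_iff)

lemma polys_below_mono: "p \<in> polys_below M \<Longrightarrow> M \<le> N \<Longrightarrow> p \<in> polys_below N"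
  by (auto simp: polys_below_def)

lemma degree_polys_below: "p \<in> polys_below (Suc d) \<Longrightarrow> degree p \<le> d"
  by (auto simp: polys_below_def intro: degree_le)

lemma in_some_polys_below: "\<exists>N. p \<in> polys_below N"
  by (rule exI[of _ "Suc (degree p)"]) (auto simp: polys_below_def coeff_eq_0)

lemma polys_below_add: "p \<in> polys_below N \<Longrightarrow> q \<in> polys_below N \<Longrightarrow> p + q \<in> polys_below N"
  and polys_below_smult: "p \<in> polys_below N \<Longrightarrow> smult c p \<in> polys_below N"
  by (auto simp: polys_below_def)

lemma pderiv_polys_below: "p \<in> polys_below (Suc N) \<Longrightarrow> pderiv p \<in> polys_below N"
  by (auto simp: polys_below_def coeff_pderiv)

lemma polys_below_Suc_decompose:
  assumes "p \<in> polys_below (Suc N)" "g \<in> polys_below (Suc N)" "coeff g N = 1"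
  obtains r where "r \<in> polys_below N" "p = smult (coeff p N) g + r"
proof
  show "p - smult (coeff p N) g \<in> polys_below N"
    unfolding polys_below_def
  proof (intro CollectI allI impI)
    fix i assume "N \<le> i"
    then consider "i = N" | "Suc N \<le> i" by linarith
    then show "coeff (p - smult (coeff p N) g) i = 0"
      using assms by cases (auto simp: polys_below_def)
  qed
qed auto

lemma antiderivative_poly:
  assumes "p \<in> polys_below N"
  shows "\<exists>q \<in> polys_below (Suc N). pderiv q = p"
proof
  let ?q = "\<Sum>i<N. monom (coeff p i / real (Suc i)) (Suc i)"
  show "pderiv ?q = p"
    using assms by (auto simp: poly_eq_iff coeff_pderiv coeff_sum polys_below_def if_distrib
        not_less sum.delta cong: if_cong)
  show "?q \<in> polys_below (Suc N)"
    by (auto simp: polys_below_def coeff_sum)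
qed

text \<open>The interval carries the weight \<open>W = (s - a) (b - s)\<close>. The polynomials orthogonal for
  \<open>W\<^bsup>j\<^esup>\<close> are rescaled Jacobi polynomials; only their differential equation is used, in the form
  of the operator \<open>jacobi_op\<close> below.\<close>

locale proper_interval =
  fixes a b :: real
  assumes less: "a < b"
begin

definition W :: "real poly" where "W = [:- a * b, a + b, - 1:]"

definition int_poly :: "real poly \<Rightarrow> real" where "int_poly p = integral {a..b} (poly p)"

definition jform :: "nat \<Rightarrow> real poly \<Rightarrow> real poly \<Rightarrow> real" where
  "jform j p q = int_poly (W ^ j * p * q)"

lemma poly_W: "poly W s = (s - a) * (b - s)"
  by (simp add: W_def algebra_simps)

lemma poly_integrable: "poly p integrable_on {a..b}"
  by (intro integrable_continuous_interval continuous_intros)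

lemma int_poly_add: "int_poly (p + q) = int_poly p + int_poly q"
  and int_poly_diff: "int_poly (p - q) = int_poly p - int_poly q"
  and int_poly_smult: "int_poly (smult c p) = c * int_poly p"
  and int_poly_0: "int_poly 0 = 0"
  using integral_add[OF poly_integrable[of p] poly_integrable[of q]]
    integral_diff[OF poly_integrable[of p] poly_integrable[of q]]
  by (simp_all add: int_poly_def poly_add[abs_def] poly_diff[abs_def] poly_smult[abs_def]
      poly_0[abs_def])

text \<open>Since \<open>W\<close> vanishes at both ends, integration by parts produces no boundary terms.\<close>

lemma int_poly_pderiv_vanishing: "int_poly (pderiv (W * r)) = 0"
proof -
  have "((\<lambda>x. poly (pderiv (W * r)) x) has_integral (poly (W * r) b - poly (W * r) a)) {a..b}"
    using less by (intro fundamental_theorem_of_calculus)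
      (auto simp flip: has_real_derivative_iff_has_vector_derivative simp del: poly_mult
        intro: DERIV_subset[OF poly_DERIV])
  then show ?thesis
    by (simp add: int_poly_def poly_W integral_unique)
qed

lemma jform_add_left: "jform j (p + p') q = jform j p q + jform j p' q"
  and jform_diff_left: "jform j (p - p') q = jform j p q - jform j p' q"
  and jform_smult_left: "jform j (smult c p) q = c * jform j p q"
  and jform_add_right: "jform j q (p + p') = jform j q p + jform j q p'"
  and jform_diff_right: "jform j q (p - p') = jform j q p - jform j q p'"
  and jform_smult_right: "jform j q (smult c p) = c * jform j q p"
  and jform_0_left: "jform j 0 q = 0"
  and jform_0_right: "jform j q 0 = 0"
  by (simp_all add: jform_def int_poly_add int_poly_diff int_poly_smult int_poly_0 algebra_simps)

lemmas jform_linear = jform_add_left jform_diff_left jform_smult_left jform_add_right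
  jform_diff_right jform_smult_right jform_0_left jform_0_right

lemma jform_commute: "jform j p q = jform j q p"
  by (simp add: jform_def mult_ac)

lemma weighted_square: "poly (W ^ j * p * p) s = ((s - a) * (b - s)) ^ j * (poly p s)\<^sup>2"
  by (simp add: poly_W power2_eq_square)

lemma jform_nonneg: "0 \<le> jform j p p"
  unfolding jform_def int_poly_def
  by (rule integral_nonneg[OF poly_integrable])
     (simp add: weighted_square del: poly_mult poly_power)

lemma jform_definite:
  assumes "jform j p p = 0"
  shows "p = 0"
proof -
  have "poly (W ^ j * p * p) s = 0" if "s \<in> cbox a b" for s
  proof (rule has_integral_0_cbox_imp_0[of a b "poly (W ^ j * p * p)"])
    show "(poly (W ^ j * p * p) has_integral 0) (cbox a b)"
      using integrable_integral[OF poly_integrable, of "W ^ j * p * p"] assms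
      by (simp add: jform_def int_poly_def del: poly_mult poly_power)
  qed (use less that in \<open>auto simp: weighted_square simp del: poly_mult poly_power
         intro!: continuous_intros\<close>)
  note W0 = this
  have "poly p s = 0" if "s \<in> {a<..<b}" for s
    using that W0[of s] by (auto simp: weighted_square simp del: poly_mult poly_power)
  then have "{a<..<b} \<subseteq> {s. poly p s = 0}"
    by auto
  then have "infinite {s. poly p s = 0}"
    using less infinite_Ioo infinite_super by blast
  then show ?thesis
    using poly_roots_finite by blast
qed

text \<open>Gram-Schmidt: the part \<open>g\<close> of \<open>x\<^bsup>N\<^esup>\<close> that is orthogonal to all lower degrees supplies the
  missing direction.\<close>

lemma orthogonal_projection: "\<exists>p \<in> polys_below N. \<forall>q \<in> polys_below N. jform j (f - p) q = 0"
proof (induction N arbitrary: f)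
  case 0
  then show ?case by (auto simp: jform_linear)
next
  case (Suc N)
  let ?x = "monom 1 N :: real poly"
  obtain g0 where g0: "g0 \<in> polys_below N" "\<forall>q \<in> polys_below N. jform j (?x - g0) q = 0"
    using Suc by blast
  obtain p0 where p0: "p0 \<in> polys_below N" "\<forall>q \<in> polys_below N. jform j (f - p0) q = 0"
    using Suc by blast
  define g where "g = ?x - g0"
  have g: "g \<in> polys_below (Suc N)" "coeff g N = 1" "\<forall>q \<in> polys_below N. jform j g q = 0"
    using g0 by (auto simp: g_def polys_below_def)
  then have "jform j g g \<noteq> 0"
    using jform_definite by fastforce
  define p where "p = p0 + smult (jform j (f - p0) g / jform j g g) g"
  have "p \<in> polys_below (Suc N)"
    unfolding p_def using p0 g
    by (auto intro!: polys_below_add polys_below_smult intro: polys_below_mono)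
  moreover have "jform j (f - p) q = 0" if q: "q \<in> polys_below (Suc N)" for q
  proof -
    obtain r where r: "r \<in> polys_below N" "q = smult (coeff q N) g + r"
      using polys_below_Suc_decompose[OF q g(1,2)] .
    have "jform j (f - p) r = 0"
      using r p0 g by (simp add: p_def jform_linear)
    moreover have "jform j (f - p) g = 0"
      using \<open>jform j g g \<noteq> 0\<close> by (simp add: p_def jform_linear)
    ultimately show ?thesis
      by (subst r(2)) (simp add: jform_linear)
  qed
  ultimately show ?case by blast
qed

text \<open>The Sturm-Liouville operator \<open>g \<mapsto> - W\<^bsup>-j\<^esup> (W\<^bsup>j+1\<^esup> g')'\<close>, multiplied out so that it maps
  polynomials to polynomials.\<close>

definition jacobi_op :: "nat \<Rightarrow> real poly \<Rightarrow> real poly" where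
  "jacobi_op j g = - (W * pderiv (pderiv g)) - smult (real (Suc j)) (pderiv W * pderiv g)"

lemma W_power_jacobi_op: "W ^ j * jacobi_op j g = - pderiv (W ^ Suc j * pderiv g)"
  by (simp only: jacobi_op_def pderiv_mult[of "W ^ Suc j"] pderiv_power_Suc)
      (simp add: algebra_simps)

text \<open>Integration by parts turns the operator into the form with exponent \<open>j + 1\<close> on
  derivatives; in particular the operator is symmetric.\<close>

lemma jform_jacobi_op: "jform j (jacobi_op j g) h = jform (Suc j) (pderiv g) (pderiv h)"
proof -
  have "pderiv (W * (W ^ j * pderiv g * h)) = pderiv ((W ^ Suc j * pderiv g) * h)"
    by (simp add: mult_ac)
  also have "\<dots> = W ^ Suc j * pderiv g * pderiv h - W ^ j * jacobi_op j g * h"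
    unfolding W_power_jacobi_op by (subst pderiv_mult) (simp add: mult_ac del: power_Suc)
  finally show ?thesis
    using int_poly_pderiv_vanishing[of "W ^ j * pderiv g * h"]
        by (simp add: jform_def int_poly_diff)
qed

lemma jform_jacobi_op_commute: "jform j (jacobi_op j g) h = jform j g (jacobi_op j h)"
  by (metis jform_jacobi_op jform_commute)

lemma coeff_W_mult:
  "coeff (W * p) i = - a * b * coeff p i + (a + b) * (case i of 0 \<Rightarrow> 0 | Suc k \<Rightarrow> coeff p k)
     - (case i of Suc (Suc k) \<Rightarrow> coeff p k | _ \<Rightarrow> 0)"
  by (auto simp: W_def coeff_pCons split: nat.split)

text \<open>In the basis of monomials the operator is triangular, and its diagonal entries are its
  eigenvalues.\<close>

lemma coeff_jacobi_op:
  assumes "g \<in> polys_below (Suc N)" "i \<ge> N"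
  shows "coeff (jacobi_op j g) i = real i * (real i + 2 * real j + 1) * coeff g i"
proof -
  have z: "coeff g i' = 0" if "i' > N" for i'
    using assms that by (auto simp: polys_below_def)
  have W': "pderiv W * q = smult (a + b) q - smult 2 (pCons 0 q)" for q
    by (simp add: W_def pderiv_pCons)
  show ?thesis
    using assms(2) unfolding jacobi_op_def W' coeff_diff coeff_minus coeff_smult coeff_W_mult
    by (cases i; cases "i - 1") (auto simp: coeff_pderiv coeff_pCons z algebra_simps)
qed

lemma jacobi_op_polys_below: "g \<in> polys_below N \<Longrightarrow> jacobi_op j g \<in> polys_below N"
  using coeff_jacobi_op[of g N] by (auto simp: polys_below_def)

text \<open>A polynomial orthogonal to all degrees below \<open>N\<close> only has components along
  eigenpolynomials of degree at least \<open>N\<close>, and the eigenvalues \<open>i (i + 2 j + 1)\<close> increase with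
  the degree. Instead of an eigenbasis, the induction on \<open>M\<close> splits off the eigenpolynomial of
  top degree.\<close>

lemma spectral_gap:
  assumes "g \<in> polys_below M" "\<forall>q \<in> polys_below N. jform j g q = 0"
  shows "real N * (real N + 2 * real j + 1) * jform j g g \<le> jform (Suc j) (pderiv g) (pderiv g)"
  using assms
proof (induction M arbitrary: g)
  case 0
  then show ?case by (simp add: jform_linear)
next
  case (Suc M)
  define ev where "ev = (\<lambda>i. real i * (real i + 2 * real j + 1))"
  show ?case
  proof (cases "M < N")
    case True
    then have "jform j g g = 0"
      using Suc.prems polys_below_mono[of g "Suc M" N] by auto
    then show ?thesis
      using jform_nonneg by simp
  next
    case False
    then have NM: "N \<le> M" by simp
    obtain g0 where g0: "g0 \<in> polys_below M"
        "\<forall>q \<in> polys_below M. jform j (monom 1 M - g0) q = 0"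
      using orthogonal_projection by blast
    define e where "e = monom 1 M - g0"
    have e: "e \<in> polys_below (Suc M)" "coeff e M = 1" "\<And>q. q \<in> polys_below M \<Longrightarrow> jform j e q = 0"
      using g0 by (auto simp: e_def polys_below_def)
    \<comment> \<open>e is an eigenpolynomial: the difference below has lower degree by triangularity and is
        orthogonal to all polynomials of lower degree by symmetry.\<close>
    have "coeff (jacobi_op j e - smult (ev M) e) i = 0" if "M \<le> i" for i
      using coeff_jacobi_op[OF e(1) that] e(1) that
      by (cases "i = M") (auto simp: polys_below_def ev_def)
    then have "jacobi_op j e - smult (ev M) e \<in> polys_below M"
      by (auto simp: polys_below_def)
    moreover have "jform j (jacobi_op j e - smult (ev M) e) q = 0" if "q \<in> polys_below M" for q
      using e(3)[OF jacobi_op_polys_below[OF that]] e(3)[OF that]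
      by (simp add: jform_linear jform_jacobi_op_commute)
    ultimately have "jacobi_op j e - smult (ev M) e = 0"
      using jform_definite by blast
    then have eigen_e: "jacobi_op j e = smult (ev M) e" by simp
    obtain h where h: "h \<in> polys_below M" "g = smult (coeff g M) e + h"
      using polys_below_Suc_decompose[OF Suc.prems(1) e(1,2)] .
    define c where "c = coeff g M"
    have g: "g = smult c e + h" using h(2) by (simp add: c_def)
    have "\<forall>q \<in> polys_below N. jform j h q = 0"
      using Suc.prems(2) e(3) polys_below_mono[OF _ NM] by (auto simp: g jform_linear)
    from Suc.IH[OF h(1) this]
    have IH: "ev N * jform j h h \<le> jform (Suc j) (pderiv h) (pderiv h)"
      by (simp add: ev_def)
    have eh: "jform j e h = 0" "jform j h e = 0"
      using e(3)[OF h(1)] jform_commute by metis+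
    have "ev N * jform j g g = ev N * (c\<^sup>2 * jform j e e) + ev N * jform j h h"
      by (simp add: g jform_linear eh power2_eq_square algebra_simps)
    also have "\<dots> \<le> ev M * (c\<^sup>2 * jform j e e) + jform (Suc j) (pderiv h) (pderiv h)"
      using NM jform_nonneg[of j e] IH
      by (intro add_mono mult_right_mono) (auto simp: ev_def intro!: mult_mono)
    also have "\<dots> = jform j (jacobi_op j g) g"
    proof -
      have opg: "jacobi_op j g = smult c (jacobi_op j e) + jacobi_op j h"
        by (simp add: g jacobi_op_def pderiv_add pderiv_smult algebra_simps smult_add_right
            smult_diff_right)
      have "jform j (jacobi_op j h) e = 0"
        using jform_jacobi_op_commute[of j h e] eh by (simp add: eigen_e jform_linear)
      then show ?thesis
        unfolding opg eigen_e jform_jacobi_op[symmetric]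
        by (simp add: g jform_linear eh power2_eq_square algebra_simps)
    qed
    also have "\<dots> = jform (Suc j) (pderiv g) (pderiv g)"
      by (rule jform_jacobi_op)
    finally show ?thesis by (simp add: ev_def)
  qed
qed

text \<open>Each test polynomial is a derivative, so symmetry of the operator moves the derivative
  from \<open>g\<close> to the test polynomial, at the price of raising the exponent of the weight.\<close>

lemma orthogonal_pderiv:
  assumes "\<forall>q \<in> polys_below (Suc N). jform j g q = 0" "q \<in> polys_below N"
  shows "jform (Suc j) (pderiv g) q = 0"
proof -
  obtain r where "r \<in> polys_below (Suc N)" "pderiv r = q"
    using antiderivative_poly[OF assms(2)] by blast
  then show ?thesis
    using jform_jacobi_op_commute[of j g r] jform_jacobi_op[of j g r] assms(1) jacobi_op_polys_below
        by auto
qed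

text \<open>By \<open>orthogonal_pderiv\<close> the derivatives of \<open>g\<close> remain orthogonal to polynomials, for a
  higher power of the weight and one degree less each time, so that the spectral gap applies \<open>n\<close>
  times in succession.\<close>

lemma iterated_spectral_gap:
  assumes "n \<le> N" "\<forall>q \<in> polys_below N. jform 0 g q = 0"
  shows "(\<forall>q \<in> polys_below (N - n). jform n ((pderiv ^^ n) g) q = 0) \<and>
    (\<Prod>i<n. (real N - real i) * (real N + real i + 1)) * jform 0 g g
      \<le> jform n ((pderiv ^^ n) g) ((pderiv ^^ n) g)"
  using assms
proof (induction n)
  case 0
  then show ?case by simp
next
  case (Suc n)
  let ?g = "(pderiv ^^ n) g"
  have IH: "\<forall>q \<in> polys_below (N - n). jform n ?g q = 0"
    "(\<Prod>i<n. (real N - real i) * (real N + real i + 1)) * jform 0 g g \<le> jform n ?g ?g"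
    using Suc by auto
  have "jform (Suc n) (pderiv ?g) q = 0" if "q \<in> polys_below (N - Suc n)" for q
    using IH(1) Suc.prems(1) that
    by (intro orthogonal_pderiv[of "N - Suc n"]) (simp_all add: Suc_diff_Suc)
  moreover have "(\<Prod>i<Suc n. (real N - real i) * (real N + real i + 1)) * jform 0 g g
      \<le> jform (Suc n) (pderiv ?g) (pderiv ?g)"
  proof -
    obtain M where "?g \<in> polys_below M"
      using in_some_polys_below by blast
    from spectral_gap[OF this IH(1)]
    have *: "(real N - real n) * (real N + real n + 1) * jform n ?g ?g
        \<le> jform (Suc n) (pderiv ?g) (pderiv ?g)"
      using Suc.prems(1) by (simp add: of_nat_diff algebra_simps)
    have "(real N - real n) * (real N + real n + 1)
          * ((\<Prod>i<n. (real N - real i) * (real N + real i + 1)) * jform 0 g g)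
        \<le> (real N - real n) * (real N + real n + 1) * jform n ?g ?g"
      using Suc.prems(1) by (intro mult_left_mono IH(2)) auto
    with * show ?thesis by (simp add: mult_ac)
  qed
  ultimately show ?case by simp
qed

text \<open>The \<open>n\<close>-th derivative of the residual \<open>f - p\<close> is again the residual of an orthogonal
  projection of \<open>f\<^bsup>(n)\<^esup>\<close>, hence not larger than \<open>f\<^bsup>(n)\<^esup>\<close> in the norm with exponent \<open>n\<close>.\<close>

lemma poly_best_approximation:
  fixes f :: "real poly"
  assumes "d \<ge> 1" "n \<le> d + 1"
  obtains p where "degree p \<le> d"
    "jform 0 (f - p) (f - p) \<le> real n ^ n / real d ^ (2 * n)
        * jform n ((pderiv ^^ n) f) ((pderiv ^^ n) f)"
proof -
  obtain p where p: "p \<in> polys_below (Suc d)"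
      "\<forall>q \<in> polys_below (Suc d). jform 0 (f - p) q = 0"
    using orthogonal_projection by blast
  have diff: "(pderiv ^^ i) (f - q) = (pderiv ^^ i) f - (pderiv ^^ i) q" for i q
    by (induction i) (auto simp: pderiv_diff)
  let ?f = "(pderiv ^^ n) f" and ?p = "(pderiv ^^ n) p" and ?g = "(pderiv ^^ n) (f - p)"
  have "?p \<in> polys_below (Suc d - n)"
    using assms(2)
  proof (induction n)
    case 0
    then show ?case using p by simp
  next
    case (Suc n)
    then have "(pderiv ^^ n) p \<in> polys_below (Suc (Suc d - Suc n))"
      by (simp add: Suc_diff_le)
    then show ?case using pderiv_polys_below by simp
  qed
  then have orth: "jform n ?g ?p = 0" "jform n ?p ?g = 0"
    using iterated_spectral_gap[OF _ p(2), of n] assms(2) jform_commute by auto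
  have f: "?f = ?g + ?p" by (simp add: diff)
  have "jform n ?f ?f = jform n ?g ?g + jform n ?p ?p"
    unfolding f by (simp add: jform_linear orth)
  then have "jform n ?g ?g \<le> jform n ?f ?f"
    using jform_nonneg by simp
  moreover have "(\<Prod>i<n. (real (Suc d) - real i) * (real (Suc d) + real i + 1))
      * jform 0 (f - p) (f - p) \<le> jform n ?g ?g"
    using iterated_spectral_gap[OF _ p(2), of n] assms(2) by simp
  moreover have "real d ^ (2 * n) / real n ^ n * jform 0 (f - p) (f - p)
     \<le> (\<Prod>i<n. (real (Suc d) - real i) * (real (Suc d) + real i + 1)) * jform 0 (f - p) (f - p)"
  proof (intro mult_right_mono jform_nonneg)
    \<comment> \<open>As i < n and n \<le> d + 1, the first factor d + 1 - i is at least d / n, which is smallest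
        for i = n - 1.\<close>
    have "real d ^ (2 * n) / real n ^ n = (\<Prod>i<n. real d / real n * real d)"
      by (simp add: power_mult power2_eq_square power_mult_distrib power_divide)
    also have "\<dots> \<le> (\<Prod>i<n. (real (Suc d) - real i) * (real (Suc d) + real i + 1))"
    proof (intro prod_mono conjI mult_mono)
      fix i assume "i \<in> {..<n}"
      then have i: "real i \<le> real n - 1" "1 \<le> real n" by auto
      have nd: "real n \<le> real d + 1" using assms(2) by linarith
      have "(real n - 1) * 1 \<le> (real n - 1) * (real d + 2 - real n)"
        using i nd by (intro mult_left_mono) auto
      then have "real d \<le> real n * (real d + 2 - real n)"
        using nd by (simp add: algebra_simps)
      also have "\<dots> \<le> real n * (real (Suc d) - real i)"
        using i by (intro mult_left_mono) auto
      finally show "real d / real n \<le> real (Suc d) - real i"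
        using i by (simp add: divide_le_eq mult.commute)
      show "0 \<le> real (Suc d) - real i" using i nd by simp
    qed auto
    finally show "real d ^ (2 * n) / real n ^ n
        \<le> (\<Prod>i<n. (real (Suc d) - real i) * (real (Suc d) + real i + 1))" .
  qed
  ultimately have *: "real d ^ (2 * n) / real n ^ n * jform 0 (f - p) (f - p) \<le> jform n ?f ?f"
    by linarith
  have "real n ^ n > 0" by (cases n) auto
  with * assms(1) have "jform 0 (f - p) (f - p) \<le> real n ^ n / real d ^ (2 * n) * jform n ?f ?f"
    by (simp add: field_simps)
  with that[OF degree_polys_below[OF p(1)]] show ?thesis by blast
qed

end

lemma weierstrass_poly:
  fixes g :: "real \<Rightarrow> real"
  assumes "continuous_on {a..b} g" "e > 0"
  obtains q where "\<And>x. x \<in> {a..b} \<Longrightarrow> \<bar>g x - poly q x\<bar> \<le> e"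
proof -
  obtain h where h: "real_polynomial_function h" "\<And>x. x \<in> {a..b} \<Longrightarrow> \<bar>g x - h x\<bar> < e"
    using Stone_Weierstrass_real_polynomial_function[OF _ assms] by auto
  then obtain c n where "h = (\<lambda>x. \<Sum>i\<le>n. c i * x ^ i)"
    using real_polynomial_function_iff_sum by blast
  with h(2) show thesis
    by (intro that[of "\<Sum>i\<le>n. monom (c i) i"]) (force simp: poly_sum poly_monom)
qed

text \<open>Approximate the highest derivative and integrate \<open>n\<close> times, matching the values at \<open>a\<close>.\<close>

lemma weierstrass_poly_nderiv:
  fixes f g :: "real \<Rightarrow> real"
  assumes "has_nderiv n f g" "e > 0" "a < b"
  shows "\<exists>q. \<forall>x\<in>{a..b}. \<bar>f x - poly q x\<bar> \<le> e \<and> \<bar>g x - poly ((pderiv ^^ n) q) x\<bar> \<le> e"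
  using assms
proof (induction n arbitrary: f e)
  case 0
  then have "continuous_on {a..b} g" "g = f"
    by (auto intro: continuous_on_subset)
  with weierstrass_poly[of a b g e] 0 show ?case by (metis funpow_0)
next
  case (Suc n)
  then obtain D where D: "\<And>x. (f has_vector_derivative D x) (at x)" "has_nderiv n D g"
    by auto
  define e' where "e' = e / (1 + (b - a))"
  have e': "e' > 0" "e' \<le> e" "e' * (b - a) \<le> e"
    using Suc.prems by (auto simp: e'_def field_simps)
  obtain q where q: "\<And>x. x \<in> {a..b} \<Longrightarrow> \<bar>D x - poly q x\<bar> \<le> e'"
      "\<And>x. x \<in> {a..b} \<Longrightarrow> \<bar>g x - poly ((pderiv ^^ n) q) x\<bar> \<le> e'"
    using Suc.IH[OF D(2) e'(1) Suc.prems(3)] by blast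
  obtain r where r: "pderiv r = q"
    using antiderivative_poly in_some_polys_below by blast
  define Q where "Q = r + [:f a - poly r a:]"
  have Q: "pderiv Q = q" "poly Q a = f a"
    by (auto simp: Q_def pderiv_add r)
  have "\<bar>f x - poly Q x\<bar> \<le> e" if x: "x \<in> {a..b}" for x
  proof -
    have der: "((\<lambda>x. f x - poly Q x) has_real_derivative D y - poly q y) (at y within {a..b})" for y
      using D(1)[of y] poly_DERIV[of Q y] unfolding Q(1)
      by (intro has_field_derivative_at_within[OF DERIV_diff])
         (simp_all add: has_real_derivative_iff_has_vector_derivative)
    have "norm ((f x - poly Q x) - (f a - poly Q a)) \<le> e' * norm (x - a)"
      by (rule field_differentiable_bound[of "{a..b}" _ "\<lambda>y. D y - poly q y"])
         (use der q x in auto)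
    also have "\<dots> \<le> e' * (b - a)"
      using x e' by (intro mult_left_mono) auto
    finally show ?thesis using e' Q by simp
  qed
  moreover have "(pderiv ^^ Suc n) Q = (pderiv ^^ n) q"
    by (simp add: funpow_Suc_right Q del: funpow.simps(2))
  ultimately show ?case
    using q(2) e'(2) by (intro exI[of _ Q]) (fastforce intro: order_trans simp del: funpow.simps)
qed

context proper_interval
begin

definition weighted_seminorm2 :: "nat \<Rightarrow> (real \<Rightarrow> 'b::real_normed_vector) \<Rightarrow> real" where
  "weighted_seminorm2 n g = integral {a..b} (\<lambda>s. ((s - a) * (b - s)) ^ n * (norm (g s))\<^sup>2)"

lemma jform_eq_integral: 
  "jform n p p = integral {a..b} (\<lambda>s. ((s - a) * (b - s)) ^ n * (poly p s)\<^sup>2)"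
  unfolding jform_def int_poly_def
  by (simp add: weighted_square[abs_def] del: poly_mult poly_power)

lemma weight_nonneg: "s \<in> {a..b} \<Longrightarrow> 0 \<le> ((s - a) * (b - s)) ^ n"
  by simp

text \<open>The polynomial case is applied to a polynomial \<open>q\<close> close to \<open>f\<close> whose \<open>n\<close>-th derivative is
  close to \<open>g\<close>. The slack \<open>e\<close> leaves room for the distance of \<open>q\<close> to \<open>f\<close>; it may be chosen as
  small as the bound that is aimed at.\<close>

lemma real_best_approximation:
  fixes f g :: "real \<Rightarrow> real"
  assumes f: "has_nderiv n f g" and d: "d \<ge> 1" "n \<le> d + 1" and "e > 0"
  shows "\<exists>p. degree p \<le> d \<and> integral {a..b} (\<lambda>s. (f s - poly p s)\<^sup>2)
     \<le> 4 * (real n ^ n / real d ^ (2 * n)) * weighted_seminorm2 n g + e"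
proof -
  define c where "c = real n ^ n / real d ^ (2 * n)"
  define w where "w = (\<lambda>s. ((s - a) * (b - s)) ^ n)"
  have c: "0 \<le> c" by (simp add: c_def)
  have cont: "continuous_on {a..b} f" "continuous_on {a..b} g" "continuous_on {a..b} w"
    using has_nderiv_continuous[OF f] has_nderiv_continuous_deriv[OF f]
    by (auto simp: w_def intro: continuous_on_subset intro!: continuous_intros)
  have w_nonneg: "s \<in> {a..b} \<Longrightarrow> 0 \<le> w s" for s
    unfolding w_def by (rule weight_nonneg)
  have jform_w: "jform n r r = integral {a..b} (\<lambda>s. w s * (poly r s)\<^sup>2)" for r
    by (simp add: jform_eq_integral w_def)
  have intw: "0 \<le> integral {a..b} w"
    by (intro integral_nonneg integrable_continuous_interval cont w_nonneg)
  define V where "V = 2 * (b - a) + 4 * c * integral {a..b} w"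
  have V: "V > 0" using less c intw by (auto simp: V_def intro!: add_pos_nonneg)
  \<comment> \<open>V is the sum of the factors of the square of e' in the estimate below, so that these
      contributions add up to e.\<close>
  define e' where "e' = sqrt (e / V)"
  have e': "e' > 0" "e'\<^sup>2 * V = e"
    using V \<open>e > 0\<close> by (auto simp: e'_def)
  obtain q where q: "\<And>s. s \<in> {a..b} \<Longrightarrow> \<bar>f s - poly q s\<bar> \<le> e'"
      "\<And>s. s \<in> {a..b} \<Longrightarrow> \<bar>g s - poly ((pderiv ^^ n) q) s\<bar> \<le> e'"
    using weierstrass_poly_nderiv[OF f e'(1) less] by blast
  obtain p where p: "degree p \<le> d"
      "jform 0 (q - p) (q - p) \<le> c * jform n ((pderiv ^^ n) q) ((pderiv ^^ n) q)"
    using poly_best_approximation[OF d] unfolding c_def by blast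
  have parallelogram: "x\<^sup>2 \<le> 2 * t\<^sup>2 + 2 * y\<^sup>2" if "\<bar>x - y\<bar> \<le> t" for x y t :: real
  proof -
    have "(x - y)\<^sup>2 \<le> t\<^sup>2"
      using that by (metis abs_ge_zero power2_abs power_mono)
    moreover have "0 \<le> (x - 2 * y)\<^sup>2" by simp
    ultimately show ?thesis by (simp add: power2_eq_square algebra_simps)
  qed
  have "integral {a..b} (\<lambda>s. (f s - poly p s)\<^sup>2)
      \<le> integral {a..b} (\<lambda>s. 2 * e'\<^sup>2 + 2 * (poly (q - p) s)\<^sup>2)"
  proof (intro integral_le integrable_continuous_interval)
    fix s assume "s \<in> {a..b}"
    from q(1)[OF this] show "(f s - poly p s)\<^sup>2 \<le> 2 * e'\<^sup>2 + 2 * (poly (q - p) s)\<^sup>2"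
      by (intro parallelogram) simp
  qed (intro continuous_intros cont)+
  also have "\<dots> = 2 * e'\<^sup>2 * (b - a) + 2 * jform 0 (q - p) (q - p)"
    using less by (subst integral_add)
      (auto simp: jform_eq_integral intro!: integrable_continuous_interval continuous_intros)
  also have "\<dots> \<le> 2 * e'\<^sup>2 * (b - a) + 2 * (c * jform n ((pderiv ^^ n) q) ((pderiv ^^ n) q))"
    using p(2) by simp
  also have "jform n ((pderiv ^^ n) q) ((pderiv ^^ n) q)
      \<le> integral {a..b} (\<lambda>s. 2 * (w s * (g s)\<^sup>2) + 2 * e'\<^sup>2 * w s)"
    unfolding jform_w
  proof (intro integral_le integrable_continuous_interval)
    fix s assume s: "s \<in> {a..b}"
    have "\<bar>poly ((pderiv ^^ n) q) s - g s\<bar> \<le> e'"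
      using q(2)[OF s] by (simp add: abs_minus_commute)
    from mult_left_mono[OF parallelogram[OF this] w_nonneg[OF s]]
    show "w s * (poly ((pderiv ^^ n) q) s)\<^sup>2 \<le> 2 * (w s * (g s)\<^sup>2) + 2 * e'\<^sup>2 * w s"
      by (simp add: algebra_simps)
  next
    show "continuous_on {a..b} (\<lambda>s. w s * (poly ((pderiv ^^ n) q) s)\<^sup>2)"
      by (intro continuous_intros cont)
  qed (intro continuous_intros cont)
  also have "\<dots> = 2 * weighted_seminorm2 n g + 2 * e'\<^sup>2 * integral {a..b} w"
    by (subst integral_add) (auto simp: weighted_seminorm2_def w_def
        intro!: integrable_continuous_interval continuous_intros cont)
  finally have "integral {a..b} (\<lambda>s. (f s - poly p s)\<^sup>2)
      \<le> 4 * c * weighted_seminorm2 n g + e'\<^sup>2 * V"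
    using c by (simp add: V_def algebra_simps mult_right_mono)
  with p(1) show ?thesis
    unfolding e'(2) c_def by blast
qed

lemma complex_best_approximation:
  fixes f g :: "real \<Rightarrow> complex"
  assumes f: "has_nderiv n f g" and d: "d \<ge> 1" "n \<le> d + 1" and "e > 0"
  shows "\<exists>p. degree p \<le> d \<and> integral {a..b} (\<lambda>s. (norm (f s - poly p (of_real s)))\<^sup>2)
     \<le> 4 * (real n ^ n / real d ^ (2 * n)) * weighted_seminorm2 n g + e"
proof -
  define c where "c = 4 * (real n ^ n / real d ^ (2 * n))"
  have cont: "continuous_on {a..b} f" "continuous_on {a..b} g"
    using has_nderiv_continuous[OF f] has_nderiv_continuous_deriv[OF f]
    by (auto intro: continuous_on_subset)
  have e2: "e / 2 > 0" using \<open>e > 0\<close> by simp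
  obtain p1 where p1: "degree p1 \<le> d" "integral {a..b} (\<lambda>s. (Re (f s) - poly p1 s)\<^sup>2)
     \<le> c * weighted_seminorm2 n (\<lambda>s. Re (g s)) + e / 2"
    using real_best_approximation[OF has_nderiv_linear[OF bounded_linear_Re f] d e2]
    unfolding c_def by blast
  obtain p2 where p2: "degree p2 \<le> d" "integral {a..b} (\<lambda>s. (Im (f s) - poly p2 s)\<^sup>2)
     \<le> c * weighted_seminorm2 n (\<lambda>s. Im (g s)) + e / 2"
    using real_best_approximation[OF has_nderiv_linear[OF bounded_linear_Im f] d e2]
    unfolding c_def by blast
  define p where "p = map_poly complex_of_real p1 + smult \<i> (map_poly complex_of_real p2)"
  have "poly (map_poly complex_of_real r) (of_real s) = of_real (poly r s)" for r s
    by (induction r) (auto simp: map_poly_pCons)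
  then have poly_p: "poly p (of_real s) = Complex (poly p1 s) (poly p2 s)" for s
    by (simp add: p_def complex_eq_iff)
  have "degree p \<le> d"
    unfolding p_def using p1(1) p2(1)
    by (intro degree_add_le order_trans[OF degree_smult_le]) (simp_all add: degree_map_poly)
  moreover have "integral {a..b} (\<lambda>s. (norm (f s - poly p (of_real s)))\<^sup>2)
     = integral {a..b} (\<lambda>s. (Re (f s) - poly p1 s)\<^sup>2) + integral {a..b} (\<lambda>s. (Im (f s)
         - poly p2 s)\<^sup>2)"
    unfolding cmod_power2 poly_p
    by (subst integral_add) (auto intro!: integrable_continuous_interval continuous_intros cont)
  moreover have "weighted_seminorm2 n g
      = weighted_seminorm2 n (\<lambda>s. Re (g s)) + weighted_seminorm2 n (\<lambda>s. Im (g s))"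
    unfolding weighted_seminorm2_def cmod_power2 distrib_left
    by (subst integral_add) (auto intro!: integrable_continuous_interval continuous_intros cont)
  ultimately show ?thesis
    using p1(2) p2(2) unfolding c_def[symmetric]
    by (intro exI[of _ p]) (auto simp: distrib_left)
qed

end

section \<open>Derivatives of the truncated asymptotic expansion\<close>

lemma periodic_int:
  fixes f :: "real \<Rightarrow> 'a"
  assumes "\<And>s. f (s + p) = f s"
  shows "f (s + p * real_of_int n) = f s"
proof -
  have *: "f (s + p * real m) = f s" for s m
  proof (induction m)
    case (Suc m)
    then show ?case using assms[of "s + p * real m"] by (simp add: algebra_simps)
  qed simp
  show ?thesis
  proof (cases "n \<ge> 0")
    case True
    then show ?thesis using *[of s "nat n"] by simp
  next
    case False
    then show ?thesis using *[of "s + p * real_of_int n" "nat (- n)"] by simp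
  qed
qed

lemma periodic_representative:
  fixes p :: real
  assumes "p > 0"
  obtains n where "c \<le> s + p * real_of_int n" "s + p * real_of_int n < c + p"
proof
  let ?n = "- \<lfloor>(s - c) / p\<rfloor>"
  have "real_of_int \<lfloor>(s - c) / p\<rfloor> * p \<le> s - c"
    unfolding pos_le_divide_eq[OF assms, symmetric] by linarith
  moreover have "s - c < (real_of_int \<lfloor>(s - c) / p\<rfloor> + 1) * p"
    unfolding pos_divide_less_eq[OF assms, symmetric] by linarith
  ultimately show "c \<le> s + p * real_of_int ?n" "s + p * real_of_int ?n < c + p"
    by (simp_all add: algebra_simps)
qed

lemma continuous_periodic_bounded:
  fixes f :: "real \<Rightarrow> 'a::real_normed_vector"
  assumes "p > 0" "\<And>s. f (s + p) = f s" "continuous_on UNIV f"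
  shows "\<exists>C. \<forall>s. norm (f s) \<le> C"
proof -
  have "compact (f ` {0..p})"
    using assms(3) by (intro compact_continuous_image) (auto intro: continuous_on_subset)
  then obtain C where C: "\<And>s. s \<in> {0..p} \<Longrightarrow> norm (f s) \<le> C"
    using compact_imp_bounded bounded_iff by (metis imageI)
  have "norm (f s) \<le> C" for s
  proof -
    obtain n where "0 \<le> s + p * real_of_int n" "s + p * real_of_int n < 0 + p"
      using periodic_representative[OF assms(1)] .
    with C[of "s + p * real_of_int n"] show ?thesis
      by (simp add: periodic_int[where f = f, OF assms(2)])
  qed
  then show ?thesis by blast
qed

definition bounded_derivs :: "(real \<Rightarrow> complex) \<Rightarrow> bool" where
  "bounded_derivs B \<longleftrightarrow> (\<forall>n. \<exists>h. has_nderiv n B h \<and> (\<exists>C. \<forall>s. norm (h s) \<le> C))"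

lemma bounded_derivs_bounded:
  assumes "bounded_derivs B"
  obtains C where "C \<ge> 0" "\<And>s. norm (B s) \<le> C"
proof -
  obtain h C where "has_nderiv 0 B h" "\<forall>s. norm (h s) \<le> C"
    using assms unfolding bounded_derivs_def by blast
  then have *: "norm (B s) \<le> C" for s by simp
  moreover from *[of 0] have "C \<ge> 0" using norm_ge_zero order_trans by blast
  ultimately show thesis using that by blast
qed

lemma bounded_derivs_continuous: "bounded_derivs B \<Longrightarrow> continuous_on UNIV B"
  unfolding bounded_derivs_def using has_nderiv_continuous by blast

lemma bounded_derivs_deriv:
  assumes "bounded_derivs B"
  obtains D where "bounded_derivs D" "\<And>s. (B has_vector_derivative D s) (at s)"
proof
  let ?D = "\<lambda>s. vector_derivative B (at s)"
  have *: "(B has_vector_derivative ?D s) (at s)" "has_nderiv n ?D h" 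
    if h: "has_nderiv (Suc n) B h" for n s h
  proof -
    obtain D where D: "\<And>s. (B has_vector_derivative D s) (at s)" "has_nderiv n D h"
      using h by auto
    moreover from this have "?D = D"
      by (auto simp: fun_eq_iff intro: vector_derivative_at)
    ultimately show "(B has_vector_derivative ?D s) (at s)" "has_nderiv n ?D h"
      by auto
  qed
  show "bounded_derivs ?D"
    using assms *(2) unfolding bounded_derivs_def by meson
  show "(B has_vector_derivative ?D s) (at s)" for s
    using assms *(1) unfolding bounded_derivs_def by meson
qed

lemma bounded_derivs_mult:
  assumes "bounded_derivs A" "bounded_derivs B"
  shows "bounded_derivs (\<lambda>s. A s * B s)"
proof -
  have "\<exists>h. has_nderiv n (\<lambda>s. A s * B s) h \<and> (\<exists>C. \<forall>s. norm (h s) \<le> C)"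
    if "bounded_derivs A" "bounded_derivs B" for n A B
    using that
  proof (induction n arbitrary: A B)
    case 0
    obtain C C' where "\<And>s. norm (A s) \<le> C" "\<And>s. norm (B s) \<le> C'" "C \<ge> 0" "C' \<ge> 0"
      using 0 bounded_derivs_bounded by metis
    then have "norm (A s * B s) \<le> C * C'" for s
      by (simp add: norm_mult mult_mono)
    moreover have "continuous_on UNIV (\<lambda>s. A s * B s)"
      using 0 by (intro continuous_intros bounded_derivs_continuous)
    ultimately show ?case by (auto simp del: norm_mult)
  next
    case (Suc n)
    obtain A' where A': "bounded_derivs A'" "\<And>s. (A has_vector_derivative A' s) (at s)"
      using bounded_derivs_deriv Suc.prems by metis
    obtain B' where B': "bounded_derivs B'" "\<And>s. (B has_vector_derivative B' s) (at s)"
      using bounded_derivs_deriv Suc.prems by metis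
    obtain h1 C1 where h1: "has_nderiv n (\<lambda>s. A s * B' s) h1" "\<forall>s. norm (h1 s) \<le> C1"
      using Suc.IH[OF Suc.prems(1) B'(1)] by blast
    obtain h2 C2 where h2: "has_nderiv n (\<lambda>s. A' s * B s) h2" "\<forall>s. norm (h2 s) \<le> C2"
      using Suc.IH[OF A'(1) Suc.prems(2)] by blast
    have "has_nderiv (Suc n) (\<lambda>s. A s * B s) (\<lambda>s. h1 s + h2 s)"
      by (rule has_nderiv_SucI[OF _ has_nderiv_add[OF h1(1) h2(1)]])
         (rule has_vector_derivative_mult[OF A'(2) B'(2)])
    moreover have "norm (h1 s + h2 s) \<le> C1 + C2" for s
      using h1(2) h2(2) by (meson add_mono norm_triangle_le)
    ultimately show ?case by blast
  qed
  then show ?thesis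
    using assms unfolding bounded_derivs_def by blast
qed

lemma smooth_periodic_bounded_derivs:
  assumes "smooth_on UNIV B" "p > 0" "\<And>s. B (s + p) = B s"
  shows "bounded_derivs B"
  unfolding bounded_derivs_def
proof
  fix n
  have h: "has_nderiv n B (nderiv n B)"
    by (rule smooth_on_UNIV_has_nderiv[OF assms(1)])
  moreover have "\<exists>C. \<forall>s. norm (nderiv n B s) \<le> C"
    by (rule continuous_periodic_bounded[OF assms(2) has_nderiv_periodic[OF h assms(3)]
        has_nderiv_continuous_deriv[OF h]])
  ultimately show "\<exists>h. has_nderiv n B h \<and> (\<exists>C. \<forall>s. norm (h s) \<le> C)"
    by blast
qed

lemma real_smooth_periodic_bounded_derivs:
  fixes Z :: "real \<Rightarrow> real"
  assumes "smooth_on UNIV Z" "p > 0" "\<And>s. Z (s + p) = Z s"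
  shows "bounded_derivs (\<lambda>s. complex_of_real (Z s))"
  unfolding bounded_derivs_def
proof
  fix n
  have h: "has_nderiv n (\<lambda>s. complex_of_real (Z s)) (\<lambda>s. complex_of_real (nderiv n Z s))"
    by (rule has_nderiv_linear[OF bounded_linear_of_real smooth_on_UNIV_has_nderiv[OF assms(1)]])
  moreover have "\<exists>C. \<forall>s. norm (complex_of_real (nderiv n Z s)) \<le> C"
    by (rule continuous_periodic_bounded[OF assms(2) has_nderiv_periodic[OF h]
        has_nderiv_continuous_deriv[OF h]]) (simp add: assms(3))
  ultimately show "\<exists>h. has_nderiv n (\<lambda>s. complex_of_real (Z s)) h \<and> (\<exists>C. \<forall>s. norm (h s) \<le> C)"
    by blast
qed

lemma powr_shift_bound:
  fixes \<tau> \<mu> :: real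
  assumes "\<tau> \<ge> 1"
  shows "\<tau> powr \<mu> \<le> 2 powr \<bar>\<mu>\<bar> * (1 + \<tau>) powr \<mu>"
proof (cases "\<mu> \<ge> 0")
  case True
  have "\<tau> powr \<mu> \<le> 1 * (1 + \<tau>) powr \<mu>"
    using True assms by (simp add: powr_mono2)
  also have "\<dots> \<le> 2 powr \<bar>\<mu>\<bar> * (1 + \<tau>) powr \<mu>"
    by (intro mult_right_mono) (auto intro: ge_one_powr_ge_zero)
  finally show ?thesis .
next
  case False
  have "\<tau> powr \<mu> \<le> ((1 + \<tau>) / 2) powr \<mu>"
    using False assms by (intro powr_mono2') auto
  also have "\<dots> = 2 powr \<bar>\<mu>\<bar> * (1 + \<tau>) powr \<mu>"
    using False assms by (simp add: powr_divide powr_minus_divide)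
  finally show ?thesis .
qed

text \<open>The bound at \<open>+\<infinity>\<close> is the expansion with no terms subtracted, decay at \<open>-\<infinity>\<close> is faster than
  any power, and in between a continuous function is compared on a compact interval.\<close>

lemma symbol_bound:
  assumes "symbol_expansion \<psi> e c" "rapidly_decreasing_at_bot \<psi>" "smooth_on UNIV \<psi>"
  shows "\<exists>C\<ge>0. \<forall>\<tau>. norm (nderiv n \<psi> \<tau>) \<le> C * (1 + \<bar>\<tau>\<bar>) powr (real_of_int e - real n)"
proof -
  define \<mu> where "\<mu> = real_of_int e - real n"
  have cont: "continuous_on UNIV (nderiv n \<psi>)"
    by (rule has_nderiv_continuous_deriv[OF smooth_on_UNIV_has_nderiv[OF assms(3)]])
  have "(\<lambda>\<tau>. norm (nderiv n \<psi> \<tau>)) \<in> O[at_top](\<lambda>\<tau>. \<tau> powi (e - int n))"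
    using assms(1)[unfolded symbol_expansion_def, rule_format, of n 0] by simp
  then obtain c1 where c1: "c1 > 0"
      "eventually (\<lambda>\<tau>. norm (nderiv n \<psi> \<tau>) \<le> c1 * \<bar>\<tau> powi (e - int n)\<bar>) at_top"
    by (auto elim!: landau_o.bigE)
  then obtain T1 where T1: "\<And>\<tau>. \<tau> \<ge> T1 \<Longrightarrow> norm (nderiv n \<psi> \<tau>) \<le> c1 * \<bar>\<tau> powi (e - int n)\<bar>"
    by (auto simp: eventually_at_top_linorder)
  \<comment> \<open>For \<tau> \<le> - 1 this makes the power - N at most e - n.\<close>
  define N where "N = nat (int n - e)"
  have "(\<lambda>\<tau>. norm (nderiv n \<psi> \<tau>)) \<in> O[at_bot](\<lambda>\<tau>. \<tau> powi (- int N))"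
    using assms(2) unfolding rapidly_decreasing_at_bot_def by blast
  then obtain c2 where c2: "c2 > 0"
      "eventually (\<lambda>\<tau>. norm (nderiv n \<psi> \<tau>) \<le> c2 * \<bar>\<tau> powi (- int N)\<bar>) at_bot"
    by (auto elim!: landau_o.bigE)
  then obtain T2 where T2: "\<And>\<tau>. \<tau> \<le> T2 \<Longrightarrow> norm (nderiv n \<psi> \<tau>) \<le> c2 * \<bar>\<tau> powi (- int N)\<bar>"
    by (auto simp: eventually_at_bot_linorder)
  define T where "T = Max {1, T1, - T2}"
  have T: "T \<ge> 1" "T \<ge> T1" "- T \<le> T2" by (auto simp: T_def)
  have "compact ((\<lambda>\<tau>. norm (nderiv n \<psi> \<tau>) / (1 + \<bar>\<tau>\<bar>) powr \<mu>) ` {- T..T})"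
    by (intro compact_continuous_image continuous_intros continuous_on_subset[OF cont]) auto
  then obtain c3 where c3: "\<And>\<tau>. \<tau> \<in> {-T..T} \<Longrightarrow> norm (nderiv n \<psi> \<tau>) / (1 + \<bar>\<tau>\<bar>) powr \<mu> \<le> c3"
    using compact_imp_bounded bounded_real by (metis (no_types, lifting) abs_le_D1 imageI)
  define C where "C = \<bar>c3\<bar> + c1 * 2 powr \<bar>\<mu>\<bar> + c2 * 2 powr \<bar>\<mu>\<bar>"
  have C: "c3 \<le> C" "c1 * 2 powr \<bar>\<mu>\<bar> \<le> C" "c2 * 2 powr \<bar>\<mu>\<bar> \<le> C" "0 \<le> C"
    using mult_nonneg_nonneg[OF less_imp_le[OF c1(1)] powr_ge_zero[of 2 "\<bar>\<mu>\<bar>"]]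
      mult_nonneg_nonneg[OF less_imp_le[OF c2(1)] powr_ge_zero[of 2 "\<bar>\<mu>\<bar>"]]
    unfolding C_def by linarith+
  have powi: "\<bar>\<tau> powi k\<bar> = \<bar>\<tau>\<bar> powr real_of_int k" if "\<tau> \<noteq> 0" for \<tau> :: real and k
    using that by (simp add: power_int_abs flip: powr_real_of_int')
  have "norm (nderiv n \<psi> \<tau>) \<le> C * (1 + \<bar>\<tau>\<bar>) powr \<mu>" for \<tau>
  proof -
    consider "\<tau> \<ge> T" | "\<tau> \<le> - T" | "\<tau> \<in> {-T..T}" by fastforce
    then show ?thesis
    proof cases
      case 1
      then have "norm (nderiv n \<psi> \<tau>) \<le> c1 * \<bar>\<tau> powi (e - int n)\<bar>"
        using T1[of \<tau>] T by linarith
      also have "c1 * \<bar>\<tau> powi (e - int n)\<bar> = c1 * \<bar>\<tau>\<bar> powr \<mu>"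
        using powi[of \<tau> "e - int n"] 1 T unfolding \<mu>_def by simp
      also have "\<dots> \<le> c1 * (2 powr \<bar>\<mu>\<bar> * (1 + \<bar>\<tau>\<bar>) powr \<mu>)"
        using 1 T c1 by (intro mult_left_mono powr_shift_bound) auto
      also have "\<dots> \<le> C * (1 + \<bar>\<tau>\<bar>) powr \<mu>"
        unfolding mult.assoc[symmetric] by (intro mult_right_mono C) auto
      finally show ?thesis .
    next
      case 2
      then have "norm (nderiv n \<psi> \<tau>) \<le> c2 * \<bar>\<tau>\<bar> powr (- real N)"
        using T2[of \<tau>] T powi[of \<tau> "- int N"] by simp
      also have "\<dots> \<le> c2 * \<bar>\<tau>\<bar> powr \<mu>"
        using 2 T c2 by (intro mult_left_mono powr_mono) (auto simp: N_def \<mu>_def)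
      also have "\<dots> \<le> c2 * (2 powr \<bar>\<mu>\<bar> * (1 + \<bar>\<tau>\<bar>) powr \<mu>)"
        using 2 T c2 by (intro mult_left_mono powr_shift_bound) auto
      also have "\<dots> \<le> C * (1 + \<bar>\<tau>\<bar>) powr \<mu>"
        unfolding mult.assoc[symmetric] by (intro mult_right_mono C) auto
      finally show ?thesis .
    next
      case 3
      then have "norm (nderiv n \<psi> \<tau>) \<le> c3 * (1 + \<bar>\<tau>\<bar>) powr \<mu>"
        using c3 by (simp add: field_simps)
      also have "\<dots> \<le> C * (1 + \<bar>\<tau>\<bar>) powr \<mu>"
        by (intro mult_right_mono C) auto
      finally show ?thesis .
    qed
  qed
  with C(4) show ?thesis unfolding \<mu>_def by blast
qed

text \<open>Differentiating \<open>B \<psi>\<^bsup>(p)\<^esup>(\<kappa> Z)\<close> gives \<open>B' \<psi>\<^bsup>(p)\<^esup>(\<kappa> Z)\<close>, of the same kind, and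
  \<open>\<kappa> B Z' \<psi>\<^bsup>(p+1)\<^esup>(\<kappa> Z)\<close>, where the order of the symbol has dropped by one and
  \<open>\<kappa> / (1 + \<kappa> \<bar>Z\<bar>) = 1 / (1 / \<kappa> + \<bar>Z\<bar>)\<close> pays for the factor \<open>\<kappa>\<close>. Letting \<open>p\<close> and \<open>B\<close> vary in the
  induction on \<open>n\<close> makes the chain rule for higher derivatives unnecessary.\<close>

lemma composed_symbol_bound:
  fixes Z :: "real \<Rightarrow> real" and \<mu> :: real
  assumes \<psi>: "\<And>p \<tau>. (nderiv p \<psi> has_vector_derivative nderiv (Suc p) \<psi> \<tau>) (at \<tau>)"
      "\<And>p. \<exists>C\<ge>0. \<forall>\<tau>. norm (nderiv p \<psi> \<tau>) \<le> C * (1 + \<bar>\<tau>\<bar>) powr (\<mu> - real p)"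
    and Z: "bounded_derivs (\<lambda>s. complex_of_real (Z s))"
    and B: "bounded_derivs B"
  shows "\<exists>C\<ge>0. \<forall>\<kappa>\<ge>1. \<exists>h. has_nderiv n (\<lambda>s. B s * nderiv p \<psi> (\<kappa> * Z s)) h \<and>
      (\<forall>s. norm (h s) \<le> C * (1 + \<kappa> * \<bar>Z s\<bar>) powr (\<mu> - real p) / (1 / \<kappa> + \<bar>Z s\<bar>) ^ n)"
  using B
proof (induction n arbitrary: p B)
  case 0
  obtain CB where CB: "CB \<ge> 0" "\<And>s. norm (B s) \<le> CB"
    using bounded_derivs_bounded[OF 0] by blast
  obtain C where C: "C \<ge> 0" "\<And>\<tau>. norm (nderiv p \<psi> \<tau>) \<le> C * (1 + \<bar>\<tau>\<bar>) powr (\<mu> - real p)"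
    using \<psi>(2) by blast
  have "has_nderiv 0 (\<lambda>s. B s * nderiv p \<psi> (\<kappa> * Z s)) (\<lambda>s. B s * nderiv p \<psi> (\<kappa> * Z s))" for \<kappa>
  proof -
    have "continuous_on UNIV Z"
      using continuous_on_Re[OF bounded_derivs_continuous[OF Z]] by simp
    then have "continuous_on UNIV (\<lambda>s. nderiv p \<psi> (\<kappa> * Z s))"
      by (intro continuous_on_compose2[OF has_vector_derivative_continuous_on_UNIV[OF \<psi>(1)]]
          continuous_intros) auto
    then show ?thesis
      by (auto intro!: continuous_intros bounded_derivs_continuous[OF 0])
  qed
  moreover have "norm (B s * nderiv p \<psi> (\<kappa> * Z s))
      \<le> CB * C * (1 + \<kappa> * \<bar>Z s\<bar>) powr (\<mu> - real p) / (1 / \<kappa> + \<bar>Z s\<bar>) ^ 0" if "\<kappa> \<ge> 1" for \<kappa> s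
    using mult_mono[OF CB(2)[of s] C(2)[of "\<kappa> * Z s"] CB(1) norm_ge_zero] that
    by (simp add: norm_mult abs_mult mult.assoc)
  ultimately show ?case
    using mult_nonneg_nonneg[OF CB(1) C(1)] by blast
next
  case (Suc n)
  obtain B' where B': "bounded_derivs B'" "\<And>s. (B has_vector_derivative B' s) (at s)"
    using bounded_derivs_deriv Suc.prems by metis
  obtain Z' where Z': "bounded_derivs Z'" "\<And>s. ((\<lambda>s. complex_of_real (Z s))
      has_vector_derivative Z' s) (at s)"
    using bounded_derivs_deriv Z by metis
  have ReZ': "(Z has_vector_derivative Re (Z' s)) (at s)" for s
    using bounded_linear.has_vector_derivative[OF bounded_linear_Re Z'(2)] by simp
  \<comment> \<open>The class of bounded derivatives consists of complex functions, so the derivative of the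
      real function Z has to be recognised as real.\<close>
  have Z'_real: "Z' s = of_real (Re (Z' s))" for s
  proof -
    have "((\<lambda>s. complex_of_real (Z s)) has_vector_derivative of_real (Re (Z' s))) (at s)"
      by (rule bounded_linear.has_vector_derivative[OF bounded_linear_of_real ReZ'])
    with Z'(2) show ?thesis using vector_derivative_unique_at by blast
  qed
  obtain ZM where ZM: "ZM \<ge> 0" "\<And>s. \<bar>Z s\<bar> \<le> ZM"
    using bounded_derivs_bounded[OF Z] by (metis norm_of_real)
  obtain C1 where C1: "C1 \<ge> 0" "\<And>\<kappa>. \<kappa> \<ge> 1 \<Longrightarrow> \<exists>h. has_nderiv n (\<lambda>s. B' s * nderiv p \<psi> (\<kappa> * Z s)) h \<and>
      (\<forall>s. norm (h s) \<le> C1 * (1 + \<kappa> * \<bar>Z s\<bar>) powr (\<mu> - real p) / (1 / \<kappa> + \<bar>Z s\<bar>) ^ n)"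
    using Suc.IH[OF B'(1), of p] by blast
  obtain C2 where C2: "C2 \<ge> 0" "\<And>\<kappa>. \<kappa> \<ge> 1 \<Longrightarrow> \<exists>h. has_nderiv n (\<lambda>s. (B s * Z' s) * nderiv (Suc p) \<psi>
      (\<kappa> * Z s)) h \<and>
      (\<forall>s. norm (h s) \<le> C2 * (1 + \<kappa> * \<bar>Z s\<bar>) powr (\<mu> - real (Suc p)) / (1 / \<kappa> + \<bar>Z s\<bar>) ^ n)"
    using Suc.IH[OF bounded_derivs_mult[OF Suc.prems Z'(1)], of "Suc p"] by blast
  have "\<exists>h. has_nderiv (Suc n) (\<lambda>s. B s * nderiv p \<psi> (\<kappa> * Z s)) h \<and>
      (\<forall>s. norm (h s) \<le> (C1 * (1 + ZM) + C2) * (1 + \<kappa> * \<bar>Z s\<bar>) powr (\<mu> - real p) / (1 / \<kappa> + \<bar>Z s\<bar>)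
          ^ Suc n)"
    if \<kappa>: "\<kappa> \<ge> 1" for \<kappa>
  proof -
    obtain h1 where h1: "has_nderiv n (\<lambda>s. B' s * nderiv p \<psi> (\<kappa> * Z s)) h1"
      "\<And>s. norm (h1 s) \<le> C1 * (1 + \<kappa> * \<bar>Z s\<bar>) powr (\<mu> - real p) / (1 / \<kappa> + \<bar>Z s\<bar>) ^ n"
      using C1(2)[OF \<kappa>] by blast
    obtain h2 where h2: "has_nderiv n (\<lambda>s. (B s * Z' s) * nderiv (Suc p) \<psi> (\<kappa> * Z s)) h2"
      "\<And>s. norm (h2 s) \<le> C2 * (1 + \<kappa> * \<bar>Z s\<bar>) powr (\<mu> - real (Suc p)) / (1 / \<kappa> + \<bar>Z s\<bar>) ^ n"
      using C2(2)[OF \<kappa>] by blast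
    define h where "h = (\<lambda>s. of_real \<kappa> * h2 s + h1 s)"
    have "has_nderiv (Suc n) (\<lambda>s. B s * nderiv p \<psi> (\<kappa> * Z s)) h"
      unfolding h_def
    proof (rule has_nderiv_SucI[OF _ has_nderiv_add[OF has_nderiv_linear[OF
        bounded_linear_mult_right h2(1)] h1(1)]])
      fix s
      have "((\<lambda>s. \<kappa> * Z s) has_vector_derivative \<kappa> * Re (Z' s)) (at s)"
        by (rule bounded_linear.has_vector_derivative[OF bounded_linear_mult_right ReZ'])
      then have "((\<lambda>s. nderiv p \<psi> (\<kappa> * Z s)) has_vector_derivative
          (\<kappa> * Re (Z' s)) *\<^sub>R nderiv (Suc p) \<psi> (\<kappa> * Z s)) (at s)"
        using vector_diff_chain_at[OF _ \<psi>(1)] unfolding o_def by blast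
      from has_vector_derivative_mult[OF B'(2) this]
      show "((\<lambda>s. B s * nderiv p \<psi> (\<kappa> * Z s)) has_vector_derivative
          of_real \<kappa> * (B s * Z' s * nderiv (Suc p) \<psi> (\<kappa> * Z s)) + B' s * nderiv p \<psi> (\<kappa> * Z s))
              (at s)"
        by (subst Z'_real) (simp add: scaleR_conv_of_real mult_ac)
    qed
    moreover have "norm (h s) \<le> (C1 * (1 + ZM) + C2) * (1 + \<kappa> * \<bar>Z s\<bar>) powr (\<mu> - real p) /
        (1 / \<kappa> + \<bar>Z s\<bar>) ^ Suc n" for s
    proof -
      define w where "w = 1 / \<kappa> + \<bar>Z s\<bar>"
      define t where "t = 1 + \<kappa> * \<bar>Z s\<bar>"
      have w: "0 < w" "w \<le> 1 + ZM"
        using \<kappa> ZM(2)[of s] by (auto simp: w_def add_pos_nonneg intro!: add_mono)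
      have t: "t > 0" "t = \<kappa> * w"
        using \<kappa> by (auto simp: t_def w_def add_pos_nonneg field_simps)
      have "norm (h s) \<le> \<kappa> * norm (h2 s) + norm (h1 s)"
        using norm_triangle_ineq[of "of_real \<kappa> * h2 s" "h1 s"] \<kappa> by (simp add: h_def norm_mult)
      moreover have "norm (h1 s) \<le> C1 * (1 + ZM) * t powr (\<mu> - real p) / w ^ Suc n"
      proof -
        have "norm (h1 s) \<le> C1 * w * t powr (\<mu> - real p) / w ^ Suc n"
          using h1(2)[of s] w by (simp add: w_def[symmetric] t_def[symmetric])
        also have "\<dots> \<le> C1 * (1 + ZM) * t powr (\<mu> - real p) / w ^ Suc n"
          using w C1 by (intro divide_right_mono mult_right_mono mult_left_mono) auto
        finally show ?thesis .
      qed
      moreover have "\<kappa> * norm (h2 s) \<le> C2 * t powr (\<mu> - real p) / w ^ Suc n"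
      proof -
        define T where "T = t powr (\<mu> - real (Suc p))"
        have "t powr (\<mu> - real p) = T * t"
          using t(1) powr_add[of t "\<mu> - real (Suc p)" 1] by (simp add: T_def)
        then have "C2 * t powr (\<mu> - real p) / w ^ Suc n = \<kappa> * (C2 * T / w ^ n)"
          using w(1) unfolding t(2) by simp
        moreover have "\<kappa> * norm (h2 s) \<le> \<kappa> * (C2 * T / w ^ n)"
          unfolding T_def w_def t_def by (rule mult_left_mono[OF h2(2)]) (use \<kappa> in simp)
        ultimately show ?thesis by simp
      qed
      ultimately have "norm (h s) \<le> C2 * t powr (\<mu> - real p) / w ^ Suc n + C1 * (1 + ZM) * t powr
          (\<mu> - real p) / w ^ Suc n"
        by linarith
      then show ?thesis
        unfolding w_def[symmetric] t_def[symmetric] by (simp add: add_divide_distrib distrib_right)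
    qed
    ultimately show ?thesis by blast
  qed
  moreover have "C1 * (1 + ZM) + C2 \<ge> 0" using C1 C2 ZM by simp
  ultimately show ?case by blast
qed

text \<open>Functions of size \<open>k\<^bsup>x\<^esup>\<close> that vary on the length scale \<open>k\<^bsup>-1/3\<^esup> + \<bar>Z(s)\<bar>\<close>: of order one
  away from the shadow boundaries, \<open>k\<^bsup>-1/3\<^esup>\<close> at them.\<close>

definition nderiv_bounded ::
    "nat \<Rightarrow> real \<Rightarrow> (real \<Rightarrow> real) \<Rightarrow> (real \<Rightarrow> real \<Rightarrow> complex) \<Rightarrow> bool" where
  "nderiv_bounded n x Z f \<longleftrightarrow> (\<exists>C\<ge>0. \<forall>k\<ge>1. \<exists>h. has_nderiv n (\<lambda>s. f s k) h \<and>
     (\<forall>s. norm (h s) \<le> C * k powr x / (k powr (- (1 / 3)) + \<bar>Z s\<bar>) ^ n))"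

lemma nderiv_bounded_add:
  assumes "nderiv_bounded n x Z f" "nderiv_bounded n x Z g"
  shows "nderiv_bounded n x Z (\<lambda>s k. f s k + g s k)"
proof -
  let ?w = "\<lambda>s k. (k powr (- (1 / 3)) + \<bar>Z s\<bar>) ^ n"
  obtain C where C: "C \<ge> 0" "\<And>k. k \<ge> 1 \<Longrightarrow> \<exists>h. has_nderiv n (\<lambda>s. f s k) h \<and>
     (\<forall>s. norm (h s) \<le> C * k powr x / ?w s k)"
    using assms(1) unfolding nderiv_bounded_def by blast
  obtain C' where C': "C' \<ge> 0" "\<And>k. k \<ge> 1 \<Longrightarrow> \<exists>h. has_nderiv n (\<lambda>s. g s k) h \<and>
     (\<forall>s. norm (h s) \<le> C' * k powr x / ?w s k)"
    using assms(2) unfolding nderiv_bounded_def by blast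
  have "\<exists>h. has_nderiv n (\<lambda>s. f s k + g s k) h \<and>
     (\<forall>s. norm (h s) \<le> (C + C') * k powr x / ?w s k)" if k: "k \<ge> 1" for k
  proof -
    obtain h where h: "has_nderiv n (\<lambda>s. f s k) h" "\<And>s. norm (h s) \<le> C * k powr x / ?w s k"
      using C(2)[OF k] by blast
    obtain h' where h': "has_nderiv n (\<lambda>s. g s k) h'" "\<And>s. norm (h' s) \<le> C' * k powr x / ?w s k"
      using C'(2)[OF k] by blast
    have "norm (h s + h' s) \<le> (C + C') * k powr x / ?w s k" for s
      using norm_triangle_le[OF add_mono[OF h(2) h'(2)]]
      by (simp add: distrib_right add_divide_distrib)
    with has_nderiv_add[OF h(1) h'(1)] show ?thesis by blast
  qed
  moreover have "C + C' \<ge> 0" using C(1) C'(1) by simp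
  ultimately show ?thesis unfolding nderiv_bounded_def by blast
qed

lemma nderiv_bounded_add_sum:
  assumes "finite F" "nderiv_bounded n x Z f" "\<And>i. i \<in> F \<Longrightarrow> nderiv_bounded n x Z (g i)"
  shows "nderiv_bounded n x Z (\<lambda>s k. f s k + (\<Sum>i\<in>F. g i s k))"
  using assms
proof (induction F)
  case (insert i F)
  then have "nderiv_bounded n x Z (\<lambda>s k. (f s k + (\<Sum>i\<in>F. g i s k)) + g i s k)"
    by (intro nderiv_bounded_add[of _ _ _ "\<lambda>s k. f s k + (\<Sum>i\<in>F. g i s k)"]) auto
  with insert show ?case by (simp add: add_ac)
qed simp

text \<open>After \<open>composed_symbol_bound\<close>, what remains is the supremum over \<open>s\<close> of
  \<open>k\<^bsup>e\<^esup> (1 + k\<^bsup>1/3\<^esup> \<bar>Z\<bar>)\<^bsup>\<nu>\<^esup>\<close>. It is \<open>k\<^bsup>e\<^esup>\<close> if \<open>\<nu> < 0\<close> and of order \<open>k\<^bsup>e + \<nu>/3\<^esup>\<close> otherwise, which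
  are the two cases in the definition of \<open>theta\<close>.\<close>

lemma expansion_term_bound:
  assumes data: "expansion_data P t1 t2 b \<Psi> Z" and "P > 0" and i: "i \<in> indices"
    and x: "theta i \<le> x"
  shows "nderiv_bounded n x Z (expansion_term b \<Psi> Z i)"
proof -
  obtain p q r l where i_eq: "i = (p, q, r, l)" by (cases i)
  have l: "l < 0" using i by (simp add: i_eq indices_def)
  have period: "2 * P > 0" using \<open>P > 0\<close> by simp
  define B where "B = b i"
  define \<psi> where "\<psi> = \<Psi> r l"
  define \<mu> where "\<mu> = real_of_int (1 + l - 2 * int r)"
  define \<nu> where "\<nu> = \<mu> - real p"
  define e where "e = - (1 + 2 * real p + 3 * real q + real r + real_of_int l) / 3
                      + min (real_of_int l + 1) 0"
  have B: "bounded_derivs B"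
    using smooth_periodic_bounded_derivs[OF _ period] data i by (simp add: expansion_data_def B_def)
  have Z: "bounded_derivs (\<lambda>s. complex_of_real (Z s))"
    using real_smooth_periodic_bounded_derivs[OF _ period] data by (simp add: expansion_data_def)
  obtain ZM where ZM: "ZM \<ge> 0" "\<And>s. \<bar>Z s\<bar> \<le> ZM"
    using bounded_derivs_bounded[OF Z] by (metis norm_of_real)
  have "smooth_on UNIV \<psi>" "\<exists>c. symbol_expansion \<psi> (1 + l - 2 * int r) c"
      "rapidly_decreasing_at_bot \<psi>"
    using data l by (auto simp: expansion_data_def \<psi>_def)
  then have \<psi>: "(nderiv j \<psi> has_vector_derivative nderiv (Suc j) \<psi> \<tau>) (at \<tau>)"
      "\<exists>C\<ge>0. \<forall>\<tau>. norm (nderiv j \<psi> \<tau>) \<le> C * (1 + \<bar>\<tau>\<bar>) powr (\<mu> - real j)" for j \<tau>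
    using smooth_on_UNIV_nderiv_step symbol_bound unfolding \<mu>_def by blast+
  obtain C where C: "C \<ge> 0" "\<And>\<kappa>. \<kappa> \<ge> 1 \<Longrightarrow> \<exists>h. has_nderiv n (\<lambda>s. B s * nderiv p \<psi> (\<kappa> * Z s)) h \<and>
      (\<forall>s. norm (h s) \<le> C * (1 + \<kappa> * \<bar>Z s\<bar>) powr \<nu> / (1 / \<kappa> + \<bar>Z s\<bar>) ^ n)"
    using composed_symbol_bound[of \<psi> \<mu> Z B n p, OF \<psi> Z B] unfolding \<nu>_def by blast
  define C' where "C' = C * (1 + ZM) powr max \<nu> 0"
  have growth: "k powr e * (1 + k powr (1/3) * \<bar>Z s\<bar>) powr \<nu> \<le> (1 + ZM) powr max \<nu> 0 * k powr x"
    if "k \<ge> 1" for k s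
  proof (cases "\<nu> < 0")
    case True
    then have "1 + l - 2 * int r - int p < 0" unfolding \<nu>_def \<mu>_def by linarith
    then have "e \<le> x" using x by (simp add: theta_def i_eq e_def)
    have "1 powr - \<nu> \<le> (1 + k powr (1/3) * \<bar>Z s\<bar>) powr - \<nu>"
      using True by (intro powr_mono2) auto
    then have "(1 + k powr (1/3) * \<bar>Z s\<bar>) powr \<nu> \<le> 1"
      by (simp add: powr_minus divide_simps) (smt (verit) inverse_le_1_iff powr_minus)
    then have "k powr e * (1 + k powr (1/3) * \<bar>Z s\<bar>) powr \<nu> \<le> k powr x * 1"
      using \<open>e \<le> x\<close> that by (intro mult_mono powr_mono) auto
    then show ?thesis using True ZM by (simp add: max_def)
  next
    case False
    then have "\<not> (1 + l - 2 * int r - int p < 0)" unfolding \<nu>_def \<mu>_def by linarith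
    then have "e + \<nu> / 3 \<le> x" using x by (simp add: theta_def i_eq e_def \<nu>_def \<mu>_def)
    have k1: "1 \<le> k powr (1/3)" using that by (simp add: ge_one_powr_ge_zero)
    have "1 + k powr (1/3) * \<bar>Z s\<bar> \<le> k powr (1/3) * (1 + ZM)"
      using k1 mult_left_mono[OF ZM(2)[of s], of "k powr (1/3)"] by (simp add: algebra_simps)
    then have "(1 + k powr (1/3) * \<bar>Z s\<bar>) powr \<nu> \<le> (k powr (1/3) * (1 + ZM)) powr \<nu>"
      using False by (intro powr_mono2) (auto simp: add_nonneg_nonneg)
    also have "\<dots> = (1 + ZM) powr \<nu> * k powr (\<nu> / 3)"
      using ZM that by (simp add: powr_mult powr_powr)
    finally have "k powr e * (1 + k powr (1/3) * \<bar>Z s\<bar>) powr \<nu>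
        \<le> k powr e * ((1 + ZM) powr \<nu> * k powr (\<nu> / 3))"
      by (intro mult_left_mono) auto
    also have "\<dots> = (1 + ZM) powr \<nu> * k powr (e + \<nu> / 3)"
      by (simp add: powr_add)
    also have "\<dots> \<le> (1 + ZM) powr \<nu> * k powr x"
      using that \<open>e + \<nu> / 3 \<le> x\<close> by (intro mult_left_mono powr_mono) auto
    finally show ?thesis using False by (simp add: max_def)
  qed
  have "\<exists>h. has_nderiv n (\<lambda>s. expansion_term b \<Psi> Z i s k) h \<and>
     (\<forall>s. norm (h s) \<le> C' * k powr x / (k powr (- (1 / 3)) + \<bar>Z s\<bar>) ^ n)" if k: "k \<ge> 1" for k
  proof -
    have "k powr (1/3) \<ge> 1" using k by (simp add: ge_one_powr_ge_zero)
    from C(2)[OF this] obtain h where h: "has_nderiv n (\<lambda>s. B s * nderiv p \<psi> (k powr (1/3) * Z s))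
        h"
      "\<And>s. norm (h s) \<le> C * (1 + k powr (1/3) * \<bar>Z s\<bar>) powr \<nu> / (1 / k powr (1/3) + \<bar>Z s\<bar>) ^ n"
      by blast
    have "has_nderiv n (\<lambda>s. of_real (k powr e) * (B s * nderiv p \<psi> (k powr (1/3) * Z s)))
        (\<lambda>s. of_real (k powr e) * h s)"
      by (rule has_nderiv_linear[OF bounded_linear_mult_right h(1)])
    then have "has_nderiv n (\<lambda>s. expansion_term b \<Psi> Z i s k) (\<lambda>s. of_real (k powr e) * h s)"
      by (simp add: expansion_term_def i_eq B_def \<psi>_def e_def mult.assoc)
    moreover have "norm (of_real (k powr e) * h s)
        \<le> C' * k powr x / (k powr (- (1 / 3)) + \<bar>Z s\<bar>) ^ n" for s
    proof -
      have w: "0 < k powr (- (1 / 3)) + \<bar>Z s\<bar>"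
        using k by (intro add_pos_nonneg) auto
      have "norm (of_real (k powr e) * h s)
        \<le> k powr e * (C * (1 + k powr (1/3) * \<bar>Z s\<bar>) powr \<nu> / (1 / k powr (1/3) + \<bar>Z s\<bar>) ^ n)"
        using mult_left_mono[OF h(2)[of s], of "k powr e"] by (simp add: norm_mult)
      also have "\<dots> = C * (k powr e * (1 + k powr (1/3) * \<bar>Z s\<bar>) powr \<nu>) / (k powr (- (1 / 3))
          + \<bar>Z s\<bar>) ^ n"
        by (simp add: powr_minus_divide mult_ac)
      also have "\<dots> \<le> C * ((1 + ZM) powr max \<nu> 0 * k powr x) / (k powr (- (1 / 3)) + \<bar>Z s\<bar>) ^ n"
        using w by (intro divide_right_mono mult_left_mono growth k C) auto
      finally show ?thesis by (simp add: C'_def mult_ac)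
    qed
    ultimately show ?thesis by blast
  qed
  moreover have "C' \<ge> 0" using C by (simp add: C'_def)
  ultimately show ?thesis unfolding nderiv_bounded_def by blast
qed

text \<open>In the class \<open>S\<^bsup>-M\<^esup>\<close> each derivative costs \<open>k\<^bsup>1/3\<^esup>\<close>, and the length scale \<open>k\<^bsup>-1/3\<^esup> + \<bar>Z\<bar>\<close>
  is bounded above. Hence any target is reached once \<open>M\<close> is large enough.\<close>

lemma hormander_class_bound:
  fixes Z :: "real \<Rightarrow> real"
  assumes a: "a \<in> hormander_class P (- M) (2 / 3) (1 / 3)" and per: "\<And>s k. a (s + 2 * P) k = a s k"
    and "P > 0" and Z: "\<And>s. \<bar>Z s\<bar> \<le> ZM" and x: "- M + real n / 3 \<le> x"
  shows "nderiv_bounded n x Z a"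
proof -
  have smooth: "smooth_on (UNIV \<times> {0<..}) (\<lambda>(s, k). a s k)"
    using a by (simp add: hormander_class_def)
  from a[unfolded hormander_class_def] obtain C where
    C: "\<And>s k. s \<in> {0..2 * P} \<Longrightarrow> k \<ge> 1 \<Longrightarrow>
        norm (mixed_deriv n 0 a s k) \<le> C * k powr (- M + 1 / 3 * real n - 2 / 3 * real 0)"
    using zero_less_one by blast
  have ZM: "ZM \<ge> 0" using Z[of 0] by simp
  have "\<exists>h. has_nderiv n (\<lambda>s. a s k) h \<and> (\<forall>s. norm (h s) \<le> \<bar>C\<bar> * (1 + ZM) ^ n * k powr x / (k powr
      (- (1 / 3)) + \<bar>Z s\<bar>) ^ n)"
    if k: "k \<ge> 1" for k
  proof -
    have "has_nderiv n (\<lambda>s. (\<lambda>(s, k). a s k) ((0, k) + s *\<^sub>R (1, 0)))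
       (nderiv n (\<lambda>s. (\<lambda>(s, k). a s k) ((0, k) + s *\<^sub>R (1, 0))))"
      using k by (intro smooth_on_line_has_nderiv[OF smooth]) auto
    then have nd: "has_nderiv n (\<lambda>s. a s k) (nderiv n (\<lambda>s. a s k))"
      by simp
    have "norm (nderiv n (\<lambda>s. a s k) s) \<le> \<bar>C\<bar> * (1 + ZM) ^ n * k powr x / (k powr (- (1 / 3))
        + \<bar>Z s\<bar>) ^ n" for s
    proof -
      obtain j where j: "0 \<le> s + 2 * P * real_of_int j" "s + 2 * P * real_of_int j < 0 + 2 * P"
        using periodic_representative[of "2 * P"] \<open>P > 0\<close> by (metis mult_pos_pos zero_less_numeral)
      have "nderiv n (\<lambda>s. a s k) s = mixed_deriv n 0 a (s + 2 * P * real_of_int j) k"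
        using periodic_int[where f = "nderiv n (\<lambda>s. a s k)", OF has_nderiv_periodic[OF nd per]]
        by (simp add: mixed_deriv_def nderiv_def[of 0])
      then have "norm (nderiv n (\<lambda>s. a s k) s) \<le> C * k powr (- M + real n / 3)"
        using C[of "s + 2 * P * real_of_int j" k] j k by simp
      also have "\<dots> \<le> \<bar>C\<bar> * k powr x"
        using x k by (intro mult_mono powr_mono) auto
      also have "\<dots> \<le> \<bar>C\<bar> * k powr x * ((1 + ZM) ^ n / (k powr (- (1 / 3)) + \<bar>Z s\<bar>) ^ n)"
      proof -
        have "0 < k powr (- (1 / 3)) + \<bar>Z s\<bar>"
          using k by (intro add_pos_nonneg) auto
        moreover have "k powr (- (1 / 3)) \<le> k powr 0"
          using k by (intro powr_mono) auto
        then have "k powr (- (1 / 3)) + \<bar>Z s\<bar> \<le> 1 + ZM"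
          using Z[of s] k by simp
        ultimately have "1 \<le> (1 + ZM) ^ n / (k powr (- (1 / 3)) + \<bar>Z s\<bar>) ^ n"
          by (simp add: power_mono)
        from mult_left_mono[OF this, of "\<bar>C\<bar> * k powr x"] show ?thesis by simp
      qed
      finally show ?thesis by (simp add: mult_ac)
    qed
    with nd show ?thesis by blast
  qed
  moreover have "\<bar>C\<bar> * (1 + ZM) ^ n \<ge> 0" using ZM by simp
  ultimately show ?thesis unfolding nderiv_bounded_def by blast
qed

text \<open>The remainder is the sum of an error of order \<open>- M\<close>, with \<open>M\<close> chosen large depending on
  \<open>n\<close>, and of finitely many terms of the expansion that are not in \<open>F_idx \<beta>\<close>.\<close>

lemma truncated_expansion_bound:
  assumes data: "expansion_data P t1 t2 b \<Psi> Z" and "P > 0"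
    and per: "\<And>s k. a (s + 2 * P) k = a s k"
    and expansion: "asymptotic_expansion P a (expansion_term b \<Psi> Z)"
  shows "nderiv_bounded n (- real \<beta> / 3) Z
    (\<lambda>s k. a s k - sigma_slow (expansion_term b \<Psi> Z) \<beta> s k)"
proof -
  let ?A = "expansion_term b \<Psi> Z"
  \<comment> \<open>The term n / 3 compensates the n derivatives; the final 1 only ensures that M is positive.\<close>
  define M where "M = (real \<beta> + real n) / 3 + 1"
  have M: "M > 0" by (simp add: M_def add_nonneg_pos)
  from expansion[unfolded asymptotic_expansion_def, rule_format, OF M]
  obtain FM where FM: "finite FM" "FM \<subseteq> indices"
    "\<forall>F. finite F \<and> FM \<subseteq> F \<and> F \<subseteq> indices \<longrightarrow>
       (\<lambda>s k. a s k - (\<Sum>i\<in>F. ?A i s k)) \<in> hormander_class P (- M) (2 / 3) (1 / 3)"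
    by (elim exE conjE)
  define F where "F = FM \<union> F_idx \<beta>"
  have F: "finite F" "FM \<subseteq> F" "F_idx \<beta> \<subseteq> F" "F \<subseteq> indices"
    using FM finite_F_idx by (auto simp: F_def F_idx_def)
  have perA: "?A i (s + 2 * P) k = ?A i s k" if "i \<in> indices" for i s k
    using data that by (cases i) (auto simp: expansion_data_def expansion_term_def)
  have "continuous_on UNIV Z"
    using data smooth_on_UNIV_has_nderiv[of Z] has_nderiv_continuous
        by (auto simp: expansion_data_def)
  then obtain ZM where ZM: "\<And>s. \<bar>Z s\<bar> \<le> ZM"
    using continuous_periodic_bounded[of "2 * P" Z] data \<open>P > 0\<close> by (auto simp: expansion_data_def)
  have "nderiv_bounded n (- real \<beta> / 3) Z (\<lambda>s k. a s k - (\<Sum>i\<in>F. ?A i s k))"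
  proof (rule hormander_class_bound[OF FM(3)[rule_format, OF conjI[OF F(1) conjI[OF F(2,4)]]]])
    show "a (s + 2 * P) k - (\<Sum>i\<in>F. ?A i (s + 2 * P) k) = a s k - (\<Sum>i\<in>F. ?A i s k)" for s k
      using F(4) by (auto simp: per perA subset_iff intro!: sum.cong)
  qed (use \<open>P > 0\<close> ZM in \<open>auto simp: M_def add_divide_distrib\<close>)
  then have "nderiv_bounded n (- real \<beta> / 3) Z
      (\<lambda>s k. a s k - (\<Sum>i\<in>F. ?A i s k) + (\<Sum>i\<in>F - F_idx \<beta>. ?A i s k))"
    using F by (intro nderiv_bounded_add_sum expansion_term_bound[OF data \<open>P > 0\<close>])
      (auto simp: F_idx_def)
  then show ?thesis
    by (simp add: sigma_slow_def sum_diff[OF F(1,3)])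
qed

section \<open>Weighted integrals of powers of the phase function\<close>

text \<open>An upper bound for the integral of \<open>s\<^bsup>-n\<^esup>\<close> over \<open>[x, y]\<close>, for \<open>n \<ge> 1\<close>.\<close>

definition power_tail :: "nat \<Rightarrow> real \<Rightarrow> real \<Rightarrow> real" where
  "power_tail n x y = (if n = 1 then ln (y / x) else 1 / x ^ (n - 1))"

lemma integral_inverse_power:
  fixes t a b :: real
  assumes "t < a" "a \<le> b" "n \<ge> 1"
  shows "integral {a..b} (\<lambda>s. 1 / (s - t) ^ n) \<le> power_tail n (a - t) (b - t)"
proof (cases "n = 1")
  case True
  have "((\<lambda>s. 1 / (s - t) ^ n) has_integral (ln (b - t) - ln (a - t))) {a..b}"
    using assms True by (intro fundamental_theorem_of_calculus)
      (auto simp flip: has_real_derivative_iff_has_vector_derivative intro!: derivative_eq_intros)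
  then show ?thesis
    using assms True by (simp add: integral_unique power_tail_def ln_div)
next
  case False
  define i where "i = n - 1"
  have i: "i \<ge> 1" "n = Suc i" using False assms by (auto simp: i_def)
  have "((\<lambda>s. 1 / (s - t) ^ n) has_integral
      (- (1 / (real i * (b - t) ^ i)) - - (1 / (real i * (a - t) ^ i)))) {a..b}"
  proof (rule fundamental_theorem_of_calculus[OF assms(2)])
    fix s assume "s \<in> {a..b}"
    then have st: "s - t > 0" using assms by simp
    have "((\<lambda>s. - (1 / (real i * (s - t) ^ i))) has_real_derivative
        real i * (real i * (s - t) ^ (i - 1)) / (real i * (s - t) ^ i)\<^sup>2) (at s)"
      using st i by (auto intro!: derivative_eq_intros simp: power2_eq_square)
    also have "real i * (real i * (s - t) ^ (i - 1)) / (real i * (s - t) ^ i)\<^sup>2 = 1 / (s - t) ^ n"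
    proof -
      have "(s - t) ^ i = (s - t) * (s - t) ^ (i - 1)"
        using i(1) by (cases i) auto
      then show ?thesis using st i by (simp add: power2_eq_square)
    qed
    finally show "((\<lambda>s. - (1 / (real i * (s - t) ^ i))) has_vector_derivative 1 / (s - t) ^ n)
        (at s within {a..b})"
      by (simp add: has_real_derivative_iff_has_vector_derivative has_vector_derivative_at_within)
  qed
  then have "integral {a..b} (\<lambda>s. 1 / (s - t) ^ n)
      = 1 / (real i * (a - t) ^ i) - 1 / (real i * (b - t) ^ i)"
    by (simp add: integral_unique)
  also have "\<dots> \<le> 1 / (real i * (a - t) ^ i)"
    using assms by simp
  also have "\<dots> \<le> 1 / (a - t) ^ i"
    using assms i by (intro divide_left_mono) (auto simp: mult_le_cancel_right1)
  finally show ?thesis using i by (simp add: power_tail_def)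
qed

text \<open>The value of \<open>weighted_seminorm2\<close> for a function whose \<open>n\<close>-th derivative has modulus
  \<open>(h + \<bar>Z\<bar>)\<^bsup>-n\<^esup>\<close>; here \<open>h\<close> stands for \<open>k\<^bsup>-1/3\<^esup>\<close>.\<close>

definition weighted_integral :: "(real \<Rightarrow> real) \<Rightarrow> nat \<Rightarrow> real \<Rightarrow> real \<Rightarrow> real \<Rightarrow> real" where
  "weighted_integral Z n h a b =
     integral {a..b} (\<lambda>s. ((s - a) * (b - s)) ^ n / (h + \<bar>Z s\<bar>) ^ (2 * n))"

lemma weighted_integral_reflect:
  "weighted_integral (\<lambda>s. Z (- s)) n h (- b) (- a) = weighted_integral Z n h a b"
proof -
  have "weighted_integral (\<lambda>s. Z (- s)) n h (- b) (- a)
      = integral {- b..- a} (\<lambda>s. (\<lambda>s. ((s - a) * (b - s)) ^ n / (h + \<bar>Z s\<bar>) ^ (2 * n)) (- s))"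
  proof -
    have "(s - - b) * (- a - s) = (- s - a) * (b - - s)" for s
      by (simp add: algebra_simps)
    then show ?thesis unfolding weighted_integral_def by simp
  qed
  also have "\<dots> = weighted_integral Z n h a b"
    unfolding weighted_integral_def by (rule Henstock_Kurzweil_Integration.integral_reflect_real)
  finally show ?thesis .
qed

lemma weighted_integral_le:
  assumes "continuous_on UNIV Z" "h > 0" "g integrable_on {a..b}"
    and "\<And>s. s \<in> {a..b} \<Longrightarrow> ((s - a) * (b - s)) ^ n / (h + \<bar>Z s\<bar>) ^ (2 * n) \<le> g s"
  shows "weighted_integral Z n h a b \<le> integral {a..b} g"
  unfolding weighted_integral_def
proof (rule integral_le[OF integrable_continuous_interval assms(3,4)])
  have "h + \<bar>Z s\<bar> \<noteq> 0" for s using assms(2) by (simp add: add_pos_nonneg less_imp_neq[symmetric])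
  then show "continuous_on {a..b} (\<lambda>s. ((s - a) * (b - s)) ^ n / (h + \<bar>Z s\<bar>) ^ (2 * n))"
    by (intro continuous_intros continuous_on_subset[OF assms(1)]) auto
qed

lemma inverse_power_integrable:
  fixes t :: real
  assumes "t \<notin> {a..b}"
  shows "(\<lambda>s. 1 / (s - t) ^ n) integrable_on {a..b}"
  using assms by (intro integrable_continuous_interval continuous_intros) auto

text \<open>The factor of the weight that vanishes at the end next to the zero \<open>t\<close> is at most \<open>s - t\<close>,
  and cancels half of the singular factor \<open>(s - t)\<^bsup>-2n\<^esup>\<close>. The other factor is at most \<open>y\<close>.\<close>

lemma weighted_integral_right_of_zero:
  assumes Z: "continuous_on UNIV Z" "\<And>s. s \<in> {t + x..t + y} \<Longrightarrow> c * (s - t) \<le> \<bar>Z s\<bar>"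
    and pos: "c > 0" "h > 0" "0 < x" "x \<le> y" "n \<ge> 1"
  shows "weighted_integral Z n h (t + x) (t + y) \<le> y ^ n / c ^ (2 * n) * power_tail n x y"
proof -
  have "weighted_integral Z n h (t + x) (t + y)
      \<le> integral {t + x..t + y} (\<lambda>s. y ^ n / c ^ (2 * n) * (1 / (s - t) ^ n))"
  proof (rule weighted_integral_le[OF Z(1) pos(2)])
    show "(\<lambda>s. y ^ n / c ^ (2 * n) * (1 / (s - t) ^ n)) integrable_on {t + x..t + y}"
      using pos by (intro integrable_on_mult_right inverse_power_integrable) auto
    fix s assume s: "s \<in> {t + x..t + y}"
    then have st: "s - t > 0" using pos by simp
    have "((s - (t + x)) * (t + y - s)) ^ n / (h + \<bar>Z s\<bar>) ^ (2 * n)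
        \<le> ((s - t) * y) ^ n / (c * (s - t)) ^ (2 * n)"
      using s st pos Z(2)[OF s]
      by (intro frac_le power_mono mult_mono zero_less_power zero_le_power mult_nonneg_nonneg
          mult_pos_pos) auto
    also have "\<dots> = y ^ n / c ^ (2 * n) * (1 / (s - t) ^ n)"
      using st by (simp add: power_mult_distrib mult_2 power_add)
    finally show "((s - (t + x)) * (t + y - s)) ^ n / (h + \<bar>Z s\<bar>) ^ (2 * n)
        \<le> y ^ n / c ^ (2 * n) * (1 / (s - t) ^ n)" .
  qed
  also have "\<dots> = y ^ n / c ^ (2 * n) * integral {t + x..t + y} (\<lambda>s. 1 / (s - t) ^ n)"
    by (rule integral_mult_right)
  also have "\<dots> \<le> y ^ n / c ^ (2 * n) * power_tail n x y"
    using integral_inverse_power[of t "t + x" "t + y" n] pos by (intro mult_left_mono) auto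
  finally show ?thesis .
qed

lemma weighted_integral_left_of_zero:
  assumes Z: "continuous_on UNIV Z" "\<And>s. s \<in> {t - y..t - x} \<Longrightarrow> c * (t - s) \<le> \<bar>Z s\<bar>"
    and pos: "c > 0" "h > 0" "0 < x" "x \<le> y" "n \<ge> 1"
  shows "weighted_integral Z n h (t - y) (t - x) \<le> y ^ n / c ^ (2 * n) * power_tail n x y"
proof -
  have "weighted_integral (\<lambda>s. Z (- s)) n h (- t + x) (- t + y) \<le> y ^ n / c ^ (2 * n)
      * power_tail n x y"
  proof (rule weighted_integral_right_of_zero[OF _ _ pos])
    show "continuous_on UNIV (\<lambda>s. Z (- s))"
      by (intro continuous_on_compose2[OF Z(1)] continuous_intros) auto
    show "c * (s - - t) \<le> \<bar>Z (- s)\<bar>" if "s \<in> {- t + x..- t + y}" for s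
      using Z(2)[of "- s"] that by (simp add: algebra_simps)
  qed
  moreover have "weighted_integral (\<lambda>s. Z (- s)) n h (- (t - x)) (- (t - y))
      = weighted_integral Z n h (t - y) (t - x)"
    by (rule weighted_integral_reflect)
  ultimately show ?thesis by (simp add: algebra_simps)
qed

lemma integral_inverse_power_left:
  fixes t a b :: real
  assumes "b < t" "a \<le> b" "n \<ge> 1"
  shows "integral {a..b} (\<lambda>s. 1 / (t - s) ^ n) \<le> power_tail n (t - b) (t - a)"
proof -
  have "integral {a..b} (\<lambda>s. 1 / (t - s) ^ n) = integral {- b..- a} (\<lambda>s. 1 / (s - (- t)) ^ n)"
    using Henstock_Kurzweil_Integration.integral_reflect_real[of b a "\<lambda>s. 1 / (t - s) ^ n"]
        by (simp add: add.commute)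
  then show ?thesis
    using integral_inverse_power[of "- t" "- b" "- a" n] assms by simp
qed

text \<open>The two factors of the weight cancel half of the singularity at the two zeros, and partial
  fractions separate these.\<close>

lemma weighted_integral_between_zeros:
  assumes Z: "continuous_on UNIV Z" "\<And>s. s \<in> {a..b} \<Longrightarrow> c * (s - t) * (t' - s) \<le> \<bar>Z s\<bar>"
    and pos: "c > 0" "h > 0" "t < a" "a \<le> b" "b < t'" "n \<ge> 1"
  shows "weighted_integral Z n h a b
    \<le> (2 / (c\<^sup>2 * (t' - t))) ^ n * (power_tail n (a - t) (b - t) + power_tail n (t' - b) (t' - a))"
proof -
  let ?K = "(2 / (c\<^sup>2 * (t' - t))) ^ n"
  have int: "(\<lambda>s. 1 / (s - t) ^ n) integrable_on {a..b}" "(\<lambda>s. 1 / (t' - s) ^ n)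
      integrable_on {a..b}"
    using pos by (auto intro!: integrable_continuous_interval continuous_intros)
  have "weighted_integral Z n h a b \<le> integral {a..b} (\<lambda>s. ?K * (1 / (s - t) ^ n + 1 / (t' - s)
      ^ n))"
  proof (rule weighted_integral_le[OF Z(1) pos(2)])
    show "(\<lambda>s. ?K * (1 / (s - t) ^ n + 1 / (t' - s) ^ n)) integrable_on {a..b}"
      by (intro integrable_on_mult_right integrable_add int)
    fix s assume s: "s \<in> {a..b}"
    define u where "u = 1 / (s - t)"
    define v where "v = 1 / (t' - s)"
    have st: "s - t > 0" "t' - s > 0" using s pos by auto
    then have uv: "u > 0" "v > 0" by (auto simp: u_def v_def)
    have "((s - a) * (b - s)) ^ n / (h + \<bar>Z s\<bar>) ^ (2 * n)
        \<le> ((s - t) * (t' - s)) ^ n / (c * (s - t) * (t' - s)) ^ (2 * n)"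
      using s st pos Z(2)[OF s]
      by (intro frac_le power_mono mult_mono zero_less_power zero_le_power mult_nonneg_nonneg
          mult_pos_pos) auto
    also have "\<dots> = (((s - t) * (t' - s)) / (c * (s - t) * (t' - s))\<^sup>2) ^ n"
      by (simp add: power_divide power_mult)
    also have "((s - t) * (t' - s)) / (c * (s - t) * (t' - s))\<^sup>2 = 1 / (c\<^sup>2 * (t' - t)) * (u + v)"
      using st pos by (simp add: u_def v_def divide_simps power2_eq_square)
    also have "(1 / (c\<^sup>2 * (t' - t)) * (u + v)) ^ n \<le> (1 / (c\<^sup>2 * (t' - t)) * (2 * max u v)) ^ n"
      using uv pos by (intro power_mono mult_left_mono) (auto simp: max_def)
    also have "\<dots> = ?K * (max u v) ^ n"
      by (simp add: power_mult_distrib power_divide)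
    also have "\<dots> \<le> ?K * (u ^ n + v ^ n)"
      using uv pos by (intro mult_left_mono) (auto simp: max_def)
    finally show "((s - a) * (b - s)) ^ n / (h + \<bar>Z s\<bar>) ^ (2 * n)
        \<le> ?K * (1 / (s - t) ^ n + 1 / (t' - s) ^ n)"
      by (simp add: u_def v_def power_one_over)
  qed
  also have "\<dots> = ?K * (integral {a..b} (\<lambda>s. 1 / (s - t) ^ n) + integral {a..b} (\<lambda>s. 1 / (t' - s)
      ^ n))"
    using integral_add[OF int] by simp
  also have "\<dots> \<le> ?K * (power_tail n (a - t) (b - t) + power_tail n (t' - b) (t' - a))"
    using pos by (intro mult_left_mono add_mono integral_inverse_power integral_inverse_power_left)
        auto
  finally show ?thesis .
qed

text \<open>The weight is bounded by a power of the length of the interval, and \<open>h\<close> keeps the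
  integrand bounded: it has the effect of shifting the zero by \<open>h / c\<close> out of the domain of
  integration on either side.\<close>

lemma weighted_integral_around_zero:
  assumes Z: "continuous_on UNIV Z" "\<And>s. s \<in> {a..b} \<Longrightarrow> c * \<bar>s - t\<bar> \<le> \<bar>Z s\<bar>"
    and pos: "c > 0" "h > 0" "a \<le> t" "t \<le> b" "n \<ge> 1"
  shows "weighted_integral Z n h a b \<le> 2 / c * (b - a) ^ (2 * n) / h ^ (2 * n - 1)"
proof -
  define x where "x = h / c"
  have x: "x > 0" "h = c * x" using pos by (auto simp: x_def)
  define g where "g = (\<lambda>s. 1 / (x + \<bar>s - t\<bar>) ^ (2 * n))"
  have "x + \<bar>s - t\<bar> \<noteq> 0" for s using x(1) by (simp add: add_pos_nonneg less_imp_neq[symmetric])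
  then have gint: "g integrable_on {l..r}" for l r
    unfolding g_def by (intro integrable_continuous_interval continuous_intros) auto
  let ?K = "(b - a) ^ (2 * n) / c ^ (2 * n)"
  have "weighted_integral Z n h a b \<le> integral {a..b} (\<lambda>s. ?K * g s)"
  proof (rule weighted_integral_le[OF Z(1) pos(2)])
    show "(\<lambda>s. ?K * g s) integrable_on {a..b}"
      by (intro integrable_on_mult_right gint)
    fix s assume s: "s \<in> {a..b}"
    have "((s - a) * (b - s)) ^ n / (h + \<bar>Z s\<bar>) ^ (2 * n) \<le> ((b - a) * (b - a)) ^ n / (c *
        (x + \<bar>s - t\<bar>)) ^ (2 * n)"
      using s pos x Z(2)[OF s]
      by (intro frac_le power_mono mult_mono zero_less_power zero_le_power mult_nonneg_nonneg
          mult_pos_pos add_pos_nonneg)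
         (auto simp: distrib_left)
    then show "((s - a) * (b - s)) ^ n / (h + \<bar>Z s\<bar>) ^ (2 * n) \<le> ?K * g s"
      by (simp add: g_def power_mult_distrib flip: power2_eq_square power_mult)
  qed
  also have "\<dots> = ?K * (integral {a..t} g + integral {t..b} g)"
    using Henstock_Kurzweil_Integration.integral_combine[OF pos(3,4) gint] by simp
  also have "\<dots> \<le> ?K * (1 / x ^ (2 * n - 1) + 1 / x ^ (2 * n - 1))"
  proof (intro mult_left_mono add_mono)
    have "integral {t..b} g = integral {t..b} (\<lambda>s. 1 / (s - (t - x)) ^ (2 * n))"
      by (intro integral_cong) (simp add: g_def algebra_simps)
    also have "\<dots> \<le> 1 / x ^ (2 * n - 1)"
      using integral_inverse_power[of "t - x" t b "2 * n"] x pos by (simp add: power_tail_def)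
    finally show "integral {t..b} g \<le> 1 / x ^ (2 * n - 1)" .
    have "integral {a..t} g = integral {a..t} (\<lambda>s. 1 / ((t + x) - s) ^ (2 * n))"
      by (intro integral_cong) (simp add: g_def algebra_simps)
    also have "\<dots> \<le> 1 / x ^ (2 * n - 1)"
      using integral_inverse_power_left[of t "t + x" a "2 * n"] x pos by (simp add: power_tail_def)
    finally show "integral {a..t} g \<le> 1 / x ^ (2 * n - 1)" .
  qed (use pos in auto)
  also have "\<dots> = 2 / c * (b - a) ^ (2 * n) / h ^ (2 * n - 1)"
  proof -
    have "c ^ (2 * n) = c * c ^ (2 * n - 1)" using pos by (cases n) auto
    then show ?thesis using x pos by (simp add: power_mult_distrib mult.assoc)
  qed
  finally show ?thesis .
qed

lemma linear_growth_at_simple_zero: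
  fixes Z :: "real \<Rightarrow> real"
  assumes "(Z has_real_derivative D) (at t)" "D \<noteq> 0" "Z t = 0"
  obtains c \<delta> where "c > 0" "\<delta> > 0" "\<And>s. \<bar>s - t\<bar> < \<delta> \<Longrightarrow> c * \<bar>s - t\<bar> \<le> \<bar>Z s\<bar>"
proof -
  have "((\<lambda>s. (Z s - Z t) / (s - t)) \<longlongrightarrow> D) (at t)"
    using assms(1) by (simp add: has_field_derivative_iff)
  then have "((\<lambda>s. \<bar>(Z s - Z t) / (s - t)\<bar>) \<longlongrightarrow> \<bar>D\<bar>) (at t)"
    by (rule tendsto_rabs)
  then have "eventually (\<lambda>s. \<bar>D\<bar> / 2 < \<bar>(Z s - Z t) / (s - t)\<bar>) (at t)"
    by (rule order_tendstoD(1)) (use assms(2) in auto)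
  then obtain \<delta> where \<delta>: "\<delta> > 0"
      "\<And>s. s \<noteq> t \<Longrightarrow> dist s t < \<delta> \<Longrightarrow> \<bar>D\<bar> / 2 < \<bar>(Z s - Z t) / (s - t)\<bar>"
    unfolding eventually_at by auto
  have "\<bar>D\<bar> / 2 * \<bar>s - t\<bar> \<le> \<bar>Z s\<bar>" if "\<bar>s - t\<bar> < \<delta>" for s
  proof (cases "s = t")
    case False
    then show ?thesis
      using \<delta>(2)[of s] that assms(3) by (simp add: dist_real_def divide_simps)
  qed simp
  then show thesis using that[of "\<bar>D\<bar> / 2" \<delta>] \<delta>(1) assms(2) by auto
qed

text \<open>Linear growth at the two ends, a positive minimum in the compact middle.\<close>

lemma growth_between_simple_zeros:
  fixes Z :: "real \<Rightarrow> real"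
  assumes "a < b" and cont: "continuous_on {a..b} Z"
    and nz: "\<And>s. a < s \<Longrightarrow> s < b \<Longrightarrow> Z s \<noteq> 0"
    and Za: "(Z has_real_derivative Da) (at a)" "Da \<noteq> 0" "Z a = 0"
    and Zb: "(Z has_real_derivative Db) (at b)" "Db \<noteq> 0" "Z b = 0"
  shows "\<exists>c>0. \<forall>s\<in>{a..b}. c * (s - a) * (b - s) \<le> \<bar>Z s\<bar>"
proof -
  obtain c1 \<delta>1 where c1: "c1 > 0" "\<delta>1 > 0" "\<And>s. \<bar>s - a\<bar> < \<delta>1 \<Longrightarrow> c1 * \<bar>s - a\<bar> \<le> \<bar>Z s\<bar>"
    using linear_growth_at_simple_zero[OF Za] by blast
  obtain c2 \<delta>2 where c2: "c2 > 0" "\<delta>2 > 0" "\<And>s. \<bar>s - b\<bar> < \<delta>2 \<Longrightarrow> c2 * \<bar>s - b\<bar> \<le> \<bar>Z s\<bar>"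
    using linear_growth_at_simple_zero[OF Zb] by blast
  define S where "S = {a + \<delta>1..b - \<delta>2}"
  have "\<exists>c3>0. \<forall>s\<in>S. c3 \<le> \<bar>Z s\<bar>"
  proof (cases "S = {}")
    case False
    have "continuous_on S (\<lambda>s. \<bar>Z s\<bar>)"
      using c1 c2 by (intro continuous_intros continuous_on_subset[OF cont]) (auto simp: S_def)
    moreover have "compact S" by (simp add: S_def)
    ultimately obtain s0 where "s0 \<in> S" "\<forall>s\<in>S. \<bar>Z s0\<bar> \<le> \<bar>Z s\<bar>"
      using continuous_attains_inf[of S] False by blast
    moreover have "Z s0 \<noteq> 0" using nz[of s0] \<open>s0 \<in> S\<close> c1 c2 by (auto simp: S_def)
    ultimately show ?thesis by (intro exI[of _ "\<bar>Z s0\<bar>"]) auto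
  qed (auto intro: exI[of _ 1])
  then obtain c3 where c3: "c3 > 0" "\<And>s. s \<in> S \<Longrightarrow> c3 \<le> \<bar>Z s\<bar>" by blast
  define L where "L = b - a"
  have L: "L > 0" using assms(1) by (simp add: L_def)
  define c where "c = min (c1 / L) (min (c2 / L) (c3 / L\<^sup>2))"
  have c: "c > 0" "c \<le> c1 / L" "c \<le> c2 / L" "c \<le> c3 / L\<^sup>2"
    using c1 c2 c3 L by (auto simp: c_def)
  have "c * (s - a) * (b - s) \<le> \<bar>Z s\<bar>" if s: "s \<in> {a..b}" for s
  proof -
    consider "\<bar>s - a\<bar> < \<delta>1" | "\<bar>s - b\<bar> < \<delta>2" | "s \<in> S"
      using s unfolding S_def by fastforce
    then show ?thesis
    proof cases
      case 1
      have "c * (s - a) * (b - s) \<le> (c1 / L) * (s - a) * L"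
        using s c L c1 by (intro mult_mono) (auto simp: L_def)
      also have "\<dots> \<le> \<bar>Z s\<bar>" using c1(3)[OF 1] s L by simp
      finally show ?thesis .
    next
      case 2
      have "c * (s - a) * (b - s) \<le> (c2 / L) * L * (b - s)"
        using s c L c2 by (intro mult_mono) (auto simp: L_def)
      also have "\<dots> \<le> \<bar>Z s\<bar>" using c2(3)[OF 2] s L by simp
      finally show ?thesis .
    next
      case 3
      have "c * (s - a) * (b - s) \<le> (c3 / L\<^sup>2) * L * L"
        using s c L c3 by (intro mult_mono) (auto simp: L_def)
      also have "\<dots> \<le> \<bar>Z s\<bar>" using c3(2)[OF 3] L by (simp add: power2_eq_square)
      finally show ?thesis .
    qed
  qed
  then show ?thesis using c(1) by blast
qed

lemma ln_le_powr:
  fixes k \<delta> :: real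
  assumes "k \<ge> 1" "\<delta> > 0"
  shows "k powr (- \<delta>) * ln k \<le> 1 / \<delta>"
proof -
  have "k powr (- \<delta>) * ln k \<le> k powr (- \<delta>) * (k powr \<delta> / \<delta>)"
    using assms by (intro mult_left_mono ln_powr_bound) auto
  also have "\<dots> = 1 / \<delta>" using assms by (simp flip: powr_add)
  finally show ?thesis .
qed

lemma square_le_one_plus_square:
  fixes E :: real
  assumes "E \<ge> 0"
  shows "1 + E\<^sup>2 \<le> (1 + E)\<^sup>2"
  using assms by (simp add: power2_sum)

text \<open>For \<open>n = 1\<close> the logarithm contained in \<open>power_tail\<close> is multiplied by \<open>k\<^bsup>-1/3 + e\<^esup>\<close> with
  \<open>e < 1/3\<close>, so it is bounded. For \<open>n \<ge> 2\<close> the left-hand side is a constant times the square of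
  the second summand on the right.\<close>

lemma transition_rate:
  fixes \<kappa> e e' :: real
  assumes "\<kappa> > 0" "e' < e" "e < 1 / 3" "e' > 0" "n \<ge> 1"
  shows "\<exists>C\<ge>0. \<forall>k\<ge>1. (\<kappa> * k powr (- (1 / 3) + e)) ^ n
      * power_tail n (\<kappa> * k powr (- (1 / 3) + e')) (\<kappa> * k powr (- (1 / 3) + e))
    \<le> C * (1 + k powr (- (1 - 3 * e') / 6) * (k powr ((e - e') / 2)) ^ n)\<^sup>2"
proof -
  define C where "C = \<kappa> / (1 / 3 - e) + \<kappa>"
  have C: "C \<ge> 0" "\<kappa> \<le> C" "\<kappa> / (1 / 3 - e) \<le> C" using assms by (auto simp: C_def)
  have "(\<kappa> * k powr (- (1 / 3) + e)) ^ n
      * power_tail n (\<kappa> * k powr (- (1 / 3) + e')) (\<kappa> * k powr (- (1 / 3) + e))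
    \<le> C * (1 + k powr (- (1 - 3 * e') / 6) * (k powr ((e - e') / 2)) ^ n)\<^sup>2" if k: "k \<ge> 1" for k
  proof -
    define E where "E = k powr (- (1 - 3 * e') / 6) * (k powr ((e - e') / 2)) ^ n"
    have E: "0 \<le> E" "E\<^sup>2 = k powr (- (1 / 3) + e' + real n * (e - e'))"
    proof -
      have "E = k powr (- (1 - 3 * e') / 6 + real n * ((e - e') / 2))"
        using k by (simp add: E_def powr_add powr_powr mult.commute flip: powr_realpow)
      then have "E\<^sup>2 = k powr (2 * (- (1 - 3 * e') / 6 + real n * ((e - e') / 2)))"
        using k by (simp add: powr_powr mult.commute flip: powr_realpow[of _ 2])
      also have "2 * (- (1 - 3 * e') / 6 + real n * ((e - e') / 2)) = - (1 / 3) + e' + real n *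
          (e - e')"
        by (simp add: field_simps)
      finally show "E\<^sup>2 = k powr (- (1 / 3) + e' + real n * (e - e'))" .
      show "0 \<le> E" by (simp add: E_def)
    qed
    show ?thesis
    proof (cases "n = 1")
      case True
      have "(\<kappa> * k powr (- (1 / 3) + e)) ^ n
        * power_tail n (\<kappa> * k powr (- (1 / 3) + e')) (\<kappa> * k powr (- (1 / 3) + e))
        = \<kappa> * k powr (- (1 / 3) + e) * ((e - e') * ln k)"
        using True assms k by (simp add: power_tail_def powr_diff[symmetric] ln_powr)
      also have "\<dots> \<le> \<kappa> * k powr (- (1 / 3) + e) * (1 * ln k)"
        using assms k by (intro mult_left_mono mult_right_mono) auto
      also have "\<dots> = \<kappa> * (k powr (- (1 / 3 - e)) * ln k)" by simp
      also have "\<dots> \<le> \<kappa> * (1 / (1 / 3 - e))"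
        using assms k by (intro mult_left_mono ln_le_powr) auto
      also have "\<dots> \<le> C * 1" using C by simp
      also have "\<dots> \<le> C * (1 + E)\<^sup>2"
        using C(1) E(1) by (intro mult_left_mono) (simp_all add: power2_sum)
      finally show ?thesis by (simp add: E_def)
    next
      case False
      define i where "i = n - 1"
      have i: "n = Suc i" "i \<noteq> 0" using False assms by (auto simp: i_def)
      have pw: "(k powr x) ^ j = k powr (real j * x)" for x j
        using k by (simp add: powr_powr mult.commute flip: powr_realpow)
      have "(\<kappa> * k powr (- (1 / 3) + e)) ^ n
        * power_tail n (\<kappa> * k powr (- (1 / 3) + e')) (\<kappa> * k powr (- (1 / 3) + e))
        = \<kappa> * (k powr (real n * (- (1 / 3) + e)) / k powr (real i * (- (1 / 3) + e')))"
      proof -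
        have "\<kappa> ^ n * A * (1 / (\<kappa> ^ i * B)) = \<kappa> * (A / B)" for A B
          using i assms by simp
        moreover have "n \<noteq> 1" "n - 1 = i" using i by auto
        ultimately show ?thesis
          by (simp only: power_tail_def power_mult_distrib pw if_False)
      qed
      also have "\<dots> = \<kappa> * E\<^sup>2"
      proof -
        have "real n * (- (1 / 3) + e) - real i * (- (1 / 3) + e') = - (1 / 3) + e' + real n *
            (e - e')"
          by (simp add: i algebra_simps add_divide_distrib)
        then show ?thesis unfolding E(2) powr_diff[symmetric] by simp
      qed
      also have "\<dots> \<le> C * E\<^sup>2" using C by (intro mult_right_mono) auto
      also have "\<dots> \<le> C * (1 + E)\<^sup>2"
        using C(1) square_le_one_plus_square[OF E(1)] by (intro mult_left_mono) auto
      finally show ?thesis by (simp add: E_def)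
    qed
  qed
  with C(1) show ?thesis by blast
qed

text \<open>For \<open>n = 1\<close> the logarithm of the ratio of the distances grows like \<open>ln k\<close>, since the
  interval ends at a distance of order one from the zero.\<close>

lemma outer_rate:
  fixes \<kappa> e Y :: real
  assumes "\<kappa> > 0" "e < 1 / 3" "e > 0" "n \<ge> 1" "Y > 0"
  shows "\<exists>C\<ge>0. \<forall>k\<ge>1. \<forall>y. 0 < y \<and> y \<le> Y \<longrightarrow>
      power_tail n (\<kappa> * k powr (- (1 / 3) + e)) y
    \<le> C * (1 + ((if n = 1 then sqrt (ln k) else 0)
        + (if n \<ge> 2 then k powr (- (1 - 3 * e) / 6) * (k powr ((1 - 3 * e) / 6)) ^ n else 0)))\<^sup>2"
proof (cases "n = 1")
  case True
  define C where "C = \<bar>ln (Y / \<kappa>)\<bar> + 1"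
  have C: "C \<ge> 1" by (simp add: C_def)
  have "ln (y / (\<kappa> * k powr (- (1 / 3) + e))) \<le> C * (1 + sqrt (ln k))\<^sup>2"
    if k: "k \<ge> 1" and y: "0 < y" "y \<le> Y" for k y
  proof -
    have "ln (y / (\<kappa> * k powr (- (1 / 3) + e))) = ln y - ln \<kappa> + (1 / 3 - e) * ln k"
      using assms k y by (simp add: ln_div ln_mult ln_powr algebra_simps)
    also have "\<dots> \<le> ln Y - ln \<kappa> + 1 * ln k"
      using assms k y by (intro add_mono diff_mono mult_right_mono) auto
    also have "\<dots> \<le> \<bar>ln (Y / \<kappa>)\<bar> + ln k"
      using assms by (simp add: ln_div)
    also have "\<dots> \<le> C + C * ln k"
      using C k mult_right_mono[of 1 C "ln k"] by (simp add: C_def)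
    also have "\<dots> = C * (1 + (sqrt (ln k))\<^sup>2)"
      using k by (simp add: distrib_left)
    also have "\<dots> \<le> C * (1 + sqrt (ln k))\<^sup>2"
      using C k by (intro mult_left_mono square_le_one_plus_square) auto
    finally show ?thesis .
  qed
  then show ?thesis
    using True C by (intro exI[of _ C]) (simp add: power_tail_def)
next
  case False
  define i where "i = n - 1"
  have i: "n = Suc i" "i \<noteq> 0" using False assms by (auto simp: i_def)
  have "power_tail n (\<kappa> * k powr (- (1 / 3) + e)) y
      \<le> 1 / \<kappa> ^ i * (1 + k powr (- (1 - 3 * e) / 6) * (k powr ((1 - 3 * e) / 6)) ^ n)\<^sup>2"
    if k: "k \<ge> 1" for k y
  proof -
    define E where "E = k powr (- (1 - 3 * e) / 6) * (k powr ((1 - 3 * e) / 6)) ^ n"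
    have pw: "(k powr x) ^ j = k powr (real j * x)" for x j
      using k by (simp add: powr_powr mult.commute flip: powr_realpow)
    have "- (1 - 3 * e) / 6 + real n * ((1 - 3 * e) / 6) = real i * ((1 - 3 * e) / 6)"
      unfolding i by (simp only: of_nat_Suc distrib_right)
    then have "E = k powr (real i * ((1 - 3 * e) / 6))"
      unfolding E_def pw powr_add[symmetric] by (simp only:)
    then have E2: "E\<^sup>2 = k powr (2 * (real i * ((1 - 3 * e) / 6)))"
      by (simp add: pw)
    have "power_tail n (\<kappa> * k powr (- (1 / 3) + e)) y = 1 / \<kappa> ^ i * (1 / k powr (real i * (- (1 / 3)
        + e)))"
      using i by (simp add: power_tail_def power_mult_distrib pw)
    also have "1 / k powr (real i * (- (1 / 3) + e)) = k powr (- (real i * (- (1 / 3) + e)))"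
      by (rule powr_minus_divide[symmetric])
    also have "- (real i * (- (1 / 3) + e)) = 2 * (real i * ((1 - 3 * e) / 6))"
      by (simp add: algebra_simps)
    also have "1 / \<kappa> ^ i * k powr (2 * (real i * ((1 - 3 * e) / 6))) \<le> 1 / \<kappa> ^ i * (1 + E)\<^sup>2"
      unfolding E2[symmetric] using assms square_le_one_plus_square[of E]
      by (intro mult_left_mono) (auto simp: E_def)
    finally show ?thesis by (simp add: E_def)
  qed
  then show ?thesis
    using i assms by (intro exI[of _ "1 / \<kappa> ^ i"]) simp
qed

lemma boundary_rate:
  fixes S e k :: real
  assumes "S \<ge> 0" "n \<ge> 1" "k \<ge> 1"
  shows "(S * k powr (- (1 / 3) + e)) ^ (2 * n) / (k powr (- (1 / 3))) ^ (2 * n - 1)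
    \<le> S ^ (2 * n) * (1 + k powr (- (1 / 6)) * (k powr e) ^ n)\<^sup>2"
proof -
  define E where "E = k powr (- (1 / 6)) * (k powr e) ^ n"
  have pw: "(k powr x) ^ j = k powr (real j * x)" for x j
    using assms by (simp add: powr_powr mult.commute flip: powr_realpow)
  have E2: "E\<^sup>2 = k powr (2 * (- (1 / 6) + real n * e))"
    by (simp add: E_def pw flip: powr_add)
  have "(S * k powr (- (1 / 3) + e)) ^ (2 * n) / (k powr (- (1 / 3))) ^ (2 * n - 1)
      = S ^ (2 * n) * (k powr (real (2 * n) * (- (1 / 3) + e)) / k powr (real (2 * n - 1) * (-
          (1 / 3))))"
    by (simp add: power_mult_distrib pw)
  also have "\<dots> = S ^ (2 * n) * E\<^sup>2"
  proof -
    have "real (2 * n) * (- (1 / 3) + e) - real (2 * n - 1) * (- (1 / 3)) = 2 * (- (1 / 6)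
        + real n * e)"
      using assms by (simp add: of_nat_diff algebra_simps diff_divide_distrib)
    then show ?thesis unfolding E2 powr_diff[symmetric] by simp
  qed
  also have "\<dots> \<le> S ^ (2 * n) * (1 + E)\<^sup>2"
    using assms square_le_one_plus_square[of E] by (intro mult_left_mono) (auto simp: E_def)
  finally show ?thesis by (simp add: E_def)
qed

text \<open>On the arcs between consecutive zeros this is \<open>growth_between_simple_zeros\<close>. Near a zero,
  one of the two factors is bounded below. The shadow side of \<open>t1\<close> is reached by shifting by the
  period.\<close>

lemma expansion_data_growth:
  assumes data: "expansion_data P t1 t2 b \<Psi> Z" and t: "0 < t1" "t1 < t2" "t2 < 2 * P"
    and gap: "t1 + \<xi>1 < t2 - \<xi>2" "t2 + \<zeta>2 < 2 * P + t1 - \<zeta>1" "\<xi>1 > 0" "\<xi>2 > 0" "\<zeta>1 > 0" "\<zeta>2 > 0"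
  shows "\<exists>c>0. (\<forall>s\<in>{t1..t2}. c * (s - t1) * (t2 - s) \<le> \<bar>Z s\<bar>) \<and>
    (\<forall>s\<in>{t2..2 * P + t1}. c * (s - t2) * (2 * P + t1 - s) \<le> \<bar>Z s\<bar>) \<and>
    (\<forall>s\<in>{t1 - \<zeta>1..t1 + \<xi>1}. c * \<bar>s - t1\<bar> \<le> \<bar>Z s\<bar>) \<and>
    (\<forall>s\<in>{t2 - \<xi>2..t2 + \<zeta>2}. c * \<bar>s - t2\<bar> \<le> \<bar>Z s\<bar>)"
proof -
  have per: "Z (s + 2 * P) = Z s" for s using data by (simp add: expansion_data_def)
  have bright: "Z s > 0" if "t1 < s" "s < t2" for s
    using data that unfolding expansion_data_def by (elim conjE) simp
  have shade: "Z s < 0" if "0 \<le> s \<and> s < t1 \<or> t2 < s \<and> s \<le> 2 * P" for s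
    using data that unfolding expansion_data_def by (elim conjE) simp
  have der: "(Z has_real_derivative nderiv 1 Z s) (at s)" for s
    using smooth_on_UNIV_nderiv_step[of Z 0 s] data
    by (simp add: expansion_data_def nderiv_def has_real_derivative_iff_has_vector_derivative)
  have nz: "nderiv 1 Z t1 \<noteq> 0" "nderiv 1 Z t2 \<noteq> 0"
    using data DERIV_imp_deriv[OF der] by (auto simp: expansion_data_def)
  have der': "(Z has_real_derivative nderiv 1 Z t1) (at (2 * P + t1))"
  proof -
    have "((\<lambda>s. Z (s + 2 * P)) has_real_derivative nderiv 1 Z t1) (at t1)"
      using der[of t1] by (simp add: per)
    then show ?thesis by (simp add: DERIV_shift add.commute)
  qed
  have cont: "continuous_on S Z" for S
    using der by (meson DERIV_continuous continuous_at_imp_continuous_on)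
  have zeros: "Z t1 = 0" "Z t2 = 0" "Z (2 * P + t1) = 0"
    using data per[of t1] by (auto simp: expansion_data_def add.commute)
  have "\<exists>c>0. \<forall>s\<in>{t1..t2}. c * (s - t1) * (t2 - s) \<le> \<bar>Z s\<bar>"
  proof (rule growth_between_simple_zeros[OF t(2) cont _ der nz(1) zeros(1) der nz(2) zeros(2)])
    show "Z s \<noteq> 0" if "t1 < s" "s < t2" for s
      using bright[of s] that by simp
  qed
  then obtain c1 where c1: "c1 > 0" "\<And>s. s \<in> {t1..t2} \<Longrightarrow> c1 * (s - t1) * (t2 - s) \<le> \<bar>Z s\<bar>"
    by blast
  have "\<exists>c>0. \<forall>s\<in>{t2..2 * P + t1}. c * (s - t2) * (2 * P + t1 - s) \<le> \<bar>Z s\<bar>"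
  proof (rule growth_between_simple_zeros[OF _ cont _ der nz(2) zeros(2) der' nz(1) zeros(3)])
    show "t2 < 2 * P + t1" using t by simp
    show "Z s \<noteq> 0" if "t2 < s" "s < 2 * P + t1" for s
    proof (cases "s \<le> 2 * P")
      case True
      then show ?thesis using shade[of s] that by simp
    next
      case False
      then have "Z (s - 2 * P) < 0"
        using shade[of "s - 2 * P"] that by simp
      then show ?thesis using per[of "s - 2 * P"] by simp
    qed
  qed
  then obtain c2 where c2: "c2 > 0" "\<And>s. s \<in> {t2..2 * P + t1} \<Longrightarrow> c2 * (s - t2) * (2 * P + t1 - s)
      \<le> \<bar>Z s\<bar>"
    by blast
  define g1 where "g1 = t2 - t1 - \<xi>1"
  define g2 where "g2 = t2 - t1 - \<xi>2"
  define g3 where "g3 = 2 * P + t1 - t2 - \<zeta>1"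
  define g4 where "g4 = 2 * P + t1 - t2 - \<zeta>2"
  have g: "g1 > 0" "g2 > 0" "g3 > 0" "g4 > 0" using gap by (auto simp: g1_def g2_def g3_def g4_def)
  \<comment> \<open>The numbers g1, ..., g4 bound from below the distance of a point near one zero to the other
      zero.\<close>
  define c where "c = Min {c1, c2, c1 * g1, c1 * g2, c2 * g3, c2 * g4}"
  have c: "c > 0" "c \<le> c1" "c \<le> c2" "c \<le> c1 * g1" "c \<le> c1 * g2" "c \<le> c2 * g3" "c \<le> c2 * g4"
    unfolding c_def using c1(1) c2(1) g by (subst Min_gr_iff; simp) (rule Min_le; simp)+
  have "c * (s - t1) * (t2 - s) \<le> \<bar>Z s\<bar>" if "s \<in> {t1..t2}" for s
    using c1(2)[OF that] that mult_right_mono[OF c(2), of "(s - t1) * (t2 - s)"]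
        by (simp add: mult.assoc)
  moreover have "c * (s - t2) * (2 * P + t1 - s) \<le> \<bar>Z s\<bar>" if "s \<in> {t2..2 * P + t1}" for s
    using c2(2)[OF that] that mult_right_mono[OF c(3), of "(s - t2) * (2 * P + t1 - s)"]
        by (simp add: mult.assoc)
  moreover have "c * \<bar>s - t1\<bar> \<le> \<bar>Z s\<bar>" if "s \<in> {t1 - \<zeta>1..t1 + \<xi>1}" for s
  proof (cases "s \<ge> t1")
    case True
    have "c * (s - t1) \<le> (c1 * g1) * (s - t1)"
      using True c by (intro mult_right_mono) auto
    also have "\<dots> \<le> c1 * (s - t1) * (t2 - s)"
      using True that c1(1) gap mult_left_mono[of g1 "t2 - s" "c1 * (s - t1)"]
          by (simp add: g1_def mult_ac)
    also have "\<dots> \<le> \<bar>Z s\<bar>" using c1(2)[of s] that True gap by auto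
    finally show ?thesis using True by simp
  next
    case False
    have "c * (t1 - s) \<le> (c2 * g3) * (t1 - s)"
      using False c by (intro mult_right_mono) auto
    also have "\<dots> \<le> c2 * (s + 2 * P - t2) * (2 * P + t1 - (s + 2 * P))"
      using False that c2(1) gap mult_left_mono[of g3 "s + 2 * P - t2" "c2 * (t1 - s)"]
          by (simp add: g3_def mult_ac)
    also have "\<dots> \<le> \<bar>Z (s + 2 * P)\<bar>" using c2(2)[of "s + 2 * P"] that False gap by auto
    finally show ?thesis using False by (simp add: per)
  qed
  moreover have "c * \<bar>s - t2\<bar> \<le> \<bar>Z s\<bar>" if "s \<in> {t2 - \<xi>2..t2 + \<zeta>2}" for s
  proof (cases "s \<le> t2")
    case True
    have "c * (t2 - s) \<le> (c1 * g2) * (t2 - s)"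
      using True c by (intro mult_right_mono) auto
    also have "\<dots> \<le> c1 * (s - t1) * (t2 - s)"
      using True that c1(1) gap mult_left_mono[of g2 "s - t1" "c1 * (t2 - s)"]
          by (simp add: g2_def mult_ac)
    also have "\<dots> \<le> \<bar>Z s\<bar>" using c1(2)[of s] that True gap by auto
    finally show ?thesis using True by simp
  next
    case False
    have "c * (s - t2) \<le> (c2 * g4) * (s - t2)"
      using False c by (intro mult_right_mono) auto
    also have "\<dots> \<le> c2 * (s - t2) * (2 * P + t1 - s)"
      using False that c2(1) gap mult_left_mono[of g4 "2 * P + t1 - s" "c2 * (s - t2)"]
          by (simp add: g4_def mult_ac)
    also have "\<dots> \<le> \<bar>Z s\<bar>" using c2(2)[of s] that False gap by auto
    finally show ?thesis using False by simp
  qed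
  ultimately show ?thesis using c(1) by blast
qed

section \<open>Square integrable functions and quasi-optimality of the Galerkin method\<close>

lemma borel_measurable_cnj [measurable]:
  assumes "g \<in> borel_measurable M"
  shows "(\<lambda>x. cnj (g x)) \<in> borel_measurable M"
  using borel_measurable_continuous_on[OF _ assms, of cnj]
  by (simp add: continuous_on_cnj)

lemma bounded_measurable_set_integrable:
  fixes h :: "real \<Rightarrow> 'a::{banach, second_countable_topology}"
  assumes "h \<in> borel_measurable borel" "\<And>s. norm (h s) \<le> C"
  shows "set_integrable lborel {a..b} h"
proof (rule set_integrable_bound)
  show "set_integrable lborel {a..b} (\<lambda>_. C)"
    by (rule borel_integrable_atLeastAtMost') simp
  show "set_borel_measurable lborel {a..b} h"
    using assms(1) by (simp add: set_borel_measurable_def)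
  have "norm (h x) \<le> norm C" for x
    using assms(2)[of x] by simp
  then show "AE x in lborel. x \<in> {a..b} \<longrightarrow> norm (h x) \<le> norm C"
    by simp
qed

lemma bounded_periodic_in_L2:
  assumes "g \<in> borel_measurable borel" "\<And>s. norm (g s) \<le> C" "\<And>s. g (s + 2 * P) = g s"
  shows "g \<in> L2 P"
proof -
  have "set_integrable lborel {0..2 * P} (\<lambda>s. (norm (g s))\<^sup>2)"
  proof (rule bounded_measurable_set_integrable)
    show "norm ((norm (g s))\<^sup>2) \<le> C\<^sup>2" for s
      using assms(2)[of s] by (simp add: power_mono)
  qed (use assms(1) in measurable)
  then show ?thesis using assms(1,3) by (simp add: L2_def)
qed

lemma L2_norm_nonneg: "0 \<le> L2_norm P g"
  by (auto simp: L2_norm_def set_lebesgue_integral_def intro!: integral_nonneg_AE)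

lemma L2_norm_power2: "(L2_norm P g)\<^sup>2 = set_lebesgue_integral lborel {0..2 * P} (\<lambda>s. (norm
    (g s))\<^sup>2)"
  unfolding L2_norm_def
  by (rule real_sqrt_pow2) (auto simp: set_lebesgue_integral_def intro!: integral_nonneg_AE)

lemma L2_inner_integrable:
  assumes "g \<in> L2 P" "h \<in> L2 P"
  shows "set_integrable lborel {0..2 * P} (\<lambda>s. cnj (g s) * h s)"
proof (rule set_integrable_bound)
  show "set_integrable lborel {0..2 * P} (\<lambda>s. (norm (g s))\<^sup>2 + (norm (h s))\<^sup>2)"
    using assms by (intro set_integral_add) (auto simp: L2_def)
  have [measurable]: "g \<in> borel_measurable borel" "h \<in> borel_measurable borel"
    using assms by (auto simp: L2_def)
  have "(\<lambda>s. cnj (g s) * h s) \<in> borel_measurable borel"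
    by measurable
  then show "set_borel_measurable lborel {0..2 * P} (\<lambda>s. cnj (g s) * h s)"
    by (simp add: set_borel_measurable_def)
  have "norm (cnj (g s) * h s) \<le> norm ((norm (g s))\<^sup>2 + (norm (h s))\<^sup>2)" for s
  proof -
    have "0 \<le> norm (g s) * norm (h s)" by simp
    then have "norm (g s) * norm (h s) \<le> (norm (g s))\<^sup>2 + (norm (h s))\<^sup>2"
      using sum_squares_bound[of "norm (g s)" "norm (h s)"] by linarith
    then show ?thesis by (simp add: norm_mult)
  qed
  then show "AE s in lborel. s \<in> {0..2 * P} \<longrightarrow>
      norm (cnj (g s) * h s) \<le> norm ((norm (g s))\<^sup>2 + (norm (h s))\<^sup>2)"
    by simp
qed

lemma L2_combination:
  assumes g: "g \<in> L2 P" and h: "h \<in> L2 P"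
  shows "(\<lambda>s. g s + c * h s) \<in> L2 P"
proof -
  have [measurable]: "g \<in> borel_measurable borel" "h \<in> borel_measurable borel"
    using assms by (auto simp: L2_def)
  have meas: "(\<lambda>s. g s + c * h s) \<in> borel_measurable borel"
    by measurable
  have "set_integrable lborel {0..2 * P} (\<lambda>s. (norm (g s + c * h s))\<^sup>2)"
  proof (rule set_integrable_bound)
    show "set_integrable lborel {0..2 * P} (\<lambda>s. 2 * (norm (g s))\<^sup>2 + 2 * (norm c)\<^sup>2 * (norm
        (h s))\<^sup>2)"
      using assms by (intro set_integral_add set_integrable_mult_right) (auto simp: L2_def)
    show "set_borel_measurable lborel {0..2 * P} (\<lambda>s. (norm (g s + c * h s))\<^sup>2)"
      using meas by (simp add: set_borel_measurable_def)
    have "(norm (g s + c * h s))\<^sup>2 \<le> 2 * (norm (g s))\<^sup>2 + 2 * (norm c)\<^sup>2 * (norm (h s))\<^sup>2" for s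
    proof -
      have "(norm (g s + c * h s))\<^sup>2 \<le> (norm (g s) + norm (c * h s))\<^sup>2"
        by (intro power_mono norm_triangle_ineq) simp
      also have "\<dots> \<le> 2 * (norm (g s))\<^sup>2 + 2 * (norm (c * h s))\<^sup>2"
        using sum_squares_bound[of "norm (g s)" "norm (c * h s)"] by (simp add: power2_sum)
      finally show ?thesis by (simp add: norm_mult power_mult_distrib)
    qed
    then show "AE s in lborel. s \<in> {0..2 * P} \<longrightarrow> norm ((norm (g s + c * h s))\<^sup>2)
        \<le> norm (2 * (norm (g s))\<^sup>2 + 2 * (norm c)\<^sup>2 * (norm (h s))\<^sup>2)"
      by simp
  qed
  then show ?thesis using assms meas by (simp add: L2_def)
qed

lemma L2_zero: "(\<lambda>_. 0) \<in> L2 P"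
  by (rule bounded_periodic_in_L2[of _ 0]) auto

lemma L2_diff: "g \<in> L2 P \<Longrightarrow> h \<in> L2 P \<Longrightarrow> (\<lambda>s. g s - h s) \<in> L2 P"
  using L2_combination[of g P h "-1"] by simp

lemma L2_scale: "h \<in> L2 P \<Longrightarrow> (\<lambda>s. c * h s) \<in> L2 P"
  using L2_combination[OF L2_zero, of h P c] by simp

lemma L2_inner_combination_right:
  assumes "\<mu> \<in> L2 P" "g \<in> L2 P" "h \<in> L2 P"
  shows "L2_inner P \<mu> (\<lambda>s. g s + c * h s) = L2_inner P \<mu> g + c * L2_inner P \<mu> h"
proof -
  have "L2_inner P \<mu> (\<lambda>s. g s + c * h s)
      = set_lebesgue_integral lborel {0..2 * P} (\<lambda>s. cnj (\<mu> s) * g s + c * (cnj (\<mu> s) * h s))"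
    by (simp add: L2_inner_def algebra_simps)
  also have "\<dots> = L2_inner P \<mu> g + c * L2_inner P \<mu> h"
    unfolding L2_inner_def
    by (subst set_integral_add(2)) (simp_all add: L2_inner_integrable assms
        set_integrable_mult_right)
  finally show ?thesis .
qed

lemma L2_inner_combination_left:
  assumes "\<mu> \<in> L2 P" "g \<in> L2 P" "h \<in> L2 P"
  shows "L2_inner P (\<lambda>s. g s + c * h s) \<mu> = L2_inner P g \<mu> + cnj c * L2_inner P h \<mu>"
proof -
  have "L2_inner P (\<lambda>s. g s + c * h s) \<mu>
      = set_lebesgue_integral lborel {0..2 * P} (\<lambda>s. cnj (g s) * \<mu> s + cnj c * (cnj (h s) * \<mu> s))"
    by (simp add: L2_inner_def algebra_simps)
  also have "\<dots> = L2_inner P g \<mu> + cnj c * L2_inner P h \<mu>"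
    unfolding L2_inner_def
    by (subst set_integral_add(2)) (simp_all add: L2_inner_integrable assms
        set_integrable_mult_right)
  finally show ?thesis .
qed

lemma L2_inner_cong_AE:
  assumes "\<mu> \<in> L2 P" "g \<in> L2 P" "h \<in> L2 P" "AE s in lborel. g s = h s"
  shows "L2_inner P \<mu> g = L2_inner P \<mu> h"
proof -
  have [measurable]: "\<mu> \<in> borel_measurable borel" "g \<in> borel_measurable borel"
      "h \<in> borel_measurable borel"
    using assms by (auto simp: L2_def)
  show ?thesis
    unfolding L2_inner_def
    using assms(4) by (intro set_lebesgue_integral_cong_AE) auto
qed

text \<open>Finite-dimensional spaces of functions, built by adding one generator at a time. Induction
  on the construction takes the place of bases and dimensions, and generators may be linearly
  dependent.\<close>

inductive finitely_spanned :: "('x \<Rightarrow> complex) set \<Rightarrow> bool" where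
  zero: "finitely_spanned {\<lambda>_. 0}"
| extend: "finitely_spanned V \<Longrightarrow> finitely_spanned {\<lambda>s. f s + c * v s | f c. f \<in> V}"

lemma finitely_spanned_zero: "finitely_spanned V \<Longrightarrow> (\<lambda>_. 0) \<in> V"
proof (induction rule: finitely_spanned.induct)
  case (extend V v)
  then show ?case by (auto intro!: exI[of _ "\<lambda>_. 0"] exI[of _ 0])
qed simp

lemma finitely_spanned_combination:
  "finitely_spanned V \<Longrightarrow> f \<in> V \<Longrightarrow> g \<in> V \<Longrightarrow> (\<lambda>s. f s + c * g s) \<in> V"
proof (induction arbitrary: f g rule: finitely_spanned.induct)
  case (extend V v)
  then obtain f' a g' a' where f: "f = (\<lambda>s. f' s + a * v s)" "f' \<in> V"
    and g: "g = (\<lambda>s. g' s + a' * v s)" "g' \<in> V" by auto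
  have "(\<lambda>s. f s + c * g s) = (\<lambda>s. (f' s + c * g' s) + (a + c * a') * v s)"
    by (auto simp: f g algebra_simps)
  then show ?case using extend.IH[OF f(2) g(2)] by auto
qed simp

text \<open>This assembles the Galerkin space from its regions.\<close>

lemma finitely_spanned_sum:
  assumes "finitely_spanned U" "finitely_spanned V"
  shows "finitely_spanned {\<lambda>s. f s + g s | f g. f \<in> V \<and> g \<in> U}"
  using assms(1)
proof (induction rule: finitely_spanned.induct)
  case zero
  have "{\<lambda>s. f s + g s | f g. f \<in> V \<and> g \<in> {\<lambda>_. 0}} = V" by auto
  then show ?case using assms(2) by simp
next
  case (extend U u)
  have "{\<lambda>s. f s + g s | f g. f \<in> V \<and> g \<in> {\<lambda>s. f s + c * u s | f c. f \<in> U}}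
      = {\<lambda>s. f s + c * u s | f c. f \<in> {\<lambda>s. f s + g s | f g. f \<in> V \<and> g \<in> U}}" (is "?L = ?R")
  proof
    show "?L \<subseteq> ?R"
    proof
      fix x assume "x \<in> ?L"
      then obtain f g c where "x = (\<lambda>s. f s + (g s + c * u s))" "f \<in> V" "g \<in> U" by auto
      then have "x = (\<lambda>s. (\<lambda>s. f s + g s) s + c * u s)" by (simp add: add.assoc)
      moreover have "(\<lambda>s. f s + g s) \<in> {\<lambda>s. f s + g s | f g. f \<in> V \<and> g \<in> U}"
        using \<open>f \<in> V\<close> \<open>g \<in> U\<close> by blast
      ultimately show "x \<in> ?R"
        by - (rule CollectI, rule exI[of _ "\<lambda>s. f s + g s"], rule exI[of _ c], rule conjI)
    qed
    show "?R \<subseteq> ?L"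
    proof
      fix x assume "x \<in> ?R"
      then obtain f g c where "x = (\<lambda>s. (f s + g s) + c * u s)" "f \<in> V" "g \<in> U" by auto
      then have "x = (\<lambda>s. f s + (\<lambda>s. g s + c * u s) s)" by (simp add: add.assoc)
      moreover have "(\<lambda>s. g s + c * u s) \<in> {\<lambda>s. f s + c * u s | f c. f \<in> U}"
        using \<open>g \<in> U\<close> by blast
      ultimately show "x \<in> ?L"
        using \<open>f \<in> V\<close>
        by - (rule CollectI, rule exI[of _ f], rule exI[of _ "\<lambda>s. g s + c * u s"],
              intro conjI)
    qed
  qed
  then show ?case using finitely_spanned.extend[OF extend.IH] by simp
qed

text \<open>Elimination of one generator \<open>v\<close> at a time. The induction hypothesis gives \<open>w\<close> in the
  smaller space with the same values \<open>a \<mu> v\<close>, so that \<open>z = v - w\<close> does not disturb the equations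
  already solved, and testing with \<open>z\<close> fixes its coefficient; definiteness makes this possible
  unless \<open>z = 0\<close>.\<close>

lemma sesquilinear_solvable:
  fixes a :: "('x \<Rightarrow> complex) \<Rightarrow> ('x \<Rightarrow> complex) \<Rightarrow> complex"
  assumes right: "\<And>\<mu> g h c. \<lbrakk>\<mu> \<in> H; g \<in> H; h \<in> H\<rbrakk> \<Longrightarrow> a \<mu> (\<lambda>s. g s + c * h s) = a \<mu> g + c * a \<mu> h"
    and left: "\<And>\<mu> g h c. \<lbrakk>\<mu> \<in> H; g \<in> H; h \<in> H\<rbrakk> \<Longrightarrow> a (\<lambda>s. g s + c * h s) \<mu> = a g \<mu> + cnj c * a h \<mu>"
    and V: "finitely_spanned V" "V \<subseteq> H"
    and definite: "\<And>v. v \<in> V \<Longrightarrow> a v v = 0 \<Longrightarrow> v = (\<lambda>_. 0)"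
    and functional: "\<And>g h c. \<lbrakk>g \<in> H; h \<in> H\<rbrakk> \<Longrightarrow> l (\<lambda>s. g s + c * h s) = l g + cnj c * l h"
  shows "\<exists>\<rho>\<in>V. \<forall>\<mu>\<in>V. a \<mu> \<rho> = l \<mu>"
  using V definite functional
proof (induction arbitrary: l rule: finitely_spanned.induct)
  case zero
  let ?o = "\<lambda>_::'x. 0::complex"
  have "?o \<in> H" using zero by simp
  then have "a ?o ?o = 0" "l ?o = 0"
    using left[of ?o ?o ?o 1] zero(3)[of ?o ?o 1] by simp_all
  then show ?case by simp
next
  case (extend V v)
  let ?V = "{\<lambda>s. f s + c * v s | f c. f \<in> V}"
  have in_V': "(\<lambda>s. f s + c * v s) \<in> ?V" if "f \<in> V" for f c
    using that by blast
  have VV': "V \<subseteq> ?V"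
  proof
    fix f assume "f \<in> V"
    from in_V'[OF this, of 0] show "f \<in> ?V" by simp
  qed
  have V: "V \<subseteq> H" using VV' extend.prems(1) by blast
  have v: "v \<in> ?V" "v \<in> H"
    using in_V'[OF finitely_spanned_zero[OF extend.hyps], of 1] extend.prems(1) by auto
  note IH = extend.IH[OF V extend.prems(2)[OF subsetD[OF VV']]]
  obtain w where w: "w \<in> V" "\<forall>\<mu>\<in>V. a \<mu> w = a \<mu> v"
    using IH[of "\<lambda>\<mu>. a \<mu> v", OF _ _ left[OF v(2)]] by auto
  obtain \<rho>0 where \<rho>0: "\<rho>0 \<in> V" "\<forall>\<mu>\<in>V. a \<mu> \<rho>0 = l \<mu>"
    using IH[of l, OF _ _ extend.prems(3)] by auto
  define z where "z = (\<lambda>s. v s + (-1) * w s)"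
  have z_eq: "z = (\<lambda>s. (\<lambda>s. 0 + (-1) * w s) s + 1 * v s)" by (auto simp: z_def)
  have "z \<in> ?V"
    unfolding z_eq
    by (rule in_V'[OF finitely_spanned_combination[OF extend.hyps finitely_spanned_zero[OF
        extend.hyps] w(1)]])
  then have zH: "z \<in> H" using extend.prems(1) by blast
  have az: "a \<mu> z = 0" if "\<mu> \<in> V" for \<mu>
    using right[of \<mu> v w "-1"] w that v(2) V by (auto simp: z_def)
  show ?case
  proof (cases "a z z = 0")
    case True
    then have "z = (\<lambda>_. 0)" using extend.prems(2) \<open>z \<in> ?V\<close> by blast
    then have "v = w" by (auto simp: z_def fun_eq_iff)
    then have "?V \<subseteq> V"
      using finitely_spanned_combination[OF extend.hyps _ w(1)] by auto
    with VV' have "?V = V" by (rule equalityI[rotated])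
    then show ?thesis using \<rho>0 by (simp only:) blast
  next
    case False
    define c where "c = (l z - a z \<rho>0) / a z z"
    define \<rho> where "\<rho> = (\<lambda>s. \<rho>0 s + c * z s)"
    have \<rho>V: "\<rho> \<in> ?V"
    proof -
      have "\<rho> = (\<lambda>s. (\<lambda>s. \<rho>0 s + (- c) * w s) s + c * v s)"
        by (auto simp: \<rho>_def z_def algebra_simps)
      then show ?thesis
        using in_V'[OF finitely_spanned_combination[OF extend.hyps \<rho>0(1) w(1)], of "- c" c] by simp
    qed
    have a\<rho>: "a \<mu> \<rho> = a \<mu> \<rho>0 + c * a \<mu> z" if "\<mu> \<in> H" for \<mu>
      unfolding \<rho>_def using right that zH \<rho>0(1) V by blast
    have az\<rho>: "a z \<rho> = l z"
      using a\<rho>[OF zH] False by (simp add: c_def)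
    have "a \<mu> \<rho> = l \<mu>" if \<mu>_in: "\<mu> \<in> ?V" for \<mu>
    proof -
      obtain f c' where \<mu>: "\<mu> = (\<lambda>s. f s + c' * v s)" "f \<in> V" using \<mu>_in by blast
      define g where "g = (\<lambda>s. f s + c' * w s)"
      have g: "g \<in> V"
        unfolding g_def by (rule finitely_spanned_combination[OF extend.hyps \<mu>(2) w(1)])
      have \<mu>': "\<mu> = (\<lambda>s. g s + c' * z s)"
        by (auto simp: \<mu> g_def z_def algebra_simps)
      have gH: "g \<in> H" using g V by blast
      have \<rho>H: "\<rho> \<in> H" using \<rho>V extend.prems(1) by blast
      have "a g \<rho> = l g"
        using a\<rho>[OF gH] az[OF g] \<rho>0(2) g by simp
      then show ?thesis
        unfolding \<mu>' left[OF \<rho>H gH zH] extend.prems(3)[OF gH zH] az\<rho> by simp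
    qed
    then show ?thesis using \<rho>V by blast
  qed
qed

text \<open>Cea's argument: the error \<open>e\<close> satisfies \<open>a \<nu> e = 0\<close> for \<open>\<nu> \<in> G\<close>, so in \<open>a e e\<close> the first
  argument may be replaced by the difference of \<open>\<eta> - \<sigma>\<close> and any element of \<open>G\<close>. That no nonzero
  function in \<open>G\<close> has norm zero makes the Galerkin solution unique as a function, as its
  definition by a definite description requires.\<close>

lemma galerkin_quasi_optimal:
  assumes R: "L2_linear_operator P R" and C: "continuous_coercive P R Cc cc"
    and f: "f \<in> L2 P" and eta: "\<eta> \<in> L2 P" "AE s in lborel. R \<eta> s = f s"
    and sig: "\<sigma> \<in> L2 P"
    and G: "finitely_spanned G" "G \<subseteq> L2 P" "\<And>g. g \<in> G \<Longrightarrow> L2_norm P g = 0 \<Longrightarrow> g = (\<lambda>_. 0)"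
    and \<mu>: "\<mu> \<in> G"
  shows "L2_norm P (\<lambda>s. \<eta> s - galerkin_approximation P R f G \<sigma> s)
    \<le> Cc / cc * L2_norm P (\<lambda>s. \<eta> s - \<sigma> s - \<mu> s)"
proof -
  define a where "a = (\<lambda>\<mu> \<rho>. L2_inner P \<mu> (R \<rho>))"
  have cpos: "Cc > 0" "cc > 0" using C by (auto simp: continuous_coercive_def)
  have bounded: "norm (a \<mu> \<phi>) \<le> Cc * L2_norm P \<mu> * L2_norm P \<phi>" if "\<mu> \<in> L2 P" "\<phi> \<in> L2 P" for \<mu> \<phi>
    using C that by (auto simp: continuous_coercive_def a_def)
  have coercive: "cc * (L2_norm P \<mu>)\<^sup>2 \<le> norm (a \<mu> \<mu>)" if "\<mu> \<in> L2 P" for \<mu>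
    using C that by (auto simp: continuous_coercive_def a_def)
  have R_L2: "R g \<in> L2 P" if "g \<in> L2 P" for g
    using R that by (auto simp: L2_linear_operator_def)
  have R_linear: "AE s in lborel. R (\<lambda>s. g s + c * h s) s = R g s + c * R h s"
    if "g \<in> L2 P" "h \<in> L2 P" for g h c
  proof -
    have "AE s in lborel. R (\<lambda>s. g s + c * h s) s = R g s + R (\<lambda>s. c * h s) s"
      by (rule R[unfolded L2_linear_operator_def, THEN conjunct2, THEN conjunct2, THEN conjunct1,
            rule_format, OF that(1) L2_scale[OF that(2)]])
    moreover have "AE s in lborel. R (\<lambda>s. c * h s) s = c * R h s"
      by (rule R[unfolded L2_linear_operator_def, THEN conjunct2, THEN conjunct2, THEN conjunct2,
            rule_format, OF that(2)])
    ultimately show ?thesis by eventually_elim simp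
  qed
  have right: "a \<mu> (\<lambda>s. g s + c * h s) = a \<mu> g + c * a \<mu> h"
    if "\<mu> \<in> L2 P" "g \<in> L2 P" "h \<in> L2 P" for \<mu> g h c
  proof -
    have "a \<mu> (\<lambda>s. g s + c * h s) = L2_inner P \<mu> (\<lambda>s. R g s + c * R h s)"
      unfolding a_def using that
      by (intro L2_inner_cong_AE R_linear R_L2 L2_combination) auto
    then show ?thesis
      using L2_inner_combination_right[of \<mu> P "R g" "R h" c] that R_L2 by (simp add: a_def)
  qed
  have left: "a (\<lambda>s. g s + c * h s) \<mu> = a g \<mu> + cnj c * a h \<mu>"
    if "\<mu> \<in> L2 P" "g \<in> L2 P" "h \<in> L2 P" for \<mu> g h c
    unfolding a_def using that R_L2 by (intro L2_inner_combination_left) auto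
  have definite: "v = (\<lambda>_. 0)" if "v \<in> G" "a v v = 0" for v
  proof -
    have "cc * (L2_norm P v)\<^sup>2 \<le> 0" using coercive[of v] that G(2) by auto
    then have "(L2_norm P v)\<^sup>2 \<le> 0" using cpos(2) by (simp add: mult_le_0_iff)
    then have "L2_norm P v = 0" by simp
    with G(3) that(1) show ?thesis by blast
  qed
  have R\<sigma>: "R \<sigma> \<in> L2 P" using R_L2 sig by blast
  define g where "g = (\<lambda>s. f s - R \<sigma> s)"
  have g: "g \<in> L2 P" unfolding g_def by (rule L2_diff[OF f R\<sigma>])
  have "\<exists>\<rho>\<in>G. \<forall>\<mu>\<in>G. a \<mu> \<rho> = L2_inner P \<mu> g"
    using right left G(1,2) definite
    by (rule sesquilinear_solvable) (auto intro: L2_inner_combination_left g)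
  then obtain \<rho> where \<rho>: "\<rho> \<in> G" "\<And>\<mu>. \<mu> \<in> G \<Longrightarrow> a \<mu> \<rho> = L2_inner P \<mu> g" by blast
  have "galerkin_solution P R G g = \<rho>"
    unfolding galerkin_solution_def
  proof (rule the_equality)
    show "\<rho> \<in> G \<and> (\<forall>\<mu>\<in>G. L2_inner P \<mu> (R \<rho>) = L2_inner P \<mu> g)"
      using \<rho> by (auto simp: a_def)
    fix \<rho>' assume \<rho>': "\<rho>' \<in> G \<and> (\<forall>\<mu>\<in>G. L2_inner P \<mu> (R \<rho>') = L2_inner P \<mu> g)"
    define \<delta> where "\<delta> = (\<lambda>s. \<rho>' s + (-1) * \<rho> s)"
    have \<delta>: "\<delta> \<in> G" unfolding \<delta>_def
      by (rule finitely_spanned_combination[OF G(1)]) (use \<rho>' \<rho> in auto)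
    have "a \<delta> \<delta> = a \<delta> \<rho>' + (-1) * a \<delta> \<rho>"
      using right[of \<delta> \<rho>' \<rho> "-1"] \<delta> \<rho> \<rho>' G(2) unfolding \<delta>_def by blast
    also have "\<dots> = 0"
      using \<rho>(2)[OF \<delta>] \<rho>' \<delta> by (simp add: a_def)
    finally have "\<delta> = (\<lambda>_. 0)" using definite \<delta> by blast
    then show "\<rho>' = \<rho>" by (auto simp: \<delta>_def fun_eq_iff)
  qed
  then have approx: "galerkin_approximation P R f G \<sigma> = (\<lambda>s. \<sigma> s + \<rho> s)"
    by (auto simp: galerkin_approximation_def g_def)
  have \<rho>L: "\<rho> \<in> L2 P" and \<mu>L: "\<mu> \<in> L2 P" using \<rho>(1) \<mu> G(2) by auto
  define r where "r = (\<lambda>s. \<eta> s + (-1) * \<sigma> s)"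
  have rL: "r \<in> L2 P" unfolding r_def by (rule L2_combination[OF eta(1) sig])
  have ar: "a \<nu> r = L2_inner P \<nu> g" if "\<nu> \<in> L2 P" for \<nu>
  proof -
    have "AE s in lborel. R r s = g s"
      using R_linear[OF eta(1) sig, of "-1"] eta(2)
      by eventually_elim (simp add: r_def g_def)
    then show ?thesis
      unfolding a_def by (intro L2_inner_cong_AE that R_L2 rL g)
  qed
  define e where "e = (\<lambda>s. r s + (-1) * \<rho> s)"
  have eL: "e \<in> L2 P" unfolding e_def by (rule L2_combination[OF rL \<rho>L])
  have orth: "a \<nu> e = 0" if "\<nu> \<in> G" for \<nu>
    using right[of \<nu> r \<rho> "-1"] ar[of \<nu>] \<rho>(2)[OF that] that G(2) rL \<rho>L unfolding e_def by auto
  define q where "q = (\<lambda>s. r s + (-1) * \<mu> s)"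
  have qL: "q \<in> L2 P" unfolding q_def by (rule L2_combination[OF rL \<mu>L])
  define \<nu> where "\<nu> = (\<lambda>s. \<mu> s + (-1) * \<rho> s)"
  have \<nu>: "\<nu> \<in> G" unfolding \<nu>_def
    by (rule finitely_spanned_combination[OF G(1) \<mu> \<rho>(1)])
  have e_eq: "e = (\<lambda>s. q s + 1 * \<nu> s)"
    by (auto simp: e_def q_def \<nu>_def)
  have "a e e = a q e + cnj 1 * a \<nu> e"
    using left[of e q \<nu> 1] eL qL \<nu> G(2) unfolding e_eq[symmetric] by blast
  then have aee: "a e e = a q e" using orth[OF \<nu>] by simp
  have "cc * (L2_norm P e)\<^sup>2 \<le> Cc * L2_norm P q * L2_norm P e"
    using coercive[OF eL] bounded[OF qL eL] unfolding aee by linarith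
  then have "cc * L2_norm P e \<le> Cc * L2_norm P q"
  proof (cases "L2_norm P e = 0")
    case False
    then have "L2_norm P e > 0" using L2_norm_nonneg[of P e] by linarith
    with \<open>cc * (L2_norm P e)\<^sup>2 \<le> Cc * L2_norm P q * L2_norm P e\<close> show ?thesis
      by (simp add: power2_eq_square mult.assoc[symmetric])
  qed (use cpos L2_norm_nonneg in simp)
  then have "L2_norm P e \<le> Cc / cc * L2_norm P q"
    using cpos by (simp add: field_simps)
  moreover have "(\<lambda>s. \<eta> s - galerkin_approximation P R f G \<sigma> s) = e"
    by (auto simp: approx e_def r_def)
  moreover have "(\<lambda>s. \<eta> s - \<sigma> s - \<mu> s) = q"
    by (auto simp: q_def r_def)
  ultimately show ?thesis by simp
qed

section \<open>Piecewise polynomials on a partition of one period\<close>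

lemma set_integral_translate:
  fixes h :: "real \<Rightarrow> real"
  assumes "\<And>s. h (s + q) = h s"
  shows "set_lebesgue_integral lborel {a + q..b + q} h = set_lebesgue_integral lborel {a..b} h"
proof -
  have "indicator {a + q..b + q} (q + s) *\<^sub>R h (q + s) = indicator {a..b} s *\<^sub>R h s" for s
    using assms[of s] by (auto simp: indicator_def add.commute)
  then show ?thesis
    unfolding set_lebesgue_integral_def
    by (subst lborel_integral_real_affine[of 1 _ q]) simp_all
qed

text \<open>In general the regions do not fit into \<open>[0, 2 P]\<close>: the union of the regions begins at a
  point that depends on \<open>k\<close> and may be negative.\<close>

lemma set_integral_period_window:
  fixes h :: "real \<Rightarrow> real"
  assumes "p > 0" and per: "\<And>s. h (s + p) = h s"
    and meas: "h \<in> borel_measurable borel" "\<And>s. norm (h s) \<le> C"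
  shows "set_lebesgue_integral lborel {c..c + p} h = set_lebesgue_integral lborel {0..p} h"
proof -
  let ?J = "\<lambda>a b. set_lebesgue_integral lborel {a..b} h"
  have split: "?J a b + ?J b d = ?J a d" if "a \<le> b" "b \<le> d" for a b d
  proof -
    have "?J a b + ?J b d = set_lebesgue_integral lborel ({a..b} \<union> {b..d}) h"
    proof (rule set_integral_Un_AE[symmetric])
      show "AE x in lborel. \<not> (x \<in> {a..b} \<and> x \<in> {b..d})"
        using AE_lborel_singleton[of b] by eventually_elim auto
    qed (auto intro: bounded_measurable_set_integrable[OF meas])
    then show ?thesis using that by (simp add: ivl_disj_un_two_touch)
  qed
  obtain n where n: "0 \<le> c + p * real_of_int n" "c + p * real_of_int n < 0 + p"
    using periodic_representative[OF \<open>p > 0\<close>] .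
  define c' where "c' = c + p * real_of_int n"
  have "?J c (c + p) = ?J c' (c' + p)"
    using set_integral_translate[where h = h, OF periodic_int[where f = h, OF per], of c n "c + p"]
    by (simp add: c'_def add_ac)
  also have "\<dots> = ?J c' p + ?J p (p + c')"
    using n split[of c' p "c' + p"] \<open>p > 0\<close> by (simp add: c'_def add_ac)
  also have "?J p (p + c') = ?J 0 c'"
    using set_integral_translate[where h = h, OF per, of 0 c'] by (simp add: add_ac)
  finally show ?thesis
    using split[of 0 c' p] n by (simp add: c'_def)
qed

lemma periodic_piece_periodic: "periodic_piece P X p (s + 2 * P) = periodic_piece P X p s"
  unfolding periodic_piece_def
  by (rule sum.reindex_bij_witness[of _ "\<lambda>n. n - 1" "\<lambda>n. n + 1"]) (auto simp: algebra_simps)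

lemma periodic_piece_combination:
  "periodic_piece P X (p + smult c q) s = periodic_piece P X p s + c * periodic_piece P X q s"
  by (simp add: periodic_piece_def sum.distrib sum_distrib_left)

text \<open>Over one period starting at the left end of a window that contains the interval, only the
  translates by \<open>0\<close> and by one period can meet it, the latter at the right end of the window
  only.\<close>

lemma periodic_piece_window:
  assumes "P > 0" "c \<le> a" "b \<le> c + 2 * P" "c \<le> s" "s < c + 2 * P"
  shows "periodic_piece P {a..b} p s
    = indicator {a..b} s * poly p (of_real s)
      + indicator {a..b} (s + 2 * P) * poly p (of_real (s + 2 * P))"
proof -
  have "n \<in> {0, 1}" if "s + 2 * P * real_of_int n \<in> {a..b}" for n
  proof -
    have "2 * P * real_of_int n < 2 * P * 2" "2 * P * (- 1) < 2 * P * real_of_int n"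
      using that assms unfolding atLeastAtMost_iff by linarith+
    then have "real_of_int n < 2" "- 1 < real_of_int n"
      using \<open>P > 0\<close> by (simp_all only: mult_less_cancel_left_pos)
    then show ?thesis by auto
  qed
  then have "periodic_piece P {a..b} p s
      = (\<Sum>n\<in>{0, 1}. if s + 2 * P * real_of_int n \<in> {a..b}
           then poly p (of_real (s + 2 * P * real_of_int n)) else 0)"
    unfolding periodic_piece_def by (subst sum.inter_filter[symmetric]) (auto intro!: sum.cong)
  then show ?thesis by (simp add: indicator_def)
qed

text \<open>A periodic piece is a bounded Borel function of the representative \<open>r s\<close> of \<open>s\<close> in the
  window.\<close>

lemma periodic_piece_bounded_measurable:
  assumes "P > 0" "c \<le> a" "b \<le> c + 2 * P"
  shows "periodic_piece P {a..b} p \<in> borel_measurable borel"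
    and "\<exists>C. \<forall>s. norm (periodic_piece P {a..b} p s) \<le> C"
proof -
  define r where "r = (\<lambda>s. s + 2 * P * real_of_int (- \<lfloor>(s - c) / (2 * P)\<rfloor>))"
  define F where "F = (\<lambda>s. indicator {a..b} s * poly p (of_real s)
      + indicator {a..b} (s + 2 * P) * poly p (of_real (s + 2 * P)))"
  have poly_cont: "continuous_on X (\<lambda>s::real. poly p (of_real s))" for X
    by (intro continuous_intros)
  have r: "c \<le> r s" "r s < c + 2 * P" for s
  proof -
    have P2: "0 < 2 * P" using \<open>P > 0\<close> by simp
    have "real_of_int \<lfloor>(s - c) / (2 * P)\<rfloor> * (2 * P) \<le> s - c"
      unfolding pos_le_divide_eq[OF P2, symmetric] by linarith
    moreover have "s - c < (real_of_int \<lfloor>(s - c) / (2 * P)\<rfloor> + 1) * (2 * P)"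
      unfolding pos_divide_less_eq[OF P2, symmetric] by linarith
    ultimately show "c \<le> r s" "r s < c + 2 * P"
      by (simp_all add: r_def algebra_simps)
  qed
  have eq: "periodic_piece P {a..b} p s = F (r s)" for s
  proof -
    have "periodic_piece P {a..b} p s = periodic_piece P {a..b} p (r s)"
      unfolding r_def
      by (rule periodic_int[symmetric, where f = "periodic_piece P {a..b} p",
          OF periodic_piece_periodic])
    then show ?thesis
      unfolding F_def using periodic_piece_window[OF assms r] by simp
  qed
  have [measurable]: "r \<in> borel_measurable borel"
    unfolding r_def by measurable
  have [measurable]: "(\<lambda>s. poly p (complex_of_real s)) \<in> borel_measurable borel"
    by (rule borel_measurable_continuous_onI[OF poly_cont])
  have [measurable]: "F \<in> borel_measurable borel"
    unfolding F_def by measurable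
  show "periodic_piece P {a..b} p \<in> borel_measurable borel"
    unfolding eq[abs_def] by measurable
  have "compact ((\<lambda>s. poly p (complex_of_real s)) ` {a..b})"
    by (intro compact_continuous_image poly_cont) simp
  then obtain M where M: "\<And>s. s \<in> {a..b} \<Longrightarrow> norm (poly p (complex_of_real s)) \<le> M"
    using compact_imp_bounded bounded_iff by (metis imageI)
  have "norm (indicator {a..b} s * poly p (complex_of_real s)) \<le> \<bar>M\<bar>" for s
    using M[of s] by (auto simp: indicator_def norm_mult)
  from this this have "norm (F s) \<le> \<bar>M\<bar> + \<bar>M\<bar>" for s
    unfolding F_def by (rule norm_triangle_le[OF add_mono])
  then show "\<exists>C. \<forall>s. norm (periodic_piece P {a..b} p s) \<le> C"
    unfolding eq by blast
qed

text \<open>The intervals may share end points. There the pieces add up, which is harmless as the end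
  points form a null set.\<close>

locale period_partition =
  fixes P c :: real and N :: nat and a b :: "nat \<Rightarrow> real"
  assumes P: "P > 0"
    and nonempty: "\<And>j. j \<in> {1..N} \<Longrightarrow> a j < b j"
    and window: "\<And>j. j \<in> {1..N} \<Longrightarrow> c \<le> a j" "\<And>j. j \<in> {1..N} \<Longrightarrow> b j \<le> c + 2 * P"
    and nonoverlap: "\<And>i j. \<lbrakk>i \<in> {1..N}; j \<in> {1..N}; i \<noteq> j\<rbrakk> \<Longrightarrow> b i \<le> a j \<or> b j \<le> a i"
    and cover: "\<And>s. c \<le> s \<Longrightarrow> s \<le> c + 2 * P \<Longrightarrow> \<exists>j\<in>{1..N}. a j \<le> s \<and> s \<le> b j"
begin

definition pieces :: "(nat \<Rightarrow> complex poly) \<Rightarrow> real \<Rightarrow> complex" where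
  "pieces p s = (\<Sum>j=1..N. periodic_piece P {a j..b j} (p j) s)"

lemma pieces_periodic: "pieces p (s + 2 * P) = pieces p s"
  by (simp add: pieces_def periodic_piece_periodic)

lemma pieces_measurable: "pieces p \<in> borel_measurable borel"
proof -
  have "(\<lambda>s. \<Sum>j=1..N. periodic_piece P {a j..b j} (p j) s) \<in> borel_measurable borel"
    by (intro borel_measurable_sum periodic_piece_bounded_measurable(1)[where c = c, OF P] window)
  then show ?thesis by (simp add: pieces_def[abs_def])
qed

lemma pieces_bounded: "\<exists>C. \<forall>s. norm (pieces p s) \<le> C"
proof -
  have "\<forall>j\<in>{1..N}. \<exists>C. \<forall>s. norm (periodic_piece P {a j..b j} (p j) s) \<le> C"
    using periodic_piece_bounded_measurable(2)[OF P] window by blast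
  from bchoice[OF this] obtain C where
    C: "\<forall>j\<in>{1..N}. \<forall>s. norm (periodic_piece P {a j..b j} (p j) s) \<le> C j" by blast
  have "norm (pieces p s) \<le> (\<Sum>j=1..N. C j)" for s
    unfolding pieces_def using C by (intro order_trans[OF norm_sum] sum_mono) blast
  then show ?thesis by blast
qed

lemma pieces_interior:
  assumes i: "i \<in> {1..N}" and s: "a i < s" "s < b i"
  shows "pieces p s = poly (p i) (of_real s)"
proof -
  have cs: "c < s" "s < c + 2 * P" using window[OF i] s by linarith+
  have piece: "periodic_piece P {a j..b j} (p j) s = (if j = i then poly (p i) (of_real s) else 0)"
    if j: "j \<in> {1..N}" for j
  proof -
    have "s + 2 * P \<notin> {a j..b j}" using window[OF j] cs by auto
    moreover have "s \<in> {a j..b j} \<longleftrightarrow> j = i"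
      using nonoverlap[OF j i] s by (cases "j = i") auto
    ultimately show ?thesis
      using periodic_piece_window[OF P window[OF j], of s "p j"] cs by auto
  qed
  have "pieces p s = (\<Sum>j\<in>{1..N}. if j = i then poly (p i) (of_real s) else 0)"
    unfolding pieces_def by (intro sum.cong refl piece)
  also have "\<dots> = poly (p i) (of_real s)"
    using i by (subst sum.delta) auto
  finally show ?thesis .
qed

text \<open>Besides the error estimate this gives definiteness, with \<open>f = 0\<close>.\<close>

lemma L2_norm_minus_pieces:
  assumes f: "continuous_on UNIV f" "\<And>s. f (s + 2 * P) = f s" and \<theta>: "\<And>s. norm (\<theta> s) = 1"
  shows "(L2_norm P (\<lambda>s. \<theta> s * (f s - pieces p s)))\<^sup>2
    = (\<Sum>j=1..N. integral {a j..b j} (\<lambda>s. (norm (f s - poly (p j) (of_real s)))\<^sup>2))"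
proof -
  define h where "h = (\<lambda>s. (norm (f s - pieces p s))\<^sup>2)"
  define hj where "hj = (\<lambda>j s. (norm (f s - poly (p j) (of_real s)))\<^sup>2)"
  have [measurable]: "f \<in> borel_measurable borel"
    by (rule borel_measurable_continuous_onI[OF f(1)])
  note [measurable] = pieces_measurable
  have hm [measurable]: "h \<in> borel_measurable borel"
    unfolding h_def by measurable
  have hj_cont: "continuous_on X (hj j)" for X j
    unfolding hj_def by (intro continuous_intros continuous_on_subset[OF f(1)]) auto
  have int: "set_integrable lborel {a j..b j} (hj j)" for j
    by (rule borel_integrable_atLeastAtMost'[OF hj_cont])
  have hj_m [measurable]: "hj j \<in> borel_measurable borel" for j
    by (rule borel_measurable_continuous_onI[OF hj_cont])
  obtain Cf where "\<And>s. norm (f s) \<le> Cf"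
    using continuous_periodic_bounded[of "2 * P" f] f P by auto
  moreover obtain Cp where "\<And>s. norm (pieces p s) \<le> Cp"
    using pieces_bounded by blast
  ultimately have "norm (f s - pieces p s) \<le> Cf + Cp" for s
    by (intro norm_triangle_le_diff add_mono)
  then have h_bd: "norm (h s) \<le> (Cf + Cp)\<^sup>2" for s
    by (simp add: h_def power_mono)
  have h_per: "h (s + 2 * P) = h s" for s
    by (simp add: h_def f(2) pieces_periodic)
  have "(L2_norm P (\<lambda>s. \<theta> s * (f s - pieces p s)))\<^sup>2 = set_lebesgue_integral lborel {0..2 * P} h"
    by (simp add: L2_norm_power2 norm_mult \<theta> h_def)
  also have "\<dots> = set_lebesgue_integral lborel {c..c + 2 * P} h"
    using set_integral_period_window[OF _ h_per hm h_bd, of c] P by simp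
  also have "\<dots> = (\<integral>s. (\<Sum>j=1..N. indicator {a j..b j} s *\<^sub>R hj j s) \<partial>lborel)"
    unfolding set_lebesgue_integral_def
  proof (rule integral_cong_AE)
    have "finite (a ` {1..N} \<union> b ` {1..N} \<union> {c + 2 * P})" by simp
    then have "AE s in lborel. s \<notin> a ` {1..N} \<union> b ` {1..N} \<union> {c + 2 * P}"
      by (intro AE_not_in finite_imp_null_set_lborel)
    then show "AE s in lborel. indicator {c..c + 2 * P} s *\<^sub>R h s
        = (\<Sum>j=1..N. indicator {a j..b j} s *\<^sub>R hj j s)"
    proof eventually_elim
      fix s assume s: "s \<notin> a ` {1..N} \<union> b ` {1..N} \<union> {c + 2 * P}"
      show "indicator {c..c + 2 * P} s *\<^sub>R h s = (\<Sum>j=1..N. indicator {a j..b j} s *\<^sub>R hj j s)"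
      proof (cases "s \<in> {c..c + 2 * P}")
        case True
        then obtain i where i: "i \<in> {1..N}" "a i \<le> s" "s \<le> b i" using cover[of s] by auto
        then have strict: "a i < s" "s < b i"
          using s by (auto simp: order.strict_iff_order)
        have "indicator {a j..b j} s *\<^sub>R hj j s = (if j = i then hj i s else 0)"
          if "j \<in> {1..N}" for j
          using nonoverlap[OF that i(1)] strict by (auto simp: indicator_def)
        then have "(\<Sum>j=1..N. indicator {a j..b j} s *\<^sub>R hj j s)
            = (\<Sum>j\<in>{1..N}. if j = i then hj i s else 0)"
          by (intro sum.cong) auto
        also have "\<dots> = hj i s" using i(1) by (subst sum.delta) auto
        finally show ?thesis
          using True pieces_interior[OF i(1) strict] by (simp add: h_def hj_def)
      next
        case False
        then have "indicator {a j..b j} s *\<^sub>R hj j s = 0" if "j \<in> {1..N}" for j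
          using window[OF that] by (auto simp: indicator_def)
        then have "(\<Sum>j=1..N. indicator {a j..b j} s *\<^sub>R hj j s) = 0"
          by (intro sum.neutral) blast
        with False show ?thesis by (simp add: indicator_def)
      qed
    qed
  qed measurable
  also have "\<dots> = (\<Sum>j=1..N. set_lebesgue_integral lborel {a j..b j} (hj j))"
    unfolding set_lebesgue_integral_def
    by (rule Bochner_Integration.integral_sum) (use int in \<open>simp add: set_integrable_def\<close>)
  also have "\<dots> = (\<Sum>j=1..N. integral {a j..b j} (hj j))"
    using set_borel_integral_eq_integral(2)[OF int] by simp
  finally show ?thesis by (simp add: hj_def)
qed

lemma weighted_pieces_in_L2:
  assumes "continuous_on UNIV \<theta>" "\<And>s. norm (\<theta> s) = 1" "\<And>s. \<theta> (s + 2 * P) = \<theta> s"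
  shows "(\<lambda>s. \<theta> s * pieces p s) \<in> L2 P"
proof -
  obtain C where "\<forall>s. norm (pieces p s) \<le> C" using pieces_bounded by blast
  moreover have [measurable]: "\<theta> \<in> borel_measurable borel"
    by (rule borel_measurable_continuous_onI[OF assms(1)])
  note [measurable] = pieces_measurable
  ultimately show ?thesis
    by (intro bounded_periodic_in_L2[of _ C])
       (auto simp: norm_mult assms(2,3) pieces_periodic)
qed

text \<open>On each interval the integral of the squared modulus of the polynomial vanishes; the
  interval is nondegenerate, so the polynomial has infinitely many roots and is zero. The
  function then vanishes everywhere, even at the end points of the intervals.\<close>

lemma weighted_pieces_eq_zero:
  assumes \<theta>: "\<And>s. norm (\<theta> s) = 1"
    and "L2_norm P (\<lambda>s. \<theta> s * pieces p s) = 0"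
  shows "(\<lambda>s. \<theta> s * pieces p s) = (\<lambda>_. 0)"
proof -
  have "L2_norm P (\<lambda>s. \<theta> s * (0 - pieces p s)) = L2_norm P (\<lambda>s. \<theta> s * pieces p s)"
    by (simp add: L2_norm_def)
  with L2_norm_minus_pieces[of "\<lambda>_. 0" \<theta> p, OF _ _ \<theta>] assms(2)
  have sum0: "(\<Sum>j=1..N. integral {a j..b j} (\<lambda>s. (norm (poly (p j) (complex_of_real s)))\<^sup>2)) = 0"
    by simp
  have cont: "continuous_on X (\<lambda>s. (norm (poly (p j) (complex_of_real s)))\<^sup>2)" for X j
    by (intro continuous_intros)
  have zero: "p j = 0" if j: "j \<in> {1..N}" for j
  proof -
    have "integral {a j..b j} (\<lambda>s. (norm (poly (p j) (complex_of_real s)))\<^sup>2) = 0"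
      using sum0 j by (subst (asm) sum_nonneg_eq_0_iff)
        (auto intro!: integral_nonneg integrable_continuous_interval cont)
    then have "((\<lambda>s. (norm (poly (p j) (complex_of_real s)))\<^sup>2) has_integral 0) (cbox (a j) (b j))"
      using integrable_integral[OF integrable_continuous_interval[OF cont]] by simp metis
    then have "(norm (poly (p j) (complex_of_real s)))\<^sup>2 = 0" if "s \<in> cbox (a j) (b j)" for s
      using has_integral_0_cbox_imp_0[OF cont _ _ _ that] nonempty[OF j] by auto
    then have "complex_of_real ` {a j..b j} \<subseteq> {z. poly (p j) z = 0}" by auto
    moreover have "infinite (complex_of_real ` {a j..b j})"
      using nonempty[OF j] by (subst finite_image_iff) (auto simp: inj_on_def infinite_Icc)
    ultimately have "infinite {z. poly (p j) z = 0}" using infinite_super by blast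
    then show ?thesis using poly_roots_finite by blast
  qed
  have "pieces p s = 0" for s
    unfolding pieces_def using zero by (intro sum.neutral) (auto simp: periodic_piece_def)
  then show ?thesis by simp
qed

lemma finitely_spanned_piece:
  "finitely_spanned {\<lambda>s. \<theta> s * periodic_piece P X p s | p. degree p \<le> d}"
proof -
  let ?U = "\<lambda>N. {\<lambda>s. \<theta> s * periodic_piece P X p s | p. \<forall>i\<ge>N. coeff p i = 0}"
  have "finitely_spanned (?U N)" for N
  proof (induction N)
    case 0
    have "(\<forall>i\<ge>0. coeff p i = 0) \<longleftrightarrow> p = 0" for p :: "complex poly"
      by (auto simp: poly_eq_iff)
    then have "?U 0 = {\<lambda>_. 0}"
      by (simp only:) (auto simp: periodic_piece_def)
    then show ?case using finitely_spanned.zero by simp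
  next
    case (Suc N)
    let ?q = "monom 1 N :: complex poly"
    let ?v = "\<lambda>s. \<theta> s * periodic_piece P X ?q s"
    have combination: "(\<lambda>s. \<theta> s * periodic_piece P X (p + smult c ?q) s)
        = (\<lambda>s. \<theta> s * periodic_piece P X p s + c * ?v s)" for p c
      by (simp only: periodic_piece_combination) (simp add: algebra_simps)
    have "?U (Suc N) = {\<lambda>s. f s + c * ?v s | f c. f \<in> ?U N}" (is "_ = ?R")
    proof
      show "?U (Suc N) \<subseteq> ?R"
      proof
        fix x assume "x \<in> ?U (Suc N)"
        then obtain p where x: "x = (\<lambda>s. \<theta> s * periodic_piece P X p s)"
          and p: "\<forall>i\<ge>Suc N. coeff p i = 0" by blast
        define p' where "p' = p - smult (coeff p N) ?q"
        have "coeff p' i = 0" if "i \<ge> N" for i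
          using p that by (cases "i = N") (auto simp: p'_def)
        then have "(\<lambda>s. \<theta> s * periodic_piece P X p' s) \<in> ?U N" by blast
        moreover have "x = (\<lambda>s. \<theta> s * periodic_piece P X p' s + coeff p N * ?v s)"
          unfolding combination[symmetric] x by (simp add: p'_def)
        ultimately show "x \<in> ?R"
          by - (rule CollectI, rule exI[of _ "\<lambda>s. \<theta> s * periodic_piece P X p' s"],
                rule exI[of _ "coeff p N"], rule conjI)
      qed
      show "?R \<subseteq> ?U (Suc N)"
      proof
        fix x assume "x \<in> ?R"
        then obtain p c where "x = (\<lambda>s. \<theta> s * periodic_piece P X p s + c * ?v s)"
          and p: "\<forall>i\<ge>N. coeff p i = 0" by blast
        then have "x = (\<lambda>s. \<theta> s * periodic_piece P X (p + smult c ?q) s)"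
          by (simp only: combination)
        moreover have "\<forall>i\<ge>Suc N. coeff (p + smult c ?q) i = 0"
          using p by auto
        ultimately show "x \<in> ?U (Suc N)" by blast
      qed
    qed
    then show ?case using finitely_spanned.extend[OF Suc.IH] by (simp only:)
  qed
  moreover have "degree p \<le> d \<longleftrightarrow> (\<forall>i\<ge>Suc d. coeff p i = 0)" for p :: "complex poly"
    by (auto intro: degree_le simp: coeff_eq_0)
  ultimately show ?thesis by (simp only:)
qed

lemma finitely_spanned_pieces:
  fixes M :: nat
  shows
  "finitely_spanned {\<lambda>s. \<theta> s * (\<Sum>j=1..M. periodic_piece P (X j) (p j) s) | p.
     \<forall>j\<in>{1..M}. degree (p j) \<le> d j}"
proof (induction M)
  case 0
  then show ?case using finitely_spanned.zero by simp
next
  case (Suc M)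
  let ?V = "{\<lambda>s. \<theta> s * (\<Sum>j=1..M. periodic_piece P (X j) (p j) s) | p. \<forall>j\<in>{1..M}. degree (p j)
      \<le> d j}"
  let ?U = "{\<lambda>s. \<theta> s * periodic_piece P (X (Suc M)) p s | p. degree p \<le> d (Suc M)}"
  have "{\<lambda>s. \<theta> s * (\<Sum>j=1..Suc M. periodic_piece P (X j) (p j) s) | p. \<forall>j\<in>{1..Suc M}. degree (p j)
      \<le> d j}
     = {\<lambda>s. f s + g s | f g. f \<in> ?V \<and> g \<in> ?U}" (is "?L = ?R")
  proof
    show "?L \<subseteq> ?R"
    proof
      fix x assume "x \<in> ?L"
      then obtain p where p: "x = (\<lambda>s. \<theta> s * (\<Sum>j=1..Suc M. periodic_piece P (X j) (p j) s))"
        "\<forall>j\<in>{1..Suc M}. degree (p j) \<le> d j" by blast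
      then have "x = (\<lambda>s. \<theta> s * (\<Sum>j=1..M. periodic_piece P (X j) (p j) s)
          + \<theta> s * periodic_piece P (X (Suc M)) (p (Suc M)) s)"
        by (simp add: distrib_left)
      then show "x \<in> ?R" using p(2) by fastforce
    qed
    show "?R \<subseteq> ?L"
    proof
      fix x assume "x \<in> ?R"
      then obtain p q where p: "x = (\<lambda>s. \<theta> s * (\<Sum>j=1..M. periodic_piece P (X j) (p j) s)
          + \<theta> s * periodic_piece P (X (Suc M)) q s)"
        "\<forall>j\<in>{1..M}. degree (p j) \<le> d j" "degree q \<le> d (Suc M)" by blast
      define p' where "p' = p(Suc M := q)"
      have "(\<Sum>j=1..M. periodic_piece P (X j) (p' j) s) = (\<Sum>j=1..M. periodic_piece P (X j) (p j) s)"
          for s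
        by (intro sum.cong) (auto simp: p'_def)
      then have "x = (\<lambda>s. \<theta> s * (\<Sum>j=1..Suc M. periodic_piece P (X j) (p' j) s))"
        using p(1) by (simp add: distrib_left) (simp add: p'_def)
      moreover have "\<forall>j\<in>{1..Suc M}. degree (p' j) \<le> d j"
        using p(2,3) by (auto simp: p'_def)
      ultimately show "x \<in> ?L" by blast
    qed
  qed
  then show ?case using finitely_spanned_sum[OF finitely_spanned_piece Suc.IH] by (simp only:)
qed

end

section \<open>Geometry of the regions\<close>

text \<open>The powers \<open>k\<^bsup>-1/3 + \<epsilon>\<^sub>i\<^esup>\<close> are replaced by arbitrary widths \<open>w i\<close>: for the geometry it
  only matters that they are positive, at most one and strictly decreasing.\<close>

definition region_ends ::
    "real \<Rightarrow> real \<Rightarrow> real \<Rightarrow> nat \<Rightarrow> real \<Rightarrow> real \<Rightarrow> real \<Rightarrow> real \<Rightarrow> (nat \<Rightarrow> real) \<Rightarrow> nat \<Rightarrow> real \<times> real" where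
  "region_ends P t1 t2 m \<xi>1 \<xi>2 \<zeta>1 \<zeta>2 w j =
     (if j = m then (t1 + \<xi>1 * w 1, t2 - \<xi>2 * w 1)
      else if j = 2 * m then (t2 + \<zeta>2 * w 1, 2 * P + t1 - \<zeta>1 * w 1)
      else if j = 3 * m then (t1 - \<zeta>1 * w m, t1 + \<xi>1 * w m)
      else if j = 4 * m then (t2 - \<xi>2 * w m, t2 + \<zeta>2 * w m)
      else if j < m then (t1 + \<xi>1 * w (j + 1), t1 + \<xi>1 * w j)
      else if j < 2 * m then (t2 - \<xi>2 * w (j - m), t2 - \<xi>2 * w (j - m + 1))
      else if j < 3 * m then (t1 - \<zeta>1 * w (j - 2 * m), t1 - \<zeta>1 * w (j - 2 * m + 1))
      else (t2 + \<zeta>2 * w (j - 3 * m + 1), t2 + \<zeta>2 * w (j - 3 * m)))"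

lemma region_eq_ends:
  "region P t1 t2 m \<epsilon> \<xi>1 \<xi>2 \<zeta>1 \<zeta>2 k j =
    {fst (region_ends P t1 t2 m \<xi>1 \<xi>2 \<zeta>1 \<zeta>2 (\<lambda>i. k powr (- (1 / 3) + \<epsilon> i)) j)
     ..snd (region_ends P t1 t2 m \<xi>1 \<xi>2 \<zeta>1 \<zeta>2 (\<lambda>i. k powr (- (1 / 3) + \<epsilon> i)) j)}"
  by (simp add: region_def region_ends_def Let_def)

lemma region_ends_simps:
  assumes "m \<ge> 1"
  shows "region_ends P t1 t2 m \<xi>1 \<xi>2 \<zeta>1 \<zeta>2 w m = (t1 + \<xi>1 * w 1, t2 - \<xi>2 * w 1)"
    "region_ends P t1 t2 m \<xi>1 \<xi>2 \<zeta>1 \<zeta>2 w (2 * m) = (t2 + \<zeta>2 * w 1, 2 * P + t1 - \<zeta>1 * w 1)"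
    "region_ends P t1 t2 m \<xi>1 \<xi>2 \<zeta>1 \<zeta>2 w (3 * m) = (t1 - \<zeta>1 * w m, t1 + \<xi>1 * w m)"
    "region_ends P t1 t2 m \<xi>1 \<xi>2 \<zeta>1 \<zeta>2 w (4 * m) = (t2 - \<xi>2 * w m, t2 + \<zeta>2 * w m)"
    "1 \<le> i \<Longrightarrow> i < m \<Longrightarrow> region_ends P t1 t2 m \<xi>1 \<xi>2 \<zeta>1 \<zeta>2 w i = (t1 + \<xi>1 * w (i + 1), t1 + \<xi>1 * w i)"
    "1 \<le> i \<Longrightarrow> i < m \<Longrightarrow> region_ends P t1 t2 m \<xi>1 \<xi>2 \<zeta>1 \<zeta>2 w (m + i) = (t2 - \<xi>2 * w i, t2 - \<xi>2 * w
        (i + 1))"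
    "1 \<le> i \<Longrightarrow> i < m \<Longrightarrow> region_ends P t1 t2 m \<xi>1 \<xi>2 \<zeta>1 \<zeta>2 w (2 * m + i) = (t1 - \<zeta>1 * w i, t1 - \<zeta>1 * w
        (i + 1))"
    "1 \<le> i \<Longrightarrow> i < m \<Longrightarrow> region_ends P t1 t2 m \<xi>1 \<xi>2 \<zeta>1 \<zeta>2 w (3 * m + i) = (t2 + \<zeta>2 * w (i + 1),
        t2 + \<zeta>2 * w i)"
  using assms by (auto simp: region_ends_def)

text \<open>The eight kinds of regions: four single ones and four families of transition regions.\<close>

lemma region_index_cases:
  fixes j m :: nat
  assumes "j \<in> {1..4 * m}"
  obtains "j = m" | "j = 2 * m" | "j = 3 * m" | "j = 4 * m"
    | i where "1 \<le> i" "i < m" "j = i"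
    | i where "1 \<le> i" "i < m" "j = m + i"
    | i where "1 \<le> i" "i < m" "j = 2 * m + i"
    | i where "1 \<le> i" "i < m" "j = 3 * m + i"
proof -
  consider "j = m" | "j = 2 * m" | "j = 3 * m" | "j = 4 * m"
    | "j < m" | "m < j" "j < 2 * m" | "2 * m < j" "j < 3 * m" | "3 * m < j" "j < 4 * m"
    using assms by fastforce
  then show thesis
  proof cases
    case 5
    then show ?thesis using assms that(5)[of j] by auto
  next
    case 6
    then show ?thesis using that(6)[of "j - m"] by auto
  next
    case 7
    then show ?thesis using that(7)[of "j - 2 * m"] by auto
  next
    case 8
    then show ?thesis using that(8)[of "j - 3 * m"] by auto
  qed (use that in auto)
qed

lemma chain_cover:
  fixes y :: "nat \<Rightarrow> real"
  assumes "m \<ge> 1" "y m \<le> s" "s \<le> y 1"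
  shows "s = y m \<or> (\<exists>i. 1 \<le> i \<and> i < m \<and> y (i + 1) \<le> s \<and> s \<le> y i)"
  using assms
proof (induction m rule: nat_induct_at_least)
  case (Suc m)
  show ?case
  proof (cases "s \<le> y m")
    case True
    then show ?thesis using Suc by auto
  next
    case False
    then show ?thesis using Suc by force
  qed
qed simp

locale region_geometry =
  fixes P t1 t2 :: real and m :: nat and \<xi>1 \<xi>2 \<zeta>1 \<zeta>2 :: real and w :: "nat \<Rightarrow> real"
  assumes P: "P > 0" and m: "m \<ge> 1"
    and pos: "0 < \<xi>1" "0 < \<xi>2" "0 < \<zeta>1" "0 < \<zeta>2"
    and gap: "t1 + \<xi>1 < t2 - \<xi>2" "t2 + \<zeta>2 < 2 * P + t1 - \<zeta>1"
    and w_pos: "0 < w m" and w_le: "w 1 \<le> 1"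
    and w_less: "\<And>i. 1 \<le> i \<Longrightarrow> i < m \<Longrightarrow> w (i + 1) < w i"
begin

abbreviation ends where "ends \<equiv> region_ends P t1 t2 m \<xi>1 \<xi>2 \<zeta>1 \<zeta>2 w"

lemma w_antimono:
  assumes "1 \<le> i" "i \<le> j" "j \<le> m"
  shows "w j \<le> w i"
  using assms(2,1,3)
proof (induction j rule: dec_induct)
  case (step j)
  then show ?case using w_less[of j] by simp
qed simp

text \<open>The weakly increasing cuts separate the eight kinds of regions from left to right.\<close>

definition cut :: "nat \<Rightarrow> real" where
  "cut z = [t1 - \<zeta>1 * w 1, t1 - \<zeta>1 * w m, t1 + \<xi>1 * w m, t1 + \<xi>1 * w 1, t2 - \<xi>2 * w 1,
     t2 - \<xi>2 * w m, t2 + \<zeta>2 * w m, t2 + \<zeta>2 * w 1, 2 * P + t1 - \<zeta>1 * w 1] ! z"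

lemma cut_simps:
  "cut 0 = t1 - \<zeta>1 * w 1" "cut (Suc 0) = t1 - \<zeta>1 * w m" "cut 2 = t1 + \<xi>1 * w m"
  "cut 3 = t1 + \<xi>1 * w 1"
  "cut 4 = t2 - \<xi>2 * w 1" "cut 5 = t2 - \<xi>2 * w m" "cut 6 = t2 + \<zeta>2 * w m" "cut 7 = t2 + \<zeta>2 * w 1"
  "cut 8 = 2 * P + t1 - \<zeta>1 * w 1" "cut (Suc (Suc 0)) = t1 + \<xi>1 * w m"
  by (simp_all add: cut_def eval_nat_numeral)

lemma scaled:
  assumes "0 < \<kappa>"
  shows "0 < \<kappa> * w m" "\<kappa> * w m \<le> \<kappa> * w 1" "\<kappa> * w 1 \<le> \<kappa>"
    "1 \<le> i \<Longrightarrow> i < m \<Longrightarrow> \<kappa> * w m \<le> \<kappa> * w (i + 1)"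
    "1 \<le> i \<Longrightarrow> i < m \<Longrightarrow> \<kappa> * w (i + 1) < \<kappa> * w i"
    "1 \<le> i \<Longrightarrow> i < m \<Longrightarrow> \<kappa> * w i \<le> \<kappa> * w 1"
  using assms w_pos w_antimono[of 1 m] w_le m w_antimono[of "i + 1"
      m] w_antimono[of 1 i] w_less[of i]
  by (auto simp: mult_le_cancel_left1)

lemma cut_steps:
  "cut 0 \<le> cut (Suc 0)" "cut (Suc 0) < cut 2" "cut 2 \<le> cut 3" "cut 3 < cut 4" "cut 4 \<le> cut 5"
      "cut 5 < cut 6"
  "cut 6 \<le> cut 7" "cut 7 < cut 8"
  unfolding cut_simps
  using scaled(1-3)[OF pos(1)] scaled(1-3)[OF pos(2)] scaled(1-3)[OF pos(3)] scaled(1-3)[OF pos(4)]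
      gap
  by linarith+

lemma cut_mono:
  assumes "z \<le> z'" "z' \<le> 8"
  shows "cut z \<le> cut z'"
  using assms
proof (induction z' rule: dec_induct)
  case (step z')
  then have "z' \<in> {0, 1, 2, 3, 4, 5, 6, 7}" by auto
  then have "cut z' \<le> cut (Suc z')"
    using cut_steps by (auto simp: cut_simps)
  then show ?case using step by simp
qed simp

text \<open>The rank of the kind of region \<open>j\<close>, counted from the left. Regions in different zones are
  separated by a cut; a zone contains a single region or the transition regions of one family,
  which are ordered by their widths.\<close>

definition zone :: "nat \<Rightarrow> nat" where
  "zone j =
    (if j = m then 3 else if j = 2 * m then 7 else if j = 3 * m then 1 else if j = 4 * m then 5
     else if j < m then 2 else if j < 2 * m then 4 else if j < 3 * m then 0 else 6)"

lemma region_in_zone: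
  assumes "j \<in> {1..4 * m}"
  shows "zone j < 8 \<and> cut (zone j) \<le> fst (ends j) \<and> fst (ends j) < snd (ends j)
    \<and> snd (ends j) \<le> cut (zone j + 1)"
  using assms
proof (cases rule: region_index_cases)
  case 1
  then show ?thesis using m cut_steps(4) by (simp add: zone_def region_ends_simps cut_simps)
next
  case 2
  then show ?thesis using m cut_steps(8) by (simp add: zone_def region_ends_simps cut_simps)
next
  case 3
  then show ?thesis using m cut_steps(2) by (simp add: zone_def region_ends_simps cut_simps)
next
  case 4
  then show ?thesis using m cut_steps(6) by (simp add: zone_def region_ends_simps cut_simps)
next
  case (5 i)
  then show ?thesis using m scaled(4-6)[OF pos(1) 5(1,2)]
    by (simp add: zone_def region_ends_simps cut_simps)
next
  case (6 i)
  then show ?thesis using m scaled(4-6)[OF pos(2) 6(1,2)]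
    by (simp add: zone_def region_ends_simps cut_simps)
next
  case (7 i)
  then show ?thesis using m scaled(4-6)[OF pos(3) 7(1,2)]
    by (simp add: zone_def region_ends_simps cut_simps)
next
  case (8 i)
  then show ?thesis using m scaled(4-6)[OF pos(4) 8(1,2)]
    by (simp add: zone_def region_ends_simps cut_simps)
qed

lemma same_zone_nonoverlap:
  assumes i: "i \<in> {1..4 * m}" and j: "j \<in> {1..4 * m}" and zone: "zone i = zone j" and ij: "i < j"
  shows "snd (ends i) \<le> fst (ends j) \<or> snd (ends j) \<le> fst (ends i)"
proof -
  have step: "\<kappa> * w j' \<le> \<kappa> * w (i' + 1)" if "1 \<le> i'" "i' < j'" "j' < m" "0 < \<kappa>" for \<kappa> i' j'
    using that w_antimono[of "i' + 1" j'] by simp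
  show ?thesis
    using i
  proof (cases rule: region_index_cases)
    case (5 i')
    then have "j < m" using zone m j by (auto simp: zone_def split: if_splits)
    then show ?thesis using 5 ij step[of i' j \<xi>1] pos m by (simp add: region_ends_simps)
  next
    case (6 i')
    then have "j < 2 * m" using zone m j by (auto simp: zone_def split: if_splits)
    then have "j = m + (j - m)" "j - m < m" "i' < j - m" using 6 ij by auto
    then show ?thesis using 6 step[of i' "j - m" \<xi>2] pos m region_ends_simps(6)[OF m, of "j - m"]
      by (simp add: region_ends_simps)
  next
    case (7 i')
    then have "j < 3 * m" using zone m j by (auto simp: zone_def split: if_splits)
    then have "j = 2 * m + (j - 2 * m)" "j - 2 * m < m" "i' < j - 2 * m" using 7 ij by auto
    then show ?thesis using 7 step[of i' "j - 2 * m" \<zeta>1] pos m region_ends_simps(7)[OF m,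
        of "j - 2 * m"] by (simp add: region_ends_simps)
  next
    case (8 i')
    then have "j < 4 * m" using zone m j by (auto simp: zone_def split: if_splits)
    then have "j = 3 * m + (j - 3 * m)" "j - 3 * m < m" "i' < j - 3 * m" using 8 ij by auto
    then show ?thesis using 8 step[of i' "j - 3 * m" \<zeta>2] pos m region_ends_simps(8)[OF m,
        of "j - 3 * m"] by (simp add: region_ends_simps)
  qed (use zone ij m j in \<open>auto simp: zone_def split: if_splits\<close>)
qed

lemma zone_cover:
  assumes "cut 0 \<le> s" "s \<le> cut 8"
  shows "\<exists>j\<in>{1..4 * m}. fst (ends j) \<le> s \<and> s \<le> snd (ends j)"
proof -
  have single: ?thesis if "j \<in> {m, 2 * m, 3 * m, 4 * m}" "fst (ends j) \<le> s" "s \<le> snd (ends j)" for j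
    using that m by auto
  consider "cut 0 \<le> s" "s \<le> cut (Suc 0)" | "cut (Suc 0) \<le> s" "s \<le> cut 2" | "cut 2 \<le> s" "s \<le> cut 3"
    | "cut 3 \<le> s" "s \<le> cut 4" | "cut 4 \<le> s" "s \<le> cut 5" | "cut 5 \<le> s" "s \<le> cut 6"
    | "cut 6 \<le> s" "s \<le> cut 7" | "cut 7 \<le> s" "s \<le> cut 8"
    using assms by linarith
  then show ?thesis
  proof cases
    case 1
    then have "- s = - t1 + \<zeta>1 * w m \<or>
        (\<exists>i. 1 \<le> i \<and> i < m \<and> - t1 + \<zeta>1 * w (i + 1) \<le> - s \<and> - s \<le> - t1 + \<zeta>1 * w i)"
      by (intro chain_cover[OF m]) (simp_all add: cut_simps)
    then show ?thesis
    proof (elim disjE exE conjE)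
      assume "- s = - t1 + \<zeta>1 * w m"
      then show ?thesis using single[of "3 * m"] cut_steps(2) m
          by (simp add: cut_simps region_ends_simps)
    next
      fix i assume "1 \<le> i" "i < m" "- t1 + \<zeta>1 * w (i + 1) \<le> - s" "- s \<le> - t1 + \<zeta>1 * w i"
      then show ?thesis using m by (intro bexI[of _ "2 * m + i"]) (auto simp: region_ends_simps)
    qed
  next
    case 2
    then show ?thesis using single[of "3 * m"] m by (simp add: cut_simps region_ends_simps)
  next
    case 3
    then have "s = t1 + \<xi>1 * w m \<or>
        (\<exists>i. 1 \<le> i \<and> i < m \<and> t1 + \<xi>1 * w (i + 1) \<le> s \<and> s \<le> t1 + \<xi>1 * w i)"
      by (intro chain_cover[OF m]) (simp_all add: cut_simps)
    then show ?thesis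
    proof (elim disjE exE conjE)
      assume "s = t1 + \<xi>1 * w m"
      then show ?thesis using single[of "3 * m"] cut_steps(2) m
          by (simp add: cut_simps region_ends_simps)
    next
      fix i assume "1 \<le> i" "i < m" "t1 + \<xi>1 * w (i + 1) \<le> s" "s \<le> t1 + \<xi>1 * w i"
      then show ?thesis using m by (intro bexI[of _ "i"]) (auto simp: region_ends_simps)
    qed
  next
    case 4
    then show ?thesis using single[of m] m by (simp add: cut_simps region_ends_simps)
  next
    case 5
    then have "- s = - t2 + \<xi>2 * w m \<or>
        (\<exists>i. 1 \<le> i \<and> i < m \<and> - t2 + \<xi>2 * w (i + 1) \<le> - s \<and> - s \<le> - t2 + \<xi>2 * w i)"
      by (intro chain_cover[OF m]) (simp_all add: cut_simps)
    then show ?thesis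
    proof (elim disjE exE conjE)
      assume "- s = - t2 + \<xi>2 * w m"
      then show ?thesis using single[of "4 * m"] cut_steps(6) m
          by (simp add: cut_simps region_ends_simps)
    next
      fix i assume "1 \<le> i" "i < m" "- t2 + \<xi>2 * w (i + 1) \<le> - s" "- s \<le> - t2 + \<xi>2 * w i"
      then show ?thesis using m by (intro bexI[of _ "m + i"]) (auto simp: region_ends_simps)
    qed
  next
    case 6
    then show ?thesis using single[of "4 * m"] m by (simp add: cut_simps region_ends_simps)
  next
    case 7
    then have "s = t2 + \<zeta>2 * w m \<or>
        (\<exists>i. 1 \<le> i \<and> i < m \<and> t2 + \<zeta>2 * w (i + 1) \<le> s \<and> s \<le> t2 + \<zeta>2 * w i)"
      by (intro chain_cover[OF m]) (simp_all add: cut_simps)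
    then show ?thesis
    proof (elim disjE exE conjE)
      assume "s = t2 + \<zeta>2 * w m"
      then show ?thesis using single[of "4 * m"] cut_steps(6) m
          by (simp add: cut_simps region_ends_simps)
    next
      fix i assume "1 \<le> i" "i < m" "t2 + \<zeta>2 * w (i + 1) \<le> s" "s \<le> t2 + \<zeta>2 * w i"
      then show ?thesis using m by (intro bexI[of _ "3 * m + i"]) (auto simp: region_ends_simps)
    qed
  next
    case 8
    then show ?thesis using single[of "2 * m"] m by (simp add: cut_simps region_ends_simps)
  qed
qed

lemma regions_period_partition:
  "period_partition P (t1 - \<zeta>1 * w 1) (4 * m) (\<lambda>j. fst (ends j)) (\<lambda>j. snd (ends j))"
proof
  show "P > 0" by (rule P)
  have cut08: "cut 0 = t1 - \<zeta>1 * w 1" "cut 8 = t1 - \<zeta>1 * w 1 + 2 * P" by (simp_all add: cut_simps)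
  fix j assume j: "j \<in> {1..4 * m}"
  note zj = region_in_zone[OF j]
  show "fst (ends j) < snd (ends j)" using zj by simp
  show "t1 - \<zeta>1 * w 1 \<le> fst (ends j)"
    unfolding cut08(1)[symmetric] using zj cut_mono[of 0 "zone j"] by simp
  show "snd (ends j) \<le> t1 - \<zeta>1 * w 1 + 2 * P"
    unfolding cut08(2)[symmetric] using zj cut_mono[of "zone j + 1" 8] by simp
  fix i assume i: "i \<in> {1..4 * m}" and "i \<noteq> j"
  note zi = region_in_zone[OF i]
  consider "zone i < zone j" | "zone j < zone i" | "zone i = zone j" "i < j" | "zone j = zone i"
      "j < i"
    using \<open>i \<noteq> j\<close> by linarith
  then show "snd (ends i) \<le> fst (ends j) \<or> snd (ends j) \<le> fst (ends i)"
  proof cases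
    case 1
    then show ?thesis using cut_mono[of "zone i + 1" "zone j"] zi zj by auto
  next
    case 2
    then show ?thesis using cut_mono[of "zone j + 1" "zone i"] zi zj by auto
  next
    case 3
    then show ?thesis by (rule same_zone_nonoverlap[OF i j])
  next
    case 4
    then show ?thesis using same_zone_nonoverlap[OF j i] by auto
  qed
next
  fix s assume "t1 - \<zeta>1 * w 1 \<le> s" "s \<le> t1 - \<zeta>1 * w 1 + 2 * P"
  then show "\<exists>j\<in>{1..4 * m}. fst (ends j) \<le> s \<and> s \<le> snd (ends j)"
    by (intro zone_cover) (simp_all add: cut_simps)
qed

end

section \<open>The rates on the individual regions\<close>

lemma epsilon_decreasing:
  fixes \<epsilon> :: "nat \<Rightarrow> real"
  assumes "region_parameters P t1 t2 m \<epsilon> \<xi>1 \<xi>2 \<zeta>1 \<zeta>2" "1 \<le> i" "i \<le> j" "j \<le> m"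
  shows "\<epsilon> j \<le> \<epsilon> i"
  using assms(3,2,4)
proof (induction j rule: dec_induct)
  case (step j)
  then have "\<epsilon> (j + 1) < \<epsilon> j" using assms(1) by (simp add: region_parameters_def)
  then show ?case using step by simp
qed simp

lemma region_geometry_of_parameters:
  assumes rp: "region_parameters P t1 t2 m \<epsilon> \<xi>1 \<xi>2 \<zeta>1 \<zeta>2" and "P > 0" "m \<ge> 1" "k > 1"
  shows "region_geometry P t1 t2 m \<xi>1 \<xi>2 \<zeta>1 \<zeta>2 (\<lambda>i. k powr (- (1 / 3) + \<epsilon> i))"
proof
  have "k powr (- (1 / 3) + \<epsilon> 1) \<le> k powr 0"
    using rp \<open>k > 1\<close> by (intro powr_mono) (auto simp: region_parameters_def)
  then show "k powr (- (1 / 3) + \<epsilon> 1) \<le> 1" using \<open>k > 1\<close> by simp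
qed (use assms in \<open>auto simp: region_parameters_def\<close>)

lemma E_factor_simps:
  assumes "m \<ge> 1"
  shows "j \<in> {m, 2 * m} \<Longrightarrow> E_factor m \<epsilon> n k j =
       (if n j = 1 then sqrt (ln k) else 0)
        + (if n j \<ge> 2 then k powr (- (1 - 3 * \<epsilon> 1) / 6) * (k powr ((1 - 3 * \<epsilon> 1) / 6))
            ^ n j else 0)"
    "j \<in> {3 * m, 4 * m} \<Longrightarrow> E_factor m \<epsilon> n k j = k powr (- (1 / 6)) * (k powr \<epsilon> m) ^ n j"
    "1 \<le> i \<Longrightarrow> i < m \<Longrightarrow> j \<in> {i, m + i, 2 * m + i, 3 * m + i} \<Longrightarrow> E_factor m \<epsilon> n k j =
       k powr (- (1 - 3 * \<epsilon> (i + 1)) / 6) * (k powr ((\<epsilon> i - \<epsilon> (i + 1)) / 2)) ^ n j"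
proof -
  show "j \<in> {m, 2 * m} \<Longrightarrow> E_factor m \<epsilon> n k j =
       (if n j = 1 then sqrt (ln k) else 0)
        + (if n j \<ge> 2 then k powr (- (1 - 3 * \<epsilon> 1) / 6) * (k powr ((1 - 3 * \<epsilon> 1) / 6))
            ^ n j else 0)"
    unfolding E_factor_def by (subst if_P) auto
  show "j \<in> {3 * m, 4 * m} \<Longrightarrow> E_factor m \<epsilon> n k j = k powr (- (1 / 6)) * (k powr \<epsilon> m) ^ n j"
    unfolding E_factor_def using assms by (subst if_not_P, force, subst if_P) auto
  assume i: "1 \<le> i" "i < m" and j: "j \<in> {i, m + i, 2 * m + i, 3 * m + i}"
  have "\<not> (j = m \<or> j = 2 * m)" "\<not> (j = 3 * m \<or> j = 4 * m)" "j mod m = i"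
    using i j by auto
  then show "E_factor m \<epsilon> n k j =
       k powr (- (1 - 3 * \<epsilon> (i + 1)) / 6) * (k powr ((\<epsilon> i - \<epsilon> (i + 1)) / 2)) ^ n j"
    unfolding E_factor_def Let_def by (simp only: if_False)
qed

lemma E_factor_nonneg: "k \<ge> 1 \<Longrightarrow> 0 \<le> E_factor m \<epsilon> n k j"
  by (simp add: E_factor_def Let_def)

text \<open>For \<open>n j = 0\<close> the integral is the length of the region. Otherwise a region lies on one
  side of a zero (transition), between two zeros (illuminated and shadow), or around a zero
  (shadow boundary), and in each case the bound for the integral is compared with \<open>E_factor\<close>.\<close>

lemma region_weighted_integral_rate:
  assumes rp: "region_parameters P t1 t2 m \<epsilon> \<xi>1 \<xi>2 \<zeta>1 \<zeta>2" and P: "P > 0" and m: "m \<ge> 1"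
    and Z: "continuous_on UNIV Z" and c: "c > 0"
    and lit: "\<And>s. s \<in> {t1..t2} \<Longrightarrow> c * (s - t1) * (t2 - s) \<le> \<bar>Z s\<bar>"
    and dark: "\<And>s. s \<in> {t2..2 * P + t1} \<Longrightarrow> c * (s - t2) * (2 * P + t1 - s) \<le> \<bar>Z s\<bar>"
    and near1: "\<And>s. s \<in> {t1 - \<zeta>1..t1 + \<xi>1} \<Longrightarrow> c * \<bar>s - t1\<bar> \<le> \<bar>Z s\<bar>"
    and near2: "\<And>s. s \<in> {t2 - \<xi>2..t2 + \<zeta>2} \<Longrightarrow> c * \<bar>s - t2\<bar> \<le> \<bar>Z s\<bar>"
    and j: "j \<in> {1..4 * m}"
  defines "ends \<equiv> \<lambda>k. region_ends P t1 t2 m \<xi>1 \<xi>2 \<zeta>1 \<zeta>2 (\<lambda>i. k powr (- (1 / 3) + \<epsilon> i)) j"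
  shows "\<exists>C\<ge>0. \<forall>k>1. weighted_integral Z (n j) (k powr (- (1 / 3))) (fst (ends k)) (snd (ends k))
     \<le> C * (1 + E_factor m \<epsilon> n k j)\<^sup>2"
proof (cases "n j = 0")
  case True
  have "weighted_integral Z (n j) (k powr (- (1 / 3))) (fst (ends k)) (snd (ends k))
     \<le> 2 * P * (1 + E_factor m \<epsilon> n k j)\<^sup>2" if k: "k > 1" for k
  proof -
    note partition = region_geometry.regions_period_partition[OF region_geometry_of_parameters[OF rp
        P m k]]
    have "weighted_integral Z (n j) (k powr (- (1 / 3))) (fst (ends k)) (snd (ends k)) \<le> 2 * P * 1"
      using True period_partition.nonempty[OF partition j] period_partition.window[OF partition j]
      by (simp add: weighted_integral_def ends_def)
    also have "\<dots> \<le> 2 * P * (1 + E_factor m \<epsilon> n k j)\<^sup>2"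
      using P k E_factor_nonneg[of k m \<epsilon> n j] by (intro mult_left_mono) (simp_all add: power2_sum)
    finally show ?thesis .
  qed
  then show ?thesis using P by (intro exI[of _ "2 * P"]) simp
next
  case False
  then have n: "n j \<ge> 1" by simp
  have pos: "0 < \<xi>1" "0 < \<xi>2" "0 < \<zeta>1" "0 < \<zeta>2" "t1 + \<xi>1 < t2 - \<xi>2" "t2 + \<zeta>2 < 2 * P + t1 - \<zeta>1"
    "0 < \<epsilon> m" "\<epsilon> 1 < 1 / 3"
    using rp by (auto simp: region_parameters_def)
  have eps: "\<epsilon> (i + 1) < \<epsilon> i" "\<epsilon> i < 1 / 3" "0 < \<epsilon> (i + 1)" if "1 \<le> i" "i < m" for i
  proof -
    show "\<epsilon> (i + 1) < \<epsilon> i" using rp that by (simp add: region_parameters_def)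
    show "\<epsilon> i < 1 / 3" using epsilon_decreasing[OF rp, of 1 i] pos(8) that by simp
    show "0 < \<epsilon> (i + 1)" using epsilon_decreasing[OF rp, of "i + 1" m] pos(7) that by simp
  qed
  have eps1: "0 < \<epsilon> 1" "\<epsilon> 1 < 1 / 3" using epsilon_decreasing[OF rp, of 1 m] pos m by auto
  define W where "W = (\<lambda>k i. k powr (- (1 / 3) + \<epsilon> i))"
  have scaled_W: "0 < \<kappa> * W k i" "\<kappa> * W k i \<le> \<kappa>" if "k > 1" "1 \<le> i" "i \<le> m" "0 < \<kappa>" for k i \<kappa>
  proof -
    have "W k i \<le> k powr 0"
      using that epsilon_decreasing[OF rp, of 1 i] pos(8) unfolding W_def by (intro powr_mono) auto
    then show "0 < \<kappa> * W k i" "\<kappa> * W k i \<le> \<kappa>" using that by (auto simp: W_def mult_le_cancel_left1)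
  qed
  have W_chain: "0 < \<kappa> * W k (i + 1)" "\<kappa> * W k (i + 1) \<le> \<kappa> * W k i" "\<kappa> * W k i \<le> \<kappa>"
    if "k > 1" "1 \<le> i" "i < m" "0 < \<kappa>" for k i \<kappa>
    using that scaled_W(1)[of k "i + 1" \<kappa>] scaled_W(2)[of k i \<kappa>] eps(1)[of i]
        by (simp_all add: W_def)
  have transition: ?thesis
    if i: "1 \<le> i" "i < m" "j \<in> {i, m + i, 2 * m + i, 3 * m + i}" and \<kappa>: "\<kappa> > 0"
      and bd: "\<And>k. k > 1 \<Longrightarrow> weighted_integral Z (n j) (k powr (- (1 / 3))) (fst (ends k)) (snd
          (ends k))
        \<le> (\<kappa> * W k i) ^ n j / c ^ (2 * n j) * power_tail (n j) (\<kappa> * W k (i + 1)) (\<kappa> * W k i)"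
            for i \<kappa>
  proof -
    obtain C where C: "C \<ge> 0" "\<And>k. k \<ge> 1 \<Longrightarrow> (\<kappa> * W k i) ^ n j * power_tail (n j) (\<kappa> * W k (i + 1))
        (\<kappa> * W k i)
       \<le> C * (1 + E_factor m \<epsilon> n k j)\<^sup>2"
      using transition_rate[OF \<kappa> eps[OF i(1,2)] n] unfolding E_factor_simps(3)[OF m i] W_def
          by blast
    have "weighted_integral Z (n j) (k powr (- (1 / 3))) (fst (ends k)) (snd (ends k))
       \<le> C / c ^ (2 * n j) * (1 + E_factor m \<epsilon> n k j)\<^sup>2" if "k > 1" for k
      using order_trans[OF bd[OF that]] divide_right_mono[OF C(2)[of k], of "c ^ (2 * n j)"] that c
          by simp
    then show ?thesis using C(1) c by (intro exI[of _ "C / c ^ (2 * n j)"]) simp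
  qed
  have right: ?thesis
    if i: "1 \<le> i" "i < m" "j \<in> {i, m + i, 2 * m + i, 3 * m + i}" and \<kappa>: "\<kappa> > 0"
      and ends: "\<And>k. ends k = (t + \<kappa> * W k (i + 1), t + \<kappa> * W k i)"
      and growth: "\<And>s. s \<in> {t..t + \<kappa>} \<Longrightarrow> c * \<bar>s - t\<bar> \<le> \<bar>Z s\<bar>" for i \<kappa> t
  proof (rule transition[OF i \<kappa>])
    fix k :: real assume k: "k > 1"
    note s = W_chain[OF k i(1,2) \<kappa>]
    have "c * (s - t) \<le> \<bar>Z s\<bar>" if "s \<in> {t + \<kappa> * W k (i + 1)..t + \<kappa> * W k i}" for s
    proof -
      have "s \<in> {t..t + \<kappa>}" "\<bar>s - t\<bar> = s - t"
        using that s unfolding atLeastAtMost_iff by linarith+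
      with growth[of s] show ?thesis by (simp only:)
    qed
    from weighted_integral_right_of_zero[OF Z this c]
    show "weighted_integral Z (n j) (k powr (- (1 / 3))) (fst (ends k)) (snd (ends k))
        \<le> (\<kappa> * W k i) ^ n j / c ^ (2 * n j) * power_tail (n j) (\<kappa> * W k (i + 1)) (\<kappa> * W k i)"
      unfolding ends fst_conv snd_conv using s n k by simp
  qed
  have left: ?thesis
    if i: "1 \<le> i" "i < m" "j \<in> {i, m + i, 2 * m + i, 3 * m + i}" and \<kappa>: "\<kappa> > 0"
      and ends: "\<And>k. ends k = (t - \<kappa> * W k i, t - \<kappa> * W k (i + 1))"
      and growth: "\<And>s. s \<in> {t - \<kappa>..t} \<Longrightarrow> c * \<bar>s - t\<bar> \<le> \<bar>Z s\<bar>" for i \<kappa> t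
  proof (rule transition[OF i \<kappa>])
    fix k :: real assume k: "k > 1"
    note s = W_chain[OF k i(1,2) \<kappa>]
    have "c * (t - s) \<le> \<bar>Z s\<bar>" if "s \<in> {t - \<kappa> * W k i..t - \<kappa> * W k (i + 1)}" for s
    proof -
      have "s \<in> {t - \<kappa>..t}" "\<bar>s - t\<bar> = t - s"
        using that s unfolding atLeastAtMost_iff by linarith+
      with growth[of s] show ?thesis by (simp only:)
    qed
    from weighted_integral_left_of_zero[OF Z this c]
    show "weighted_integral Z (n j) (k powr (- (1 / 3))) (fst (ends k)) (snd (ends k))
        \<le> (\<kappa> * W k i) ^ n j / c ^ (2 * n j) * power_tail (n j) (\<kappa> * W k (i + 1)) (\<kappa> * W k i)"
      unfolding ends fst_conv snd_conv using s n k by simp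
  qed
  have outer: ?thesis
    if j: "j \<in> {m, 2 * m}" and \<kappa>: "\<kappa> > 0" "\<kappa>' > 0" and t: "t < t'"
      and ends: "\<And>k. k > 1 \<Longrightarrow> ends k = (t + \<kappa> * W k 1, t' - \<kappa>' * W k 1)"
      and gap: "t + \<kappa> < t' - \<kappa>'"
      and growth: "\<And>s. s \<in> {t..t'} \<Longrightarrow> c * (s - t) * (t' - s) \<le> \<bar>Z s\<bar>" for t t' \<kappa> \<kappa>'
  proof -
    have Y: "0 < t' - t" using t by simp
    obtain C where C: "C \<ge> 0" "\<And>k y. k \<ge> 1 \<Longrightarrow> 0 < y \<Longrightarrow> y \<le> t' - t \<Longrightarrow>
        power_tail (n j) (\<kappa> * W k 1) y \<le> C * (1 + E_factor m \<epsilon> n k j)\<^sup>2"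
      using outer_rate[OF \<kappa>(1) eps1(2,1) n Y] unfolding E_factor_simps(1)[OF m j] W_def by blast
    obtain C' where C': "C' \<ge> 0" "\<And>k y. k \<ge> 1 \<Longrightarrow> 0 < y \<Longrightarrow> y \<le> t' - t \<Longrightarrow>
        power_tail (n j) (\<kappa>' * W k 1) y \<le> C' * (1 + E_factor m \<epsilon> n k j)\<^sup>2"
      using outer_rate[OF \<kappa>(2) eps1(2,1) n Y] unfolding E_factor_simps(1)[OF m j] W_def by blast
    define K where "K = (2 / (c\<^sup>2 * (t' - t))) ^ n j"
    have K: "K \<ge> 0" using Y by (simp add: K_def)
    have "weighted_integral Z (n j) (k powr (- (1 / 3))) (fst (ends k)) (snd (ends k))
       \<le> K * (C + C') * (1 + E_factor m \<epsilon> n k j)\<^sup>2" if k: "k > 1" for k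
    proof -
      let ?a = "t + \<kappa> * W k 1" and ?b = "t' - \<kappa>' * W k 1"
      have s: "0 < \<kappa> * W k 1" "\<kappa> * W k 1 \<le> \<kappa>" "0 < \<kappa>' * W k 1" "\<kappa>' * W k 1 \<le> \<kappa>'"
        using scaled_W[OF k, of 1] m \<kappa> by auto
      have "weighted_integral Z (n j) (k powr (- (1 / 3))) ?a ?b
          \<le> K * (power_tail (n j) (?a - t) (?b - t) + power_tail (n j) (t' - ?b) (t' - ?a))"
        unfolding K_def
        by (rule weighted_integral_between_zeros[OF Z _ c]) (use s gap n k growth in auto)
      also have "\<dots> \<le> K * (C * (1 + E_factor m \<epsilon> n k j)\<^sup>2 + C' * (1 + E_factor m \<epsilon> n k j)\<^sup>2)"
        using C(2)[of k "?b - t"] C'(2)[of k "t' - ?a"] s gap k K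
        by (intro mult_left_mono add_mono) auto
      finally show ?thesis by (simp add: ends[OF k] distrib_left distrib_right mult.assoc)
    qed
    then show ?thesis using K C(1) C'(1) by (intro exI[of _ "K * (C + C')"]) simp
  qed
  have boundary: ?thesis
    if j: "j \<in> {3 * m, 4 * m}" and \<kappa>: "\<kappa> > 0" "\<kappa>' > 0"
      and ends: "\<And>k. k > 1 \<Longrightarrow> ends k = (t - \<kappa> * W k m, t + \<kappa>' * W k m)"
      and growth: "\<And>s. s \<in> {t - \<kappa>..t + \<kappa>'} \<Longrightarrow> c * \<bar>s - t\<bar> \<le> \<bar>Z s\<bar>" for t \<kappa> \<kappa>'
  proof -
    define K where "K = 2 / c * (\<kappa> + \<kappa>') ^ (2 * n j)"
    have "weighted_integral Z (n j) (k powr (- (1 / 3))) (fst (ends k)) (snd (ends k))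
       \<le> K * (1 + E_factor m \<epsilon> n k j)\<^sup>2" if k: "k > 1" for k
    proof -
      have s: "0 < \<kappa> * W k m" "\<kappa> * W k m \<le> \<kappa>" "0 < \<kappa>' * W k m" "\<kappa>' * W k m \<le> \<kappa>'"
        using scaled_W[OF k, of m] m \<kappa> by auto
      have "weighted_integral Z (n j) (k powr (- (1 / 3))) (t - \<kappa> * W k m) (t + \<kappa>' * W k m)
        \<le> 2 / c * ((t + \<kappa>' * W k m) - (t - \<kappa> * W k m)) ^ (2 * n j) / (k powr (- (1 / 3))) ^
            (2 * n j - 1)"
        by (rule weighted_integral_around_zero[where t = t, OF Z _ c]) (use s n k growth in auto)
      also have "(t + \<kappa>' * W k m) - (t - \<kappa> * W k m) = (\<kappa> + \<kappa>') * W k m"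
        by (simp add: algebra_simps)
      also have "2 / c * ((\<kappa> + \<kappa>') * W k m) ^ (2 * n j) / (k powr (- (1 / 3))) ^ (2 * n j - 1)
        = 2 / c * (((\<kappa> + \<kappa>') * W k m) ^ (2 * n j) / (k powr (- (1 / 3))) ^ (2 * n j - 1))"
        by simp
      also have "\<dots> \<le> 2 / c * ((\<kappa> + \<kappa>') ^ (2 * n j) * (1 + E_factor m \<epsilon> n k j)\<^sup>2)"
        unfolding E_factor_simps(2)[OF m j] W_def using c \<kappa> n k
        by (intro mult_left_mono boundary_rate) auto
      finally show ?thesis by (simp add: ends[OF k] K_def)
    qed
    moreover have "K \<ge> 0" using c \<kappa> by (simp add: K_def)
    ultimately show ?thesis by blast
  qed
  show ?thesis
    using j
  proof (cases rule: region_index_cases)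
    case 1
    show ?thesis
      by (rule outer[of \<xi>1 \<xi>2 t1 t2]) (use 1 pos m lit in \<open>auto simp: ends_def region_ends_simps
          W_def\<close>)
  next
    case 2
    show ?thesis
      by (rule outer[of \<zeta>2 \<zeta>1 t2 "2 * P + t1"]) (use 2 pos m dark in \<open>auto simp: ends_def
          region_ends_simps W_def\<close>)
  next
    case 3
    show ?thesis
      by (rule boundary[of \<zeta>1 \<xi>1 t1]) (use 3 pos m near1 in \<open>auto simp: ends_def region_ends_simps
          W_def\<close>)
  next
    case 4
    show ?thesis
      by (rule boundary[of \<xi>2 \<zeta>2 t2]) (use 4 pos m near2 in \<open>auto simp: ends_def region_ends_simps
          W_def\<close>)
  next
    case (5 i)
    show ?thesis
    proof (rule right[of i \<xi>1 t1])
      show "c * \<bar>s - t1\<bar> \<le> \<bar>Z s\<bar>" if "s \<in> {t1..t1 + \<xi>1}" for s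
        using that pos by (intro near1) simp
    qed (use 5 pos m in \<open>auto simp: ends_def region_ends_simps W_def\<close>)
  next
    case (6 i)
    show ?thesis
    proof (rule left[of i \<xi>2 t2])
      show "c * \<bar>s - t2\<bar> \<le> \<bar>Z s\<bar>" if "s \<in> {t2 - \<xi>2..t2}" for s
        using that pos by (intro near2) simp
    qed (use 6 pos m in \<open>auto simp: ends_def region_ends_simps W_def\<close>)
  next
    case (7 i)
    show ?thesis
    proof (rule left[of i \<zeta>1 t1])
      show "c * \<bar>s - t1\<bar> \<le> \<bar>Z s\<bar>" if "s \<in> {t1 - \<zeta>1..t1}" for s
        using that pos by (intro near1) simp
    qed (use 7 pos m in \<open>auto simp: ends_def region_ends_simps W_def\<close>)
  next
    case (8 i)
    show ?thesis
    proof (rule right[of i \<zeta>2 t2])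
      show "c * \<bar>s - t2\<bar> \<le> \<bar>Z s\<bar>" if "s \<in> {t2..t2 + \<zeta>2}" for s
        using that pos by (intro near2) simp
    qed (use 8 pos m in \<open>auto simp: ends_def region_ends_simps W_def\<close>)
  qed
qed

section \<open>The error estimate\<close>

lemma continuous_periodic_in_L2:
  assumes "P > 0" "continuous_on UNIV g" "\<And>s. g (s + 2 * P) = g s"
  shows "g \<in> L2 P"
proof -
  obtain C where "\<forall>s. norm (g s) \<le> C"
    using continuous_periodic_bounded[of "2 * P" g] assms by auto
  then show ?thesis
    using bounded_periodic_in_L2[of g C P] borel_measurable_continuous_onI[OF assms(2)] assms(3)
        by blast
qed

lemma hormander_class_continuous:
  assumes "a \<in> hormander_class P \<mu> \<rho> \<delta>" "k > 0"
  shows "continuous_on UNIV (\<lambda>s. a s k)"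
proof -
  have smooth: "smooth_on (UNIV \<times> {0<..}) (\<lambda>(s, k). a s k)"
    using assms(1) by (simp add: hormander_class_def)
  have "has_nderiv 0 (\<lambda>s. (\<lambda>(s, k). a s k) ((0, k) + s *\<^sub>R (1, 0)))
     (nderiv 0 (\<lambda>s. (\<lambda>(s, k). a s k) ((0, k) + s *\<^sub>R (1, 0))))"
    using assms(2) by (intro smooth_on_line_has_nderiv[OF smooth]) auto
  from has_nderiv_continuous[OF this] show ?thesis by simp
qed

text \<open>The summand \<open>1\<close> in \<open>1 + E_factor\<close> makes the target positive, so the slack in
  \<open>complex_best_approximation\<close> can be chosen as the square of \<open>k\<^bsup>x\<^esup> / d\<^bsup>n\<^esup>\<close>.\<close>

lemma piecewise_polynomial_approximation:
  fixes f :: "real \<Rightarrow> real \<Rightarrow> complex" and n :: "nat \<Rightarrow> nat"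
  assumes rp: "region_parameters P t1 t2 m \<epsilon> \<xi>1 \<xi>2 \<zeta>1 \<zeta>2" and P: "P > 0" and m: "m \<ge> 1"
    and t: "0 < t1" "t1 < t2" "t2 < 2 * P"
    and data: "expansion_data P t1 t2 b \<Psi> Z"
    and f: "nderiv_bounded (n j) x Z f" and j: "j \<in> {1..4 * m}"
  shows "\<exists>C>0. \<forall>k>1. \<forall>d\<ge>1. n j \<le> d + 1 \<longrightarrow>
    (\<exists>p. degree p \<le> d \<and> integral (region P t1 t2 m \<epsilon> \<xi>1 \<xi>2 \<zeta>1 \<zeta>2 k j)
        (\<lambda>s. (norm (f s k - poly p (of_real s)))\<^sup>2)
      \<le> (C * k powr x * ((1 + E_factor m \<epsilon> n k j) / real d ^ n j))\<^sup>2)"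
proof -
  define ends where "ends = (\<lambda>k. region_ends P t1 t2 m \<xi>1 \<xi>2 \<zeta>1 \<zeta>2 (\<lambda>i. k powr (- (1 / 3) + \<epsilon> i))
      j)"
  have Z: "continuous_on UNIV Z"
    using data smooth_on_UNIV_has_nderiv[of Z] has_nderiv_continuous
        by (auto simp: expansion_data_def)
  obtain c where c: "c > 0" "\<forall>s\<in>{t1..t2}. c * (s - t1) * (t2 - s) \<le> \<bar>Z s\<bar>"
    "\<forall>s\<in>{t2..2 * P + t1}. c * (s - t2) * (2 * P + t1 - s) \<le> \<bar>Z s\<bar>"
    "\<forall>s\<in>{t1 - \<zeta>1..t1 + \<xi>1}. c * \<bar>s - t1\<bar> \<le> \<bar>Z s\<bar>"
    "\<forall>s\<in>{t2 - \<xi>2..t2 + \<zeta>2}. c * \<bar>s - t2\<bar> \<le> \<bar>Z s\<bar>"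
    using expansion_data_growth[OF data t, of \<xi>1 \<xi>2 \<zeta>2 \<zeta>1] rp by (auto simp: region_parameters_def)
  have "\<exists>C\<ge>0. \<forall>k>1. weighted_integral Z (n j) (k powr (- (1 / 3))) (fst (ends k)) (snd (ends k))
     \<le> C * (1 + E_factor m \<epsilon> n k j)\<^sup>2"
    unfolding ends_def
    by (rule region_weighted_integral_rate[OF rp P m Z c(1) _ _ _ _ j]) (use c in auto)
  then obtain C1 where C1: "C1 \<ge> 0" "\<And>k. k > 1 \<Longrightarrow>
      weighted_integral Z (n j) (k powr (- (1 / 3))) (fst (ends k)) (snd (ends k))
        \<le> C1 * (1 + E_factor m \<epsilon> n k j)\<^sup>2"
    by blast
  obtain D where D: "D \<ge> 0" "\<And>k. k \<ge> 1 \<Longrightarrow> \<exists>h. has_nderiv (n j) (\<lambda>s. f s k) h \<and>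
     (\<forall>s. norm (h s) \<le> D * k powr x / (k powr (- (1 / 3)) + \<bar>Z s\<bar>) ^ n j)"
    using f unfolding nderiv_bounded_def by blast
  define K where "K = 4 * real (n j) ^ n j * D\<^sup>2 * C1 + 1"
  have K: "K \<ge> 1" using C1(1) by (simp add: K_def)
  have "\<exists>p. degree p \<le> d \<and> integral (region P t1 t2 m \<epsilon> \<xi>1 \<xi>2 \<zeta>1 \<zeta>2 k j)
        (\<lambda>s. (norm (f s k - poly p (of_real s)))\<^sup>2)
      \<le> (sqrt K * k powr x * ((1 + E_factor m \<epsilon> n k j) / real d ^ n j))\<^sup>2"
    if k: "k > 1" and d: "d \<ge> 1" "n j \<le> d + 1" for k d
  proof -
    define E where "E = E_factor m \<epsilon> n k j"
    have E: "E \<ge> 0" using E_factor_nonneg k by (simp add: E_def)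
    define lo where "lo = fst (ends k)"
    define hi where "hi = snd (ends k)"
    have less: "lo < hi"
      using period_partition.nonempty[OF region_geometry.regions_period_partition[OF
            region_geometry_of_parameters[OF rp P m k]] j]
      by (simp add: lo_def hi_def ends_def)
    interpret proper_interval lo hi by standard (rule less)
    have region: "region P t1 t2 m \<epsilon> \<xi>1 \<xi>2 \<zeta>1 \<zeta>2 k j = {lo..hi}"
      by (simp add: region_eq_ends lo_def hi_def ends_def)
    obtain h where h: "has_nderiv (n j) (\<lambda>s. f s k) h"
      "\<And>s. norm (h s) \<le> D * k powr x / (k powr (- (1 / 3)) + \<bar>Z s\<bar>) ^ n j"
      using D(2)[of k] k by auto
    \<comment> \<open>The slack is the square of the target without the constant and without the factor 1 + E.\<close>
    define e where "e = (k powr x)\<^sup>2 / (real d ^ n j)\<^sup>2"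
    have e: "e > 0" using k d by (simp add: e_def)
    obtain p where p: "degree p \<le> d" "integral {lo..hi} (\<lambda>s. (norm (f s k - poly p (of_real s)))\<^sup>2)
        \<le> 4 * (real (n j) ^ n j / real d ^ (2 * n j)) * weighted_seminorm2 (n j) h + e"
      using complex_best_approximation[OF h(1) d e] by blast
    have hpos: "k powr (- (1 / 3)) + \<bar>Z s\<bar> > 0" for s
      using k by (intro add_pos_nonneg) auto
    have "weighted_seminorm2 (n j) h
        \<le> integral {lo..hi} (\<lambda>s. (D * k powr x)\<^sup>2 * (((s - lo) * (hi - s)) ^ n j / (k powr (-
            (1 / 3)) + \<bar>Z s\<bar>) ^ (2 * n j)))"
      unfolding weighted_seminorm2_def
    proof (rule integral_le)
      have "continuous_on {lo..hi} h"
        using has_nderiv_continuous_deriv[OF h(1)] continuous_on_subset by blast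
      then show "(\<lambda>s. ((s - lo) * (hi - s)) ^ n j * (norm (h s))\<^sup>2) integrable_on {lo..hi}"
        by (intro integrable_continuous_interval continuous_intros)
      have "k powr (- (1 / 3)) + \<bar>Z s\<bar> \<noteq> 0" for s using hpos[of s] by simp
      then show "(\<lambda>s. (D * k powr x)\<^sup>2 * (((s - lo) * (hi - s)) ^ n j / (k powr (- (1 / 3)) + \<bar>Z s\<bar>)
          ^ (2 * n j))) integrable_on {lo..hi}"
        by (intro integrable_continuous_interval continuous_intros continuous_on_subset[OF Z]) auto
      fix s assume s: "s \<in> {lo..hi}"
      have "(norm (h s))\<^sup>2 \<le> (D * k powr x / (k powr (- (1 / 3)) + \<bar>Z s\<bar>) ^ n j)\<^sup>2"
        by (intro power_mono h(2)) simp
      also have "\<dots> = (D * k powr x)\<^sup>2 / (k powr (- (1 / 3)) + \<bar>Z s\<bar>) ^ (2 * n j)"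
        by (simp add: power_divide mult.commute flip: power_mult)
      finally have "((s - lo) * (hi - s)) ^ n j * (norm (h s))\<^sup>2
          \<le> ((s - lo) * (hi - s)) ^ n j * ((D * k powr x)\<^sup>2 / (k powr (- (1 / 3)) + \<bar>Z s\<bar>) ^
              (2 * n j))"
        by (rule mult_left_mono[OF _ weight_nonneg[OF s]])
      then show "((s - lo) * (hi - s)) ^ n j * (norm (h s))\<^sup>2
          \<le> (D * k powr x)\<^sup>2 * (((s - lo) * (hi - s)) ^ n j / (k powr (- (1 / 3)) + \<bar>Z s\<bar>) ^
              (2 * n j))"
        by (simp only: times_divide_eq_right mult.commute)
    qed
    also have "\<dots> = (D * k powr x)\<^sup>2 * weighted_integral Z (n j) (k powr (- (1 / 3))) lo hi"
      unfolding weighted_integral_def by (rule integral_mult_right)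
    also have "\<dots> \<le> (D * k powr x)\<^sup>2 * (C1 * (1 + E)\<^sup>2)"
      using C1(2)[OF k] by (intro mult_left_mono) (auto simp: E_def lo_def hi_def)
    finally have semi: "weighted_seminorm2 (n j) h \<le> (D * k powr x)\<^sup>2 * (C1 * (1 + E)\<^sup>2)" .
    have "integral {lo..hi} (\<lambda>s. (norm (f s k - poly p (of_real s)))\<^sup>2)
        \<le> 4 * (real (n j) ^ n j / real d ^ (2 * n j)) * ((D * k powr x)\<^sup>2 * (C1 * (1 + E)\<^sup>2)) + e *
            (1 + E)\<^sup>2"
    proof (rule order_trans[OF p(2) add_mono])
      show "e \<le> e * (1 + E)\<^sup>2"
        using e E mult_left_mono[of 1 "(1 + E)\<^sup>2" e] by (simp add: power2_sum)
    qed (intro mult_left_mono semi, simp)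
    also have "\<dots> = K * ((k powr x)\<^sup>2 * ((1 + E)\<^sup>2 / (real d ^ n j)\<^sup>2))"
      using d by (simp add: K_def e_def power_mult_distrib power_mult field_simps power_even_eq)
    also have "\<dots> = (sqrt K * k powr x * ((1 + E) / real d ^ n j))\<^sup>2"
      using K by (simp add: power_mult_distrib power_divide)
    finally show ?thesis
      using p(1) unfolding region E_def by blast
  qed
  then show ?thesis using K by (intro exI[of _ "sqrt K"]) auto
qed

theorem theorem11:
  fixes K :: "(real ^ 2) set" and P t1 t2 :: real and \<gamma> :: "real \<Rightarrow> real ^ 2"
    and \<alpha> :: "real ^ 2" and u :: "real \<Rightarrow> real ^ 2 \<Rightarrow> complex"
    and b :: "index \<Rightarrow> real \<Rightarrow> complex" and \<Psi> :: "nat \<Rightarrow> int \<Rightarrow> real \<Rightarrow> complex"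
    and Z :: "real \<Rightarrow> real"
    and k0 :: real and R :: "real \<Rightarrow> (real \<Rightarrow> complex) \<Rightarrow> real \<Rightarrow> complex"
    and f :: "real \<Rightarrow> real \<Rightarrow> complex" and Cc cc :: "real \<Rightarrow> real"
    and \<beta> m :: nat and n :: "nat \<Rightarrow> nat"
    and \<epsilon> :: "nat \<Rightarrow> real" and \<xi>1 \<xi>2 \<zeta>1 \<zeta>2 :: real
  assumes obstacle: "compact K" "strictly_convex K" "boundary_parametrization K P \<gamma>"
    and direction: "norm \<alpha> = 1"
    and shadow: "shadow_boundary_points P \<gamma> \<alpha> t1 t2"
    and scattering: "\<And>k. k > 0 \<Longrightarrow> scattered_field K \<gamma> \<alpha> k (u k)"
    and symbol: "eta_slow \<alpha> \<gamma> u \<in> hormander_class P 0 (2 / 3) (1 / 3)"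
    and data: "expansion_data P t1 t2 b \<Psi> Z"
    and expansion: "asymptotic_expansion P (eta_slow \<alpha> \<gamma> u) (expansion_term b \<Psi> Z)"
    and k0: "k0 > 1"
    and operator: "\<And>k. k \<ge> k0 \<Longrightarrow> L2_linear_operator P (R k)"
    and coercive: "\<And>k. k \<ge> k0 \<Longrightarrow> continuous_coercive P (R k) (Cc k) (cc k)"
    and rhs: "\<And>k. k \<ge> k0 \<Longrightarrow> f k \<in> L2 P"
    and equation: "\<And>k. k \<ge> k0 \<Longrightarrow> AE s in lborel. R k (\<lambda>s. eta \<alpha> \<gamma> u s k) s = f k s"
    and m: "m \<ge> 1"
    and regions: "region_parameters P t1 t2 m \<epsilon> \<xi>1 \<xi>2 \<zeta>1 \<zeta>2"
  shows "\<exists>C>0. \<forall>k\<ge>k0. \<forall>d :: nat \<Rightarrow> nat.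
     (\<forall>j\<in>{1..4 * m}. d j \<ge> 1 \<and> int (d j) \<ge> int (n j) - 1) \<longrightarrow>
     L2_norm P (\<lambda>s. eta \<alpha> \<gamma> u s k
        - galerkin_approximation P (R k) (f k)
            (galerkin_space P \<alpha> \<gamma> m (region P t1 t2 m \<epsilon> \<xi>1 \<xi>2 \<zeta>1 \<zeta>2 k) d k)
            (\<lambda>s. sigma \<alpha> \<gamma> (expansion_term b \<Psi> Z) \<beta> s k) s)
     \<le> C * (Cc k / cc k) * k powr (- real \<beta> / 3)
       * (\<Sum>j=1..4 * m. (1 + E_factor m \<epsilon> n k j) / real (d j) ^ n j)"
proof -
  let ?A = "expansion_term b \<Psi> Z"
  let ?R = "region P t1 t2 m \<epsilon> \<xi>1 \<xi>2 \<zeta>1 \<zeta>2"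
  have P: "P > 0" and \<gamma>: "\<And>s. \<gamma> (s + 2 * P) = \<gamma> s" "smooth_on UNIV \<gamma>"
    using obstacle(3) by (auto simp: boundary_parametrization_def)
  have t: "0 < t1" "t1 < t2" "t2 < 2 * P"
    using shadow by (auto simp: shadow_boundary_points_def)
  define r where "r = (\<lambda>s k. eta_slow \<alpha> \<gamma> u s k - sigma_slow ?A \<beta> s k)"
  have eta_slow_per: "eta_slow \<alpha> \<gamma> u (s + 2 * P) k = eta_slow \<alpha> \<gamma> u s k" for s k
    by (simp add: eta_slow_def eta_def \<gamma>)
  have r_bounded: "nderiv_bounded i (- real \<beta> / 3) Z r" for i
    unfolding r_def by (rule truncated_expansion_bound[OF data P eta_slow_per expansion])
  have "\<forall>j\<in>{1..4 * m}. \<exists>C>0. \<forall>k>1. \<forall>d\<ge>1. n j \<le> d + 1 \<longrightarrow>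
    (\<exists>p. degree p \<le> d \<and> integral (?R k j) (\<lambda>s. (norm (r s k - poly p (of_real s)))\<^sup>2)
      \<le> (C * k powr (- real \<beta> / 3) * ((1 + E_factor m \<epsilon> n k j) / real d ^ n j))\<^sup>2)"
    using piecewise_polynomial_approximation[OF regions P m t data r_bounded] by blast
  from bchoice[OF this] obtain C where C: "\<And>j. j \<in> {1..4 * m} \<Longrightarrow> C j > 0"
    "\<And>j k d. j \<in> {1..4 * m} \<Longrightarrow> k > 1 \<Longrightarrow> d \<ge> 1 \<Longrightarrow> n j \<le> d + 1 \<Longrightarrow>
      \<exists>p. degree p \<le> d \<and> integral (?R k j) (\<lambda>s. (norm (r s k - poly p (of_real s)))\<^sup>2)
      \<le> (C j * k powr (- real \<beta> / 3) * ((1 + E_factor m \<epsilon> n k j) / real d ^ n j))\<^sup>2"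
    by blast
  define C0 where "C0 = (\<Sum>j=1..4 * m. C j)"
  have C_le: "C j \<le> C0" if "j \<in> {1..4 * m}" for j
    unfolding C0_def using that C(1) by (intro member_le_sum) (auto intro: less_imp_le)
  have C0: "C0 > 0" using C_le[of 1] C(1)[of 1] m by simp
  have "L2_norm P (\<lambda>s. eta \<alpha> \<gamma> u s k
        - galerkin_approximation P (R k) (f k) (galerkin_space P \<alpha> \<gamma> m (?R k) d k)
            (\<lambda>s. sigma \<alpha> \<gamma> ?A \<beta> s k) s)
     \<le> C0 * (Cc k / cc k) * k powr (- real \<beta> / 3)
       * (\<Sum>j=1..4 * m. (1 + E_factor m \<epsilon> n k j) / real (d j) ^ n j)"
    if k: "k \<ge> k0" and d: "\<forall>j\<in>{1..4 * m}. d j \<ge> 1 \<and> int (d j) \<ge> int (n j) - 1"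
        for k and d :: "nat \<Rightarrow> nat"
  proof -
    have k1: "k > 1" using k k0 by simp
    define ends where "ends = region_ends P t1 t2 m \<xi>1 \<xi>2 \<zeta>1 \<zeta>2 (\<lambda>i. k powr (- (1 / 3) + \<epsilon> i))"
    interpret period_partition P "t1 - \<zeta>1 * k powr (- (1 / 3) + \<epsilon> 1)" "4 * m"
      "\<lambda>j. fst (ends j)" "\<lambda>j. snd (ends j)"
      unfolding ends_def
      by (rule region_geometry.regions_period_partition[OF
            region_geometry_of_parameters[OF regions P m k1]])
    have region: "?R k j = {fst (ends j)..snd (ends j)}" for j
      by (simp add: region_eq_ends ends_def)
    let ?\<theta> = "\<lambda>s. phase \<alpha> \<gamma> s k"
    let ?G = "galerkin_space P \<alpha> \<gamma> m (?R k) d k"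
    have \<theta>_per: "?\<theta> (s + 2 * P) = ?\<theta> s" for s by (simp add: phase_def \<gamma>)
    have \<theta>_norm: "norm (?\<theta> s) = 1" for s by (simp add: phase_def norm_exp_i_times)
    have \<theta>_cont: "continuous_on UNIV ?\<theta>"
      unfolding phase_def
      by (intro continuous_intros has_nderiv_continuous[OF smooth_on_UNIV_has_nderiv[OF \<gamma>(2)]])
    have G_eq: "?G = {\<lambda>s. ?\<theta> s * pieces p s | p. \<forall>j\<in>{1..4 * m}. degree (p j) \<le> d j}"
      by (simp add: galerkin_space_def pieces_def region)
    have G_fin: "finitely_spanned ?G"
      unfolding galerkin_space_def by (rule finitely_spanned_pieces)
    have G_L2: "?G \<subseteq> L2 P"
      unfolding G_eq using weighted_pieces_in_L2[OF \<theta>_cont \<theta>_norm \<theta>_per] by auto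
    have G_def: "g = (\<lambda>_. 0)" if "g \<in> ?G" "L2_norm P g = 0" for g
      using that unfolding G_eq using weighted_pieces_eq_zero[where \<theta> = ?\<theta>, OF \<theta>_norm] by blast
    obtain h where "has_nderiv 0 (\<lambda>s. r s k) h"
      using r_bounded[of 0] k1 unfolding nderiv_bounded_def by (meson less_imp_le)
    then have r_cont: "continuous_on UNIV (\<lambda>s. r s k)" by (rule has_nderiv_continuous)
    have eta_slow_cont: "continuous_on UNIV (\<lambda>s. eta_slow \<alpha> \<gamma> u s k)"
      by (rule hormander_class_continuous[OF symbol]) (use k1 in simp)
    have sigma_slow_eq: "sigma_slow ?A \<beta> s k = eta_slow \<alpha> \<gamma> u s k - r s k" for s
      by (simp add: r_def)
    have eta_eq: "eta \<alpha> \<gamma> u s k = ?\<theta> s * eta_slow \<alpha> \<gamma> u s k" for s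
      by (simp add: phase_def eta_slow_def mult.assoc[symmetric] flip: exp_add)
    have per_A: "?A i (s + 2 * P) k = ?A i s k" if "i \<in> indices" for i s
      using data that by (cases i) (auto simp: expansion_data_def expansion_term_def)
    have sigma_slow_per: "sigma_slow ?A \<beta> (s + 2 * P) k = sigma_slow ?A \<beta> s k" for s
      unfolding sigma_slow_def by (intro sum.cong refl per_A) (auto simp: F_idx_def)
    have r_per: "r (s + 2 * P) k = r s k" for s
      by (simp add: r_def eta_slow_per sigma_slow_per)
    have eta_L2: "(\<lambda>s. eta \<alpha> \<gamma> u s k) \<in> L2 P"
      unfolding eta_eq
      by (intro continuous_periodic_in_L2[OF P] continuous_intros \<theta>_cont eta_slow_cont)
         (simp add: \<theta>_per eta_slow_per)
    have sigma_L2: "(\<lambda>s. sigma \<alpha> \<gamma> ?A \<beta> s k) \<in> L2 P"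
      unfolding sigma_def sigma_slow_eq
      by (intro continuous_periodic_in_L2[OF P] continuous_intros \<theta>_cont eta_slow_cont r_cont)
         (simp add: \<theta>_per eta_slow_per r_per)
    define S where "S = (\<lambda>j. C j * k powr (- real \<beta> / 3) * ((1 + E_factor m \<epsilon> n k j) / real (d j)
        ^ n j))"
    have "\<forall>j\<in>{1..4 * m}. \<exists>p. degree p \<le> d j \<and>
        integral (?R k j) (\<lambda>s. (norm (r s k - poly p (of_real s)))\<^sup>2) \<le> (S j)\<^sup>2"
      unfolding S_def
    proof (intro ballI C(2) k1)
      fix j assume "j \<in> {1..4 * m}"
      with d have "1 \<le> d j \<and> int (d j) \<ge> int (n j) - 1" by blast
      then show "1 \<le> d j" "n j \<le> d j + 1" by linarith+
    qed
    from bchoice[OF this] obtain p where p: "\<And>j. j \<in> {1..4 * m} \<Longrightarrow> degree (p j) \<le> d j"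
      "\<And>j. j \<in> {1..4 * m} \<Longrightarrow>
        integral (?R k j) (\<lambda>s. (norm (r s k - poly (p j) (of_real s)))\<^sup>2) \<le> (S j)\<^sup>2"
      by blast
    define \<mu> where "\<mu> = (\<lambda>s. ?\<theta> s * pieces p s)"
    have "\<mu> \<in> ?G" unfolding G_eq \<mu>_def using p(1) by blast
    have E: "0 \<le> (1 + E_factor m \<epsilon> n k j) / real (d j) ^ n j" for j
      using E_factor_nonneg[of k m \<epsilon> n j] k1 by simp
    have S: "0 \<le> S j" if "j \<in> {1..4 * m}" for j
      unfolding S_def using C(1)[OF that] E by (intro mult_nonneg_nonneg) (auto intro: less_imp_le)
    have error: "(\<lambda>s. eta \<alpha> \<gamma> u s k - sigma \<alpha> \<gamma> ?A \<beta> s k - \<mu> s) = (\<lambda>s. ?\<theta> s * (r s k - pieces p s))"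
      by (simp add: eta_eq sigma_def \<mu>_def r_def algebra_simps)
    have "(L2_norm P (\<lambda>s. eta \<alpha> \<gamma> u s k - sigma \<alpha> \<gamma> ?A \<beta> s k - \<mu> s))\<^sup>2
        = (\<Sum>j=1..4 * m. integral (?R k j) (\<lambda>s. (norm (r s k - poly (p j) (of_real s)))\<^sup>2))"
      unfolding error region by (rule L2_norm_minus_pieces[OF r_cont r_per \<theta>_norm])
    also have "\<dots> \<le> (\<Sum>j=1..4 * m. (S j)\<^sup>2)"
      by (intro sum_mono p(2))
    also have "\<dots> \<le> (\<Sum>j=1..4 * m. S j)\<^sup>2"
    proof -
      have "(\<Sum>j\<in>J. (S j)\<^sup>2) \<le> (\<Sum>j\<in>J. S j)\<^sup>2" if "finite J" "J \<subseteq> {1..4 * m}" for J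
        using that
      proof (induction J)
        case (insert j J)
        have "0 \<le> 2 * S j * (\<Sum>j\<in>J. S j)"
          using S insert.prems by (intro mult_nonneg_nonneg sum_nonneg) auto
        with insert show ?case by (simp add: power2_sum)
      qed simp
      then show ?thesis by blast
    qed
    finally have "L2_norm P (\<lambda>s. eta \<alpha> \<gamma> u s k - sigma \<alpha> \<gamma> ?A \<beta> s k - \<mu> s) \<le> (\<Sum>j=1..4 * m. S j)"
      by (rule power2_le_imp_le) (intro sum_nonneg S)
    also have "\<dots> \<le> (\<Sum>j=1..4 * m. C0 * k powr (- real \<beta> / 3) * ((1 + E_factor m \<epsilon> n k j) / real (d j)
        ^ n j))"
      unfolding S_def using C_le E by (intro sum_mono mult_right_mono) auto
    also have "\<dots> = C0 * k powr (- real \<beta> / 3) * (\<Sum>j=1..4 * m. (1 + E_factor m \<epsilon> n k j) / real (d j)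
        ^ n j)"
      by (rule sum_distrib_left[symmetric])
    finally have best: "L2_norm P (\<lambda>s. eta \<alpha> \<gamma> u s k - sigma \<alpha> \<gamma> ?A \<beta> s k - \<mu> s)
      \<le> C0 * k powr (- real \<beta> / 3) * (\<Sum>j=1..4 * m. (1 + E_factor m \<epsilon> n k j) / real (d j) ^ n j)" .
    have "0 \<le> Cc k / cc k"
      using coercive[OF k] by (simp add: continuous_coercive_def)
    from mult_left_mono[OF best this]
    show ?thesis
      using galerkin_quasi_optimal[OF operator[OF k] coercive[OF k] rhs[OF k] eta_L2 equation[OF k]
          sigma_L2 G_fin G_L2 G_def \<open>\<mu> \<in> ?G\<close>]
      by (simp add: mult_ac)
  qed
  then show ?thesis using C0 by blast
qed

end
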